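(* Let $P(n,l)\subseteq\mathbb{R}^2$ be a regular polygon with $n\ge 3$ vertices and side length $l>0$. Label its sides counterclockwise as $l_1,l_2,\dots,l_n$, and let $d_i(x)=\mathrm{dist}(x,l_i)$. If $\varphi_{P(n,l)}$ is the principal Dirichlet Laplacian eigenfunction of $P(n,l)$ normalized so that $\|\varphi_{P(n,l)}\|_{L^2(P(n,l))}=1$, then on $P(n,l)$ $$\varphi_{P(n,l)}\asymp\frac{\min\{d_1d_2,d_2d_3,\dots,d_nd_1\}\cdot\min\{d_1+d_2,d_2+d_3,\dots,d_n+d_1\}^{\frac{n}{n-2}-2}}{(nl)^{\frac{n}{n-2}+1}},$$ where the implied constants are absolute (in particular independent of $n$ and $l$).
   Context: The principal Dirichlet Laplacian eigenfunction of a bounded domain is the positive first eigenfunction of the Laplacian with Dirichlet boundary conditions. $A\asymp B$ means $C^{-1}B\le A\le CB$ for a constant $C\ge1$ (here absolute). *)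

theory Defs
  imports "HOL-Analysis.Analysis"
begin

text \<open>
  Twice continuous (Frechet) differentiability on an open set. The second derivative at a point
  is the bounded bilinear map \<open>h \<mapsto> k \<mapsto> D\<^sup>2u(x)[h, k]\<close>.
\<close>

definition C2_on :: "'a::euclidean_space set \<Rightarrow> ('a \<Rightarrow> real) \<Rightarrow> bool" where
  "C2_on U u \<longleftrightarrow>
     (\<exists>(Du :: 'a \<Rightarrow> 'a \<Rightarrow>\<^sub>L real) (D2u :: 'a \<Rightarrow> 'a \<Rightarrow>\<^sub>L 'a \<Rightarrow>\<^sub>L real).
        (\<forall>x\<in>U. (u has_derivative blinfun_apply (Du x)) (at x)) \<and>
        (\<forall>x\<in>U. (Du has_derivative blinfun_apply (D2u x)) (at x)) \<and>
        continuous_on U D2u)"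

definition laplacian :: "('a::euclidean_space \<Rightarrow> real) \<Rightarrow> 'a \<Rightarrow> real" where
  "laplacian u x = (\<Sum>b\<in>Basis. (deriv ^^ 2) (\<lambda>t::real. u (x + t *\<^sub>R b)) 0)"

text \<open>
  Classical Dirichlet eigenfunctions: solutions in \<open>C\<^sup>2(U) \<inter> C(closure U)\<close> of \<open>- \<Delta>u = \<mu>u\<close>,
  not identically zero, with zero boundary values. On a bounded domain all of whose boundary points
  are regular for the Dirichlet problem (in particular on a polygon) these are exactly the
  continuous representatives of the eigenfunctions of the Dirichlet Laplacian on \<open>L\<^sup>2(U)\<close>.
\<close>

definition dirichlet_eigenfunction ::
    "'a::euclidean_space set \<Rightarrow> real \<Rightarrow> ('a \<Rightarrow> real) \<Rightarrow> bool" where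
  "dirichlet_eigenfunction U \<mu> u \<longleftrightarrow>
     C2_on U u \<and> continuous_on (closure U) u \<and>
     (\<forall>x\<in>U. - laplacian u x = \<mu> * u x) \<and>
     (\<forall>x\<in>frontier U. u x = 0) \<and>
     (\<exists>x\<in>U. u x \<noteq> 0)"

definition first_dirichlet_eigenvalue :: "'a::euclidean_space set \<Rightarrow> real \<Rightarrow> bool" where
  "first_dirichlet_eigenvalue U \<mu> \<longleftrightarrow>
     (\<exists>u. dirichlet_eigenfunction U \<mu> u) \<and>
     (\<forall>\<nu> u. dirichlet_eigenfunction U \<nu> u \<longrightarrow> \<mu> \<le> \<nu>)"

definition principal_dirichlet_eigenfunction ::
    "'a::euclidean_space set \<Rightarrow> ('a \<Rightarrow> real) \<Rightarrow> bool" where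
  "principal_dirichlet_eigenfunction U \<phi> \<longleftrightarrow>
     (\<exists>\<mu>. first_dirichlet_eigenvalue U \<mu> \<and> dirichlet_eigenfunction U \<mu> \<phi>) \<and>
     (\<forall>x\<in>U. \<phi> x > 0)"

definition L2_norm_on :: "'a::euclidean_space set \<Rightarrow> ('a \<Rightarrow> real) \<Rightarrow> real" where
  "L2_norm_on U f = sqrt (LINT x:U|lborel. (f x)\<^sup>2)"

text \<open>
  Every regular \<open>n\<close>-gon of side length \<open>l\<close> arises for some centre \<open>c\<close> and some angle \<open>\<theta>\<close>;
  its circumradius is \<open>l / (2 sin (\<pi>/n))\<close>. Vertices and sides are numbered counterclockwise
  from \<open>0\<close> to \<open>n - 1\<close>. The polygon is taken as an open set, on which all distances to the sides are
  positive.
\<close>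

definition regular_polygon_vertex ::
    "nat \<Rightarrow> real \<Rightarrow> real^2 \<Rightarrow> real \<Rightarrow> nat \<Rightarrow> real^2" where
  "regular_polygon_vertex n l c \<theta> k =
     c + (l / (2 * sin (pi / real n))) *\<^sub>R
         vector [cos (\<theta> + 2 * pi * real k / real n), sin (\<theta> + 2 * pi * real k / real n)]"

definition regular_polygon :: "nat \<Rightarrow> real \<Rightarrow> real^2 \<Rightarrow> real \<Rightarrow> (real^2) set" where
  "regular_polygon n l c \<theta> = interior (convex hull (regular_polygon_vertex n l c \<theta> ` {..<n}))"

definition regular_polygon_side ::
    "nat \<Rightarrow> real \<Rightarrow> real^2 \<Rightarrow> real \<Rightarrow> nat \<Rightarrow> (real^2) set" where
  "regular_polygon_side n l c \<theta> i =
     closed_segment (regular_polygon_vertex n l c \<theta> i)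
                    (regular_polygon_vertex n l c \<theta> (Suc i mod n))"

definition side_dist ::
    "nat \<Rightarrow> real \<Rightarrow> real^2 \<Rightarrow> real \<Rightarrow> nat \<Rightarrow> real^2 \<Rightarrow> real" where
  "side_dist n l c \<theta> i x = infdist x (regular_polygon_side n l c \<theta> i)"

lemma regular_polygon_vertex_periodic:
  assumes "n \<ge> 1"
  shows "regular_polygon_vertex n l c \<theta> (k + n) = regular_polygon_vertex n l c \<theta> k"
proof -
  have "\<theta> + 2 * pi * real (k + n) / real n = \<theta> + 2 * pi * real k / real n + 2 * pi"
    using assms by (simp add: field_simps)
  then show ?thesis by (simp only: regular_polygon_vertex_def sin_periodic cos_periodic)
qed

lemma dist_regular_polygon_vertex_Suc:
  assumes "n \<ge> 3" "l > 0"
  shows "dist (regular_polygon_vertex n l c \<theta> k) (regular_polygon_vertex n l c \<theta> (Suc k)) = l"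
proof -
  define R where "R = l / (2 * sin (pi / real n))"
  define a where "a = \<theta> + 2 * pi * real k / real n"
  define h where "h = pi / real n"
  have b: "\<theta> + 2 * pi * real (Suc k) / real n = a + 2 * h"
    using assms by (simp add: a_def h_def field_simps)
  have "0 < h" "h < pi" using assms by (auto simp: h_def field_simps)
  then have s: "sin h > 0" by (rule sin_gt_zero)
  have Rl: "2 * R * sin h = l" using s by (simp add: R_def h_def)
  have c: "cos a - cos (a + 2 * h) = 2 * sin (a + h) * sin h"
    by (simp add: cos_diff_cos)
       (simp add: add_divide_distrib)
  have d: "sin a - sin (a + 2 * h) = - (2 * cos (a + h) * sin h)"
    by (simp add: sin_diff_sin)
       (simp add: add_divide_distrib)
  have "(dist (regular_polygon_vertex n l c \<theta> k) (regular_polygon_vertex n l c \<theta> (Suc k)))\<^sup>2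
      = (R * (cos a - cos (a + 2 * h)))\<^sup>2 + (R * (sin a - sin (a + 2 * h)))\<^sup>2"
    unfolding regular_polygon_vertex_def b R_def[symmetric] a_def[symmetric]
    by (simp add: dist_norm norm_vec_def L2_set_def sum_2 vector_2 right_diff_distrib)
  also have "\<dots> = (2 * R * sin h)\<^sup>2 * ((sin (a + h))\<^sup>2 + (cos (a + h))\<^sup>2)"
    unfolding c d by algebra
  also have "\<dots> = l\<^sup>2" by (simp only: Rl sin_cos_squared_add mult_1_right)
  finally show ?thesis using assms by (simp add: power2_eq_iff_nonneg)
qed

end

theory Submission
  imports Defs
begin

text \<open>
  After a similarity the polygon has centre 0 and inradius 1, and everything is a comparison with
  explicit barriers by the maximum principle. A square inscribed in the polygon bounds the
  eigenvalue from above, and a parabola in the distance to a side line bounds the eigenfunction by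
  its maximum \<open>M\<close> times that distance. Hence the maximum is attained far from the boundary;
  reflecting in lines gives a gradient bound there, and a chain of discs carries a lower bound of
  order \<open>M\<close> to the centre and then to the whole incircle.

  Near a vertex the model is the harmonic function \<open>w = r\<^sup>p cos (p\<psi>)\<close>, \<open>p = n / (n - 2)\<close>,
  of the sector spanned by the two adjacent sides. The disc about a vertex of radius half the side
  length meets the incircle orthogonally at the midpoints of the adjacent sides, so on its arc the
  lower bound on the incircle is comparable to \<open>w\<close>, and it propagates into the corner; for the
  upper bound \<open>w (1 - 4 r\<^sup>2)\<close> is a supersolution. Thus \<open>\<phi>\<close> is comparable to \<open>M\<close> times the
  distance to the boundary times \<open>r\<^bsup>p-1\<^esup>\<close>, with \<open>r\<close> the distance to the nearest vertex, which
  is also the order of the stated product. All constants stay bounded because \<open>n\<^bsup>2/(n-2)\<^esup>\<close> does.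
\<close>

section \<open>The maximum principle\<close>

text \<open>The obstacle is uniformity in n. With the inradius fixed, the interior angle tends to pi
  and the corner discs shrink like 1/n, so compactness for each single n gives nothing and every
  constant must be explicit. The constant of a corner barrier contains the reciprocal of (disc
  radius)^(p-1), and p - 1 = 2/(n-2); this is where the critical power of n comes from. The two
  directions use the equation differently. From below, \<open>u\<close> acts as a positive
  superharmonic function and subharmonic barriers suffice. They need a whole disc of definite radius
  on which \<open>u\<close> is of order \<open>M\<close>, which the value at one point cannot give;
  hence the gradient bound. From above, the term \<open>lam * u\<close> has the wrong sign for
  harmonic majorants, and a barrier must absorb it; this is possible with absolute constants only
  once \<open>lam\<close> is bounded. The L2 norm enters at the very end: it fixes \<open>M\<close>
  times the inradius up to constants, and what remains is scaling.\<close>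

definition has_deriv2 :: "(real \<Rightarrow> real) \<Rightarrow> real \<Rightarrow> real \<Rightarrow> bool" where
  "has_deriv2 f a t \<longleftrightarrow>
     (\<exists>f'. (\<forall>\<^sub>F s in nhds t. (f has_real_derivative f' s) (at s)) \<and> (f' has_real_derivative a) (at t))"

lemma has_deriv2I:
  assumes "\<And>s. (f has_real_derivative f' s) (at s)" "(f' has_real_derivative a) (at t)"
  shows "has_deriv2 f a t"
  using assms unfolding has_deriv2_def by (intro exI[of _ f']) auto

lemma has_deriv2_add:
  assumes "has_deriv2 f a t" "has_deriv2 g b t"
  shows "has_deriv2 (\<lambda>s. f s + g s) (a + b) t"
proof -
  from assms obtain f' g' where
    f: "\<forall>\<^sub>F s in nhds t. (f has_real_derivative f' s) (at s)" "(f' has_real_derivative a) (at t)" and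
    g: "\<forall>\<^sub>F s in nhds t. (g has_real_derivative g' s) (at s)" "(g' has_real_derivative b) (at t)"
    unfolding has_deriv2_def by blast
  have "\<forall>\<^sub>F s in nhds t. ((\<lambda>s. f s + g s) has_real_derivative f' s + g' s) (at s)"
    using f(1) g(1) by eventually_elim (rule DERIV_add)
  then show ?thesis
    unfolding has_deriv2_def using DERIV_add[OF f(2) g(2)] by (intro exI[of _ "\<lambda>s. f' s + g' s"]) simp
qed

lemma has_deriv2_cmult:
  assumes "has_deriv2 f a t"
  shows "has_deriv2 (\<lambda>s. c * f s) (c * a) t"
proof -
  from assms obtain f' where
    f: "\<forall>\<^sub>F s in nhds t. (f has_real_derivative f' s) (at s)" "(f' has_real_derivative a) (at t)"
    unfolding has_deriv2_def by blast
  have "\<forall>\<^sub>F s in nhds t. ((\<lambda>s. c * f s) has_real_derivative c * f' s) (at s)"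
    using f(1) by eventually_elim (rule DERIV_cmult)
  then show ?thesis
    unfolding has_deriv2_def using DERIV_cmult[OF f(2)] by (intro exI[of _ "\<lambda>s. c * f' s"]) simp
qed

lemma has_deriv2_flip:
  assumes "has_deriv2 f a 0"
  shows "has_deriv2 (\<lambda>s. f (- s)) a 0"
proof -
  from assms obtain f' where
    f: "\<forall>\<^sub>F s in nhds 0. (f has_real_derivative f' s) (at s)" "(f' has_real_derivative a) (at 0)"
    unfolding has_deriv2_def by blast
  obtain e where e: "e > 0" "\<And>s. dist s 0 < e \<Longrightarrow> (f has_real_derivative f' s) (at s)"
    using f(1) unfolding eventually_nhds_metric by blast
  have "((\<lambda>s. f (- s)) has_real_derivative - f' (- s)) (at s)" if "dist s 0 < e" for s
    using DERIV_chain2[of f "f' (- s)" uminus s "-1" UNIV] e(2)[of "- s"] that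
      DERIV_minus[OF DERIV_ident, of s UNIV]
    by (simp add: dist_norm)
  then have 1: "\<forall>\<^sub>F s in nhds 0. ((\<lambda>s. f (- s)) has_real_derivative - f' (- s)) (at s)"
    unfolding eventually_nhds_metric using e(1) by blast
  have "((\<lambda>s. f' (- s)) has_real_derivative a * (- 1)) (at 0)"
    using DERIV_chain2[of f' a uminus 0 "-1" UNIV] f(2) DERIV_minus[OF DERIV_ident, of 0 UNIV]
    by simp
  from DERIV_minus[OF this] have "((\<lambda>s. - f' (- s)) has_real_derivative a) (at 0)" by simp
  with 1 show ?thesis
    unfolding has_deriv2_def by (intro exI[of _ "\<lambda>s. - f' (- s)"]) simp
qed

text \<open>If \<open>a > 0\<close>, then \<open>f'\<close> vanishes at \<open>t\<close> and is
  positive just to the right of \<open>t\<close>, so \<open>f\<close> increases strictly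
  there.\<close>

lemma has_deriv2_local_max:
  assumes "has_deriv2 f a t" "\<forall>\<^sub>F s in nhds t. f s \<le> f t"
  shows "a \<le> 0"
proof (rule ccontr)
  assume "\<not> a \<le> 0"
  then have a: "a > 0" by simp
  from assms(1) obtain f' where
    f: "\<forall>\<^sub>F s in nhds t. (f has_real_derivative f' s) (at s)" "(f' has_real_derivative a) (at t)"
    unfolding has_deriv2_def by blast
  obtain e where e: "e > 0"
    "\<And>s. dist s t < e \<Longrightarrow> (f has_real_derivative f' s) (at s) \<and> f s \<le> f t"
    using eventually_conj[OF f(1) assms(2)] unfolding eventually_nhds_metric by blast
  have "(f has_real_derivative f' t) (at t)" using e by simp
  then have ft: "f' t = 0"
    using DERIV_local_max[OF _ e(1), of f "f' t" t] e(2) by (auto simp: dist_real_def abs_minus_commute)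
  obtain d where d: "d > 0" "\<And>h. 0 < h \<Longrightarrow> h < d \<Longrightarrow> f' t < f' (t + h)"
    using DERIV_pos_inc_right[OF f(2) a] by blast
  define k where "k = min d e / 2"
  have k: "k > 0" "k < d" "k < e" using d(1) e(1) by (auto simp: k_def)
  have "f t < f (t + k)"
  proof (rule DERIV_pos_imp_increasing_open[of t "t + k" f])
    show "t < t + k" using k by simp
    show "\<exists>y. (f has_real_derivative y) (at x) \<and> 0 < y" if "t < x" "x < t + k" for x
      using e(2)[of x] d(2)[of "x - t"] that k ft
      by (intro exI[of _ "f' x"]) (auto simp: dist_real_def)
    have "isCont f x" if "x \<in> {t..t + k}" for x
      using e(2)[of x] that k by (auto simp: dist_real_def intro: DERIV_isCont)
    then show "continuous_on {t..t + k} f" by (simp add: continuous_at_imp_continuous_on)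
  qed
  moreover have "f (t + k) \<le> f t" using e(2)[of "t + k"] k by (simp add: dist_real_def)
  ultimately show False by simp
qed

text \<open>Only the derivatives along the two coordinate lines through a point are recorded: the
  maximum principle needs nothing more, and barriers are differentiated in one variable.\<close>

definition has_lap :: "(complex \<Rightarrow> real) \<Rightarrow> complex \<Rightarrow> real \<Rightarrow> bool" where
  "has_lap u z L \<longleftrightarrow>
     (\<exists>a b. has_deriv2 (\<lambda>t. u (z + of_real t)) a 0 \<and>
            has_deriv2 (\<lambda>t. u (z + \<i> * of_real t)) b 0 \<and> L = a + b)"

lemma has_lapI:
  assumes "has_deriv2 (\<lambda>t. u (z + of_real t)) a 0"
    "has_deriv2 (\<lambda>t. u (z + \<i> * of_real t)) b 0" "L = a + b"
  shows "has_lap u z L"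
  using assms unfolding has_lap_def by blast

lemma has_lap_add:
  assumes "has_lap u z a" "has_lap v z b"
  shows "has_lap (\<lambda>z. u z + v z) z (a + b)"
proof -
  from assms obtain a1 a2 b1 b2 where
    "has_deriv2 (\<lambda>t. u (z + of_real t)) a1 0" "has_deriv2 (\<lambda>t. u (z + \<i> * of_real t)) a2 0" "a = a1 + a2"
    "has_deriv2 (\<lambda>t. v (z + of_real t)) b1 0" "has_deriv2 (\<lambda>t. v (z + \<i> * of_real t)) b2 0" "b = b1 + b2"
    unfolding has_lap_def by blast
  then show ?thesis
    by (intro has_lapI[where a = "a1 + b1" and b = "a2 + b2"] has_deriv2_add) auto
qed

lemma has_lap_cmult:
  assumes "has_lap u z a"
  shows "has_lap (\<lambda>z. c * u z) z (c * a)"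
proof -
  from assms obtain a1 a2 where
    "has_deriv2 (\<lambda>t. u (z + of_real t)) a1 0" "has_deriv2 (\<lambda>t. u (z + \<i> * of_real t)) a2 0" "a = a1 + a2"
    unfolding has_lap_def by blast
  then show ?thesis
    by (intro has_lapI[where a = "c * a1" and b = "c * a2"] has_deriv2_cmult) (auto simp: algebra_simps)
qed

lemma has_lap_diff:
  assumes "has_lap u z a" "has_lap v z b"
  shows "has_lap (\<lambda>z. u z - v z) z (a - b)"
  using has_lap_add[OF assms(1) has_lap_cmult[OF assms(2), of "-1"]] by simp

lemma has_lap_const: "has_lap (\<lambda>z. c) z 0"
  by (rule has_lapI[where a = 0 and b = 0])
    (auto intro!: has_deriv2I[where f' = "\<lambda>s. 0"] derivative_eq_intros)

lemma has_lap_local_max: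
  assumes "has_lap v z L" "z \<in> interior K" "\<And>w. w \<in> K \<Longrightarrow> v w \<le> v z"
  shows "L \<le> 0"
proof -
  from assms(1) obtain a b where ab:
    "has_deriv2 (\<lambda>t. v (z + of_real t)) a 0" "has_deriv2 (\<lambda>t. v (z + \<i> * of_real t)) b 0" "L = a + b"
    unfolding has_lap_def by blast
  obtain e where e: "e > 0" "ball z e \<subseteq> K"
    using assms(2) by (meson mem_interior)
  have "\<forall>\<^sub>F t in nhds 0. v (z + of_real t) \<le> v (z + of_real 0)"
    unfolding eventually_nhds_metric using e assms(3)
    by (intro exI[of _ e]) (auto simp: dist_norm subset_iff)
  moreover have "\<forall>\<^sub>F t in nhds 0. v (z + \<i> * of_real t) \<le> v (z + \<i> * of_real 0)"
    unfolding eventually_nhds_metric using e assms(3)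
    by (intro exI[of _ e]) (auto simp: dist_norm subset_iff norm_mult)
  ultimately show ?thesis
    using has_deriv2_local_max[OF ab(1)] has_deriv2_local_max[OF ab(2)] ab(3) by auto
qed

text \<open>At an interior maximum \<open>q\<close> of \<open>v / Z\<close> with positive value \<open>m\<close>, the function \<open>v - m Z\<close> has a
  local maximum.\<close>

lemma max_principle:
  assumes K: "compact K" "continuous_on K v" "continuous_on K Z"
    and Z: "\<And>z. z \<in> K \<Longrightarrow> Z z > 0"
    and int: "\<And>z. z \<in> K \<Longrightarrow> v z > 0 \<Longrightarrow> z \<in> interior K"
    and lap: "\<And>z. z \<in> K \<Longrightarrow> v z > 0 \<Longrightarrow>
       \<exists>a b. has_lap v z a \<and> has_lap Z z b \<and> b * v z < a * Z z"
    and "z \<in> K"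
  shows "v z \<le> 0"
proof -
  have "continuous_on K (\<lambda>z. v z / Z z)"
    using K(2,3) Z by (intro continuous_on_divide) (auto simp: less_imp_neq[symmetric])
  then obtain q where q: "q \<in> K" "\<And>w. w \<in> K \<Longrightarrow> v w / Z w \<le> v q / Z q"
    using continuous_attains_sup[OF K(1), of "\<lambda>z. v z / Z z"] \<open>z \<in> K\<close> by blast
  define m where "m = v q / Z q"
  have "v q \<le> 0"
  proof (rule ccontr)
    assume "\<not> v q \<le> 0"
    then have vq: "v q > 0" by simp
    obtain a b where ab: "has_lap v q a" "has_lap Z q b" "b * v q < a * Z q"
      using lap[OF q(1) vq] by blast
    have "has_lap (\<lambda>z. v z - m * Z z) q (a - m * b)"
      by (intro has_lap_diff has_lap_cmult ab)
    moreover have "v w - m * Z w \<le> v q - m * Z q" if "w \<in> K" for w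
      using q(2)[OF that] Z[OF that] Z[OF q(1)] by (simp add: m_def field_simps)
    ultimately have "a - m * b \<le> 0"
      using has_lap_local_max int[OF q(1) vq] by blast
    then show False using ab(3) Z[OF q(1)] by (simp add: m_def field_simps)
  qed
  then have "v z / Z z \<le> 0"
    using q(2)[OF \<open>z \<in> K\<close>] Z[OF q(1)] by (meson divide_nonpos_pos order_trans)
  then show ?thesis using Z[OF \<open>z \<in> K\<close>] by (simp add: divide_le_0_iff)
qed

lemma has_deriv2_quadratic: "has_deriv2 (\<lambda>t. c0 + c1 * t + c2 * t\<^sup>2) (2 * c2) 0"
  by (rule has_deriv2I[where f' = "\<lambda>t. c1 + 2 * c2 * t"])
    (auto intro!: derivative_eq_intros)

lemma has_lap_norm_sq: "has_lap (\<lambda>z. (cmod (z - q))\<^sup>2) z 4"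
proof (rule has_lapI[where a = 2 and b = 2])
  have 1: "(\<lambda>t. (cmod (z + of_real t - q))\<^sup>2) = (\<lambda>t. (cmod (z - q))\<^sup>2 + 2 * Re (z - q) * t + 1 * t\<^sup>2)"
    unfolding cmod_power2 by (auto simp: fun_eq_iff power2_eq_square algebra_simps)
  show "has_deriv2 (\<lambda>t. (cmod (z + of_real t - q))\<^sup>2) 2 0"
    unfolding 1 using has_deriv2_quadratic[of _ _ 1] by simp
  have 2: "(\<lambda>t. (cmod (z + \<i> * of_real t - q))\<^sup>2) = (\<lambda>t. (cmod (z - q))\<^sup>2 + 2 * Im (z - q) * t + 1 * t\<^sup>2)"
    unfolding cmod_power2 by (auto simp: fun_eq_iff power2_eq_square algebra_simps)
  show "has_deriv2 (\<lambda>t. (cmod (z + \<i> * of_real t - q))\<^sup>2) 2 0"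
    unfolding 2 using has_deriv2_quadratic[of _ _ 1] by simp
qed simp

text \<open>The weak inequality becomes strict through \<open>Z = r^2 + 1 - |z|^2\<close>, which is
  positive on \<open>K\<close> and has Laplacian -4. The boundary condition is coded in
  \<open>int\<close>: a point where \<open>v\<close> is positive is interior.\<close>

lemma max_principle_subharmonic:
  assumes K: "compact K" "continuous_on K v"
    and int: "\<And>z. z \<in> K \<Longrightarrow> v z > 0 \<Longrightarrow> z \<in> interior K"
    and lap: "\<And>z. z \<in> K \<Longrightarrow> v z > 0 \<Longrightarrow> \<exists>a\<ge>0. has_lap v z a"
    and "z \<in> K"
  shows "v z \<le> 0"
proof -
  obtain r where r: "\<And>z. z \<in> K \<Longrightarrow> cmod z \<le> r"
    using compact_imp_bounded[OF K(1)] unfolding bounded_iff by blast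
  define Z where "Z = (\<lambda>z. (r\<^sup>2 + 1) - (cmod (z - 0))\<^sup>2)"
  have Zpos: "Z z > 0" if "z \<in> K" for z
    using power_mono[OF r[OF that], of 2] by (simp add: Z_def)
  show ?thesis
  proof (rule max_principle[OF K _ Zpos int _ \<open>z \<in> K\<close>])
    show "continuous_on K Z" unfolding Z_def by (intro continuous_intros)
    fix w assume w: "w \<in> K" "v w > 0"
    obtain a where a: "a \<ge> 0" "has_lap v w a" using lap[OF w] by blast
    have "has_lap Z w (0 - 4)"
      unfolding Z_def by (intro has_lap_diff has_lap_const has_lap_norm_sq)
    moreover have "(0 - 4) * v w < a * Z w"
      using w(2) mult_nonneg_nonneg[OF a(1) less_imp_le[OF Zpos[OF w(1)]]] by simp
    ultimately show "\<exists>a b. has_lap v w a \<and> has_lap Z w b \<and> b * v w < a * Z w"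
      using a(2) by blast
  qed auto
qed

section \<open>Barriers\<close>

lemma has_lap_affine: "has_lap (\<lambda>z. Re ((z - q) * e)) z 0"
proof (rule has_lapI[where a = 0 and b = 0])
  have 1: "(\<lambda>t. Re ((z + of_real t - q) * e)) = (\<lambda>t. Re ((z - q) * e) + Re e * t + 0 * t\<^sup>2)"
    by (auto simp: fun_eq_iff algebra_simps)
  show "has_deriv2 (\<lambda>t. Re ((z + of_real t - q) * e)) 0 0"
    unfolding 1 using has_deriv2_quadratic[of _ _ 0] by simp
  have 2: "(\<lambda>t. Re ((z + \<i> * of_real t - q) * e)) = (\<lambda>t. Re ((z - q) * e) + (- Im e) * t + 0 * t\<^sup>2)"
    by (auto simp: fun_eq_iff algebra_simps)
  show "has_deriv2 (\<lambda>t. Re ((z + \<i> * of_real t - q) * e)) 0 0"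
    unfolding 2 using has_deriv2_quadratic[of "Re ((z - q) * e)" "- Im e" 0] by simp
qed simp

lemma has_lap_affine_sq: "has_lap (\<lambda>z. (Re ((z - q) * e))\<^sup>2) z (2 * (cmod e)\<^sup>2)"
proof (rule has_lapI[where a = "2 * (Re e)\<^sup>2" and b = "2 * (Im e)\<^sup>2"])
  let ?c = "Re ((z - q) * e)"
  have 1: "(\<lambda>t. (Re ((z + of_real t - q) * e))\<^sup>2) = (\<lambda>t. ?c\<^sup>2 + 2 * ?c * Re e * t + (Re e)\<^sup>2 * t\<^sup>2)"
    by (auto simp: fun_eq_iff algebra_simps power2_eq_square)
  show "has_deriv2 (\<lambda>t. (Re ((z + of_real t - q) * e))\<^sup>2) (2 * (Re e)\<^sup>2) 0"
    unfolding 1 by (rule has_deriv2_quadratic)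
  have 2: "(\<lambda>t. (Re ((z + \<i> * of_real t - q) * e))\<^sup>2) = (\<lambda>t. ?c\<^sup>2 + - (2 * ?c * Im e) * t + (Im e)\<^sup>2 * t\<^sup>2)"
    by (auto simp: fun_eq_iff algebra_simps power2_eq_square)
  show "has_deriv2 (\<lambda>t. (Re ((z + \<i> * of_real t - q) * e))\<^sup>2) (2 * (Im e)\<^sup>2) 0"
    unfolding 2 by (rule has_deriv2_quadratic)
qed (simp add: cmod_power2)

lemma has_deriv2_exp_quadratic:
  "has_deriv2 (\<lambda>t. exp (a * (c0 + c1 * t + t\<^sup>2))) ((a\<^sup>2 * c1\<^sup>2 + 2 * a) * exp (a * c0)) 0"
  by (rule has_deriv2I[where f' = "\<lambda>t. a * (c1 + 2 * t) * exp (a * (c0 + c1 * t + t\<^sup>2))"])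
    (auto intro!: derivative_eq_intros simp: algebra_simps power2_eq_square)

lemma has_lap_exp_norm_sq:
  "has_lap (\<lambda>z. exp (a * (cmod (z - q))\<^sup>2)) z ((4 * a\<^sup>2 * (cmod (z - q))\<^sup>2 + 4 * a) * exp (a * (cmod (z - q))\<^sup>2))"
proof -
  let ?c = "(cmod (z - q))\<^sup>2"
  have 1: "(\<lambda>t. exp (a * (cmod (z + of_real t - q))\<^sup>2)) = (\<lambda>t. exp (a * (?c + 2 * Re (z - q) * t + t\<^sup>2)))"
    unfolding cmod_power2 by (auto simp: fun_eq_iff power2_eq_square algebra_simps)
  have 2: "(\<lambda>t. exp (a * (cmod (z + \<i> * of_real t - q))\<^sup>2)) = (\<lambda>t. exp (a * (?c + 2 * Im (z - q) * t + t\<^sup>2)))"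
    unfolding cmod_power2 by (auto simp: fun_eq_iff power2_eq_square algebra_simps)
  show ?thesis
  proof (rule has_lapI)
    show "has_deriv2 (\<lambda>t. exp (a * (cmod (z + of_real t - q))\<^sup>2))
        ((a\<^sup>2 * (2 * Re (z - q))\<^sup>2 + 2 * a) * exp (a * ?c)) 0"
      unfolding 1 by (rule has_deriv2_exp_quadratic)
    show "has_deriv2 (\<lambda>t. exp (a * (cmod (z + \<i> * of_real t - q))\<^sup>2))
        ((a\<^sup>2 * (2 * Im (z - q))\<^sup>2 + 2 * a) * exp (a * ?c)) 0"
      unfolding 2 by (rule has_deriv2_exp_quadratic)
    have c: "?c = (Re (z - q))\<^sup>2 + (Im (z - q))\<^sup>2" by (rule cmod_power2)
    have "4 * a\<^sup>2 * ?c + 4 * a = (a\<^sup>2 * (2 * Re (z - q))\<^sup>2 + 2 * a) + (a\<^sup>2 * (2 * Im (z - q))\<^sup>2 + 2 * a)"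
      unfolding c by (simp add: algebra_simps power2_eq_square)
    then show "(4 * a\<^sup>2 * ?c + 4 * a) * exp (a * ?c) =
        (a\<^sup>2 * (2 * Re (z - q))\<^sup>2 + 2 * a) * exp (a * ?c) + (a\<^sup>2 * (2 * Im (z - q))\<^sup>2 + 2 * a) * exp (a * ?c)"
      by (simp only: distrib_right)
  qed
qed

lemma has_lap_cos_cos:
  "has_lap (\<lambda>z. cos (a * Re z) * cos (a * Im z)) z (- (2 * a\<^sup>2) * (cos (a * Re z) * cos (a * Im z)))"
proof (rule has_lapI)
  let ?L = "- (a\<^sup>2) * (cos (a * Re z) * cos (a * Im z))"
  show "has_deriv2 (\<lambda>t. cos (a * Re (z + of_real t)) * cos (a * Im (z + of_real t))) ?L 0"
    by (rule has_deriv2I[where f' = "\<lambda>t. - a * sin (a * (Re z + t)) * cos (a * Im z)"])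
      (auto intro!: derivative_eq_intros simp: algebra_simps power2_eq_square)
  show "has_deriv2 (\<lambda>t. cos (a * Re (z + \<i> * of_real t)) * cos (a * Im (z + \<i> * of_real t))) ?L 0"
    by (rule has_deriv2I[where f' = "\<lambda>t. - a * cos (a * Re z) * sin (a * (Im z + t))"])
      (auto intro!: derivative_eq_intros simp: algebra_simps power2_eq_square)
qed simp

lemma Re_line_derivative:
  assumes "(F has_field_derivative D) (at (z + e * of_real t))"
  shows "((\<lambda>t. Re (F (z + e * of_real t))) has_real_derivative Re (e * D)) (at t)"
proof -
  have "((\<lambda>t. z + e * of_real t) has_vector_derivative e) (at t)"
    by (auto intro!: derivative_eq_intros)
  from field_vector_diff_chain_at[OF this assms]
  have "((\<lambda>t. F (z + e * of_real t)) has_vector_derivative e * D) (at t)"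
    by (simp add: o_def)
  from bounded_linear.has_vector_derivative[OF bounded_linear_Re this]
  show ?thesis by (simp add: has_real_derivative_iff_has_vector_derivative)
qed

text \<open>Since \<open>F\<close> is holomorphic, the second derivatives of \<open>Re F\<close> along \<open>1\<close> and \<open>\<i>\<close>
  cancel; only the mixed terms of the product survive.\<close>

lemma has_lap_Re_holomorphic_mult_quadratic:
  assumes S: "open S" "z \<in> S"
    and F: "\<And>w. w \<in> S \<Longrightarrow> (F has_field_derivative F' w) (at w)"
      "\<And>w. w \<in> S \<Longrightarrow> (F' has_field_derivative F'' w) (at w)"
  shows "has_lap (\<lambda>w. Re (F w) * (b + a * (cmod (w - q))\<^sup>2)) z
    (4 * a * (Re (F' z * (z - q)) + Re (F z)))"
proof -
  have line: "has_deriv2 (\<lambda>t. Re (F (z + e * of_real t)) * (c0 + c1 * t + c2 * t\<^sup>2))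
      (Re (e * e * F'' z) * c0 + 2 * Re (e * F' z) * c1 + 2 * c2 * Re (F z)) 0"
    if e: "cmod e = 1" for e c0 c1 c2
  proof -
    obtain d where d: "d > 0" "ball z d \<subseteq> S" using S by (meson open_contains_ball)
    have inS: "z + e * of_real t \<in> S" if "dist t 0 < d" for t
    proof -
      have "z + e * of_real t \<in> ball z d" using that e by (simp add: dist_norm norm_mult)
      then show ?thesis using d(2) by blast
    qed
    let ?q = "\<lambda>t. c0 + c1 * t + c2 * t\<^sup>2" and ?q' = "\<lambda>t. c1 + 2 * c2 * t"
    have q: "(?q has_real_derivative ?q' t) (at t)" for t
      by (auto intro!: derivative_eq_intros)
    have q': "(?q' has_real_derivative 2 * c2) (at t)" for t
      by (auto intro!: derivative_eq_intros)
    have 1: "((\<lambda>t. Re (F (z + e * of_real t))) has_real_derivative Re (e * F' (z + e * of_real t))) (at t)"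
      if "dist t 0 < d" for t
      using Re_line_derivative[OF F(1)[OF inS[OF that]]] .
    have "((\<lambda>w. e * F' w) has_field_derivative e * F'' z) (at (z + e * of_real 0))"
      using DERIV_cmult[OF F(2)[OF S(2)], of e] by simp
    from Re_line_derivative[OF this]
    have 2: "((\<lambda>t. Re (e * F' (z + e * of_real t))) has_real_derivative Re (e * e * F'' z)) (at 0)"
      by (simp add: mult.assoc)
    have "((\<lambda>t. Re (F (z + e * of_real t)) * ?q t) has_real_derivative
        Re (e * F' (z + e * of_real t)) * ?q t + ?q' t * Re (F (z + e * of_real t))) (at t)"
      if "dist t 0 < d" for t
      by (rule DERIV_mult[OF 1[OF that] q])
    moreover have "((\<lambda>t. Re (e * F' (z + e * of_real t)) * ?q t + ?q' t * Re (F (z + e * of_real t)))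
        has_real_derivative
        (Re (e * e * F'' z) * ?q 0 + ?q' 0 * Re (e * F' (z + e * of_real 0))) +
        (2 * c2 * Re (F (z + e * of_real 0)) + Re (e * F' (z + e * of_real 0)) * ?q' 0)) (at 0)"
      by (rule DERIV_add[OF DERIV_mult[OF 2 q] DERIV_mult[OF q' 1]]) (use d in simp)
    ultimately show ?thesis
      unfolding has_deriv2_def eventually_nhds_metric using d(1)
      by (intro exI[of _ "\<lambda>t. Re (e * F' (z + e * of_real t)) * ?q t + ?q' t * Re (F (z + e * of_real t))"])
        (auto simp: algebra_simps)
  qed
  let ?c = "b + a * (cmod (z - q))\<^sup>2"
  have 1: "(\<lambda>t. Re (F (z + of_real t)) * (b + a * (cmod (z + of_real t - q))\<^sup>2)) =
      (\<lambda>t. Re (F (z + 1 * of_real t)) * (?c + 2 * a * Re (z - q) * t + a * t\<^sup>2))"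
    unfolding cmod_power2 by (auto simp: fun_eq_iff power2_eq_square algebra_simps)
  have 2: "(\<lambda>t. Re (F (z + \<i> * of_real t)) * (b + a * (cmod (z + \<i> * of_real t - q))\<^sup>2)) =
      (\<lambda>t. Re (F (z + \<i> * of_real t)) * (?c + 2 * a * Im (z - q) * t + a * t\<^sup>2))"
    unfolding cmod_power2 by (auto simp: fun_eq_iff power2_eq_square algebra_simps)
  show ?thesis
  proof (rule has_lapI)
    show "has_deriv2 (\<lambda>t. Re (F (z + of_real t)) * (b + a * (cmod (z + of_real t - q))\<^sup>2))
      (Re (1 * 1 * F'' z) * ?c + 2 * Re (1 * F' z) * (2 * a * Re (z - q)) + 2 * a * Re (F z)) 0"
      unfolding 1 by (rule line) simp
    show "has_deriv2 (\<lambda>t. Re (F (z + \<i> * of_real t)) * (b + a * (cmod (z + \<i> * of_real t - q))\<^sup>2))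
      (Re (\<i> * \<i> * F'' z) * ?c + 2 * Re (\<i> * F' z) * (2 * a * Im (z - q)) + 2 * a * Re (F z)) 0"
      unfolding 2 by (rule line) simp
  qed (simp add: algebra_simps)
qed

text \<open>Mirrors parallel to the axes map the two recorded coordinate lines to coordinate lines,
  up to an orientation that \<open>has_deriv2_flip\<close> absorbs. This is why the gradient bound
  below is stated for four directions.\<close>

lemma has_lap_reflect:
  assumes "has_lap u (c + of_real k * cnj z) L" "k = 1 \<or> k = -1"
  shows "has_lap (\<lambda>z. u (c + of_real k * cnj z)) z L"
proof -
  let ?w = "c + of_real k * cnj z"
  from assms(1) obtain a b where
    ab: "has_deriv2 (\<lambda>t. u (?w + of_real t)) a 0" "has_deriv2 (\<lambda>t. u (?w + \<i> * of_real t)) b 0" "L = a + b"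
    unfolding has_lap_def by blast
  note flip = has_deriv2_flip[OF ab(1)] has_deriv2_flip[OF ab(2)]
  show ?thesis
    by (rule has_lapI[where a = a and b = b])
      (use assms(2) ab flip in \<open>auto simp: algebra_simps\<close>)
qed

text \<open>Barrier for the difference of \<open>u\<close> and its mirror image: on the mirror line the difference
  vanishes, and the barrier grows linearly away from it.\<close>

lemma reflection_gradient_bound:
  assumes e: "e \<in> {1, -1, \<i>, - \<i>}" and s: "s > 0" and M: "M \<ge> 0" and lam: "lam \<ge> 0"
    and cont: "continuous_on (cball q (2 * s)) u"
    and bnd: "\<And>z. z \<in> cball q (2 * s) \<Longrightarrow> 0 \<le> u z \<and> u z \<le> M"
    and lap: "\<And>z. z \<in> cball q (2 * s) \<Longrightarrow> has_lap u z (- lam * u z)"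
    and t: "0 \<le> t" "t \<le> s"
  shows "u (q + of_real t * e) - u (q - of_real t * e) \<le> (2 / s + lam * s) * M * t"
proof -
  define k where "k = (if e = 1 \<or> e = -1 then -1 else (1::real))"
  define \<sigma> where "\<sigma> = (\<lambda>z. (q - of_real k * cnj q) + of_real k * cnj z)"
  have k: "k = 1 \<or> k = -1" by (simp add: k_def)
  have norme: "cmod (cnj e) = 1" using e by auto
  define X where "X = (\<lambda>z. Re ((z - q) * cnj e))"
  define Y where "Y = (\<lambda>z. Re ((z - q) * (- \<i> * cnj e)))"
  \<comment> \<open>With this \<open>c\<close> the first term of \<open>W\<close> is at least
    \<open>M\<close> at \<open>X = s\<close>, while the second equals \<open>M\<close> at
    \<open>|Y| = s\<close>; and the Laplacian \<open>2 M / s^2 - 2 c\<close> is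
    \<open>- lam M\<close>, which absorbs \<open>lam\<close> times the difference of
    \<open>u\<close> and its mirror image.\<close>
  define c where "c = M / s\<^sup>2 + lam * M / 2"
  define W where "W = (\<lambda>z. c * (2 * s * X z - (X z)\<^sup>2) + (M / s\<^sup>2) * (Y z)\<^sup>2)"
  \<comment> \<open>Half of the square of half-side \<open>s\<close> about \<open>q\<close>. The
    side \<open>X = 0\<close> lies on the mirror, and the whole square fits into the disc of radius
    \<open>2 s\<close>.\<close>
  define Q where "Q = {z. 0 \<le> X z \<and> X z \<le> s \<and> - s \<le> Y z \<and> Y z \<le> s}"
  have contX: "continuous_on A X" and contY: "continuous_on A Y" for A
    unfolding X_def Y_def by (intro continuous_intros)+
  have XY: "(X z)\<^sup>2 + (Y z)\<^sup>2 = (cmod (z - q))\<^sup>2" for z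
    using e unfolding cmod_power2 X_def Y_def by (auto simp: power2_commute)
  have c0: "c \<ge> 0" using M lam s by (simp add: c_def)
  have ball: "z \<in> cball q (2 * s)" if "\<bar>X z\<bar> \<le> s" "\<bar>Y z\<bar> \<le> s" for z
  proof -
    have "(X z)\<^sup>2 \<le> s\<^sup>2" "(Y z)\<^sup>2 \<le> s\<^sup>2"
      using that power_mono[of "\<bar>X z\<bar>" s 2] power_mono[of "\<bar>Y z\<bar>" s 2] by auto
    then have "(cmod (z - q))\<^sup>2 \<le> 2 * s\<^sup>2" using XY[of z] by linarith
    also have "\<dots> \<le> (2 * s)\<^sup>2" by (simp add: power_mult_distrib)
    finally have "(cmod (z - q))\<^sup>2 \<le> (2 * s)\<^sup>2" .
    then have "cmod (z - q) \<le> 2 * s" by (rule power2_le_imp_le) (use s in simp)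
    then show ?thesis by (simp add: dist_norm norm_minus_commute)
  qed
  have X\<sigma>: "X (\<sigma> z) = - X z" and Y\<sigma>: "Y (\<sigma> z) = Y z" for z
    using e by (auto simp: X_def Y_def \<sigma>_def k_def algebra_simps)
  have Qball: "z \<in> cball q (2 * s)" "\<sigma> z \<in> cball q (2 * s)" if "z \<in> Q" for z
    using that s by (auto intro!: ball simp: Q_def X\<sigma> Y\<sigma> abs_le_iff simp del: mem_cball)
  have cont\<sigma>: "continuous_on A \<sigma>" for A unfolding \<sigma>_def by (intro continuous_intros)
  define v where "v = (\<lambda>z. u z - u (\<sigma> z) - W z)"
  have clQ: "closed Q"
    unfolding Q_def by (intro closed_Collect_conj closed_Collect_le contX contY continuous_intros)
  have "v z \<le> 0" if "z \<in> Q" for z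
  proof (rule max_principle_subharmonic[OF _ _ _ _ that])
    show "compact Q"
      using clQ Qball(1) bounded_subset[OF bounded_cball] by (intro compact_eq_bounded_closed[THEN iffD2]) blast
    show "continuous_on Q v"
      unfolding v_def W_def
      by (intro continuous_intros contX contY continuous_on_subset[OF cont]
          continuous_on_compose2[OF cont cont\<sigma>]) (use Qball in auto)
    fix z assume z: "z \<in> Q" "v z > 0"
    have u: "u z - u (\<sigma> z) \<le> M" "u (\<sigma> z) \<ge> 0" using bnd[OF Qball(1)[OF z(1)]] bnd[OF Qball(2)[OF z(1)]] by auto
    have xx: "2 * s * X z - (X z)\<^sup>2 = X z * (s + (s - X z))" by (simp add: algebra_simps power2_eq_square)
    have W1: "c * (2 * s * X z - (X z)\<^sup>2) \<ge> 0" unfolding xx using c0 z(1) s by (auto simp: Q_def)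
    have W2: "(M / s\<^sup>2) * (Y z)\<^sup>2 \<ge> 0" using M by simp
    have "X z \<noteq> 0"
    proof
      assume "X z = 0"
      then have "\<sigma> z = z" using e by (auto simp: X_def \<sigma>_def k_def complex_eq_iff)
      then show False using z(2) W1 W2 by (simp add: v_def W_def)
    qed
    moreover have "X z \<noteq> s"
    proof
      assume "X z = s"
      then have "c * (2 * s * X z - (X z)\<^sup>2) = M + lam * M / 2 * s\<^sup>2"
        using s by (simp add: c_def field_simps power2_eq_square)
      moreover have "lam * M / 2 * s\<^sup>2 \<ge> 0" using lam M by simp
      ultimately show False using z(2) W2 u by (simp add: v_def W_def)
    qed
    moreover have "\<bar>Y z\<bar> \<noteq> s"
    proof
      assume "\<bar>Y z\<bar> = s"
      then have "(Y z)\<^sup>2 = s\<^sup>2" by (metis power2_abs)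
      then have "(M / s\<^sup>2) * (Y z)\<^sup>2 = M" using s by simp
      then show False using z(2) W1 u by (simp add: v_def W_def)
    qed
    ultimately have strict: "0 < X z \<and> X z < s \<and> - s < Y z \<and> Y z < s"
      using z(1) s by (auto simp: Q_def abs_if split: if_splits)
    have "open {z. 0 < X z \<and> X z < s \<and> - s < Y z \<and> Y z < s}"
      by (intro open_Collect_conj open_Collect_less contX contY continuous_intros)
    moreover have "{z. 0 < X z \<and> X z < s \<and> - s < Y z \<and> Y z < s} \<subseteq> Q" by (auto simp: Q_def)
    ultimately show "z \<in> interior Q" using strict interior_maximal by blast
    have "has_lap (\<lambda>z. u (\<sigma> z)) z (- lam * u (\<sigma> z))"
      unfolding \<sigma>_def by (rule has_lap_reflect[OF _ k]) (use lap[OF Qball(2)[OF z(1)]] in \<open>simp add: \<sigma>_def\<close>)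
    moreover have "has_lap W z (c * (2 * s * 0 - 2 * (cmod (cnj e))\<^sup>2) + (M / s\<^sup>2) * (2 * (cmod (- \<i> * cnj e))\<^sup>2))"
      unfolding W_def X_def Y_def
      by (intro has_lap_add has_lap_diff has_lap_cmult has_lap_affine has_lap_affine_sq)
    ultimately have "has_lap v z (- lam * u z - (- lam * u (\<sigma> z)) -
        (c * (2 * s * 0 - 2 * (cmod (cnj e))\<^sup>2) + (M / s\<^sup>2) * (2 * (cmod (- \<i> * cnj e))\<^sup>2)))"
      unfolding v_def by (intro has_lap_diff lap Qball z)
    moreover have "cmod (- \<i> * cnj e) = 1" using norme by (simp add: norm_mult)
    then have "- lam * u z - (- lam * u (\<sigma> z)) -
        (c * (2 * s * 0 - 2 * (cmod (cnj e))\<^sup>2) + (M / s\<^sup>2) * (2 * (cmod (- \<i> * cnj e))\<^sup>2)) =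
        lam * (M - (u z - u (\<sigma> z)))"
      using norme by (simp add: c_def algebra_simps)
    moreover have "lam * (M - (u z - u (\<sigma> z))) \<ge> 0" using lam u by simp
    ultimately show "\<exists>a\<ge>0. has_lap v z a" by metis
  qed
  moreover have "q + of_real t * e \<in> Q" and Xt: "X (q + of_real t * e) = t" and Yt: "Y (q + of_real t * e) = 0"
    using e t s by (auto simp: Q_def X_def Y_def)
  ultimately have "v (q + of_real t * e) \<le> 0" by blast
  moreover have "\<sigma> (q + of_real t * e) = q - of_real t * e"
    using e by (auto simp: \<sigma>_def k_def algebra_simps)
  ultimately have "u (q + of_real t * e) - u (q - of_real t * e) \<le> c * (2 * s * t - t\<^sup>2)"
    by (simp add: v_def W_def Xt Yt)
  also have "\<dots> \<le> c * (2 * s * t)" using c0 by (intro mult_left_mono) auto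
  also have "\<dots> = (2 / s + lam * s) * M * t"
    using s by (simp add: c_def field_simps power2_eq_square)
  finally show ?thesis .
qed

text \<open>The barrier is the Gaussian \<open>exp (- |z - q|^2 / s^2)\<close> minus its value at
  radius \<open>r\<close>: it is at most 1 on the inner disc, vanishes on the outer circle, and is
  subharmonic from radius \<open>s\<close> outwards. The bound \<open>exp x >= 1 + x\<close> then
  replaces it by a multiple of \<open>r^2 - |z - q|^2\<close>.\<close>

lemma annulus_lower_bound:
  assumes s: "0 < s" "s < r" and m: "m \<ge> 0"
    and cont: "continuous_on (cball q r) u"
    and nonneg: "\<And>z. z \<in> cball q r \<Longrightarrow> u z \<ge> 0"
    and lap: "\<And>z. z \<in> ball q r \<Longrightarrow> \<exists>a\<le>0. has_lap u z a"
    and low: "\<And>z. z \<in> cball q s \<Longrightarrow> m \<le> u z"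
    and z: "z \<in> cball q r"
  shows "m * exp (- (r\<^sup>2 / s\<^sup>2)) * ((r\<^sup>2 - (cmod (z - q))\<^sup>2) / s\<^sup>2) \<le> u z"
proof -
  define a where "a = - 1 / s\<^sup>2"
  define E where "E = exp (a * r\<^sup>2)"
  define v where "v = (\<lambda>z. m * (exp (a * (cmod (z - q))\<^sup>2) - E) - u z)"
  have a: "a < 0" using s by (simp add: a_def)
  have "v z \<le> 0"
  proof (rule max_principle_subharmonic[OF _ _ _ _ z])
    show "compact (cball q r)" by simp
    show "continuous_on (cball q r) v" unfolding v_def by (intro continuous_intros cont)
    fix w assume w: "w \<in> cball q r" "v w > 0"
    have "cmod (w - q) > s"
    proof (rule ccontr)
      assume "\<not> cmod (w - q) > s"
      then have "w \<in> cball q s" by (simp add: dist_norm norm_minus_commute)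
      then have "m \<le> u w" by (rule low)
      moreover have "exp (a * (cmod (w - q))\<^sup>2) \<le> 1" "E > 0" using a by (auto simp: E_def mult_nonpos_nonneg)
      then have "exp (a * (cmod (w - q))\<^sup>2) - E \<le> 1" by linarith
      then have "m * (exp (a * (cmod (w - q))\<^sup>2) - E) \<le> m * 1" by (rule mult_left_mono) (rule m)
      ultimately show False using w(2) by (simp add: v_def)
    qed
    then have far: "s\<^sup>2 \<le> (cmod (w - q))\<^sup>2" using s by (intro power_mono) auto
    have "cmod (w - q) \<noteq> r"
    proof
      assume "cmod (w - q) = r"
      then show False using w nonneg[OF w(1)] by (simp add: v_def E_def)
    qed
    then have wb: "w \<in> ball q r" using w(1) by (auto simp: dist_norm norm_minus_commute)
    then show "w \<in> interior (cball q r)" by simp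
    obtain b where b: "b \<le> 0" "has_lap u w b" using lap[OF wb] by blast
    have "has_lap v w (m * ((4 * a\<^sup>2 * (cmod (w - q))\<^sup>2 + 4 * a) * exp (a * (cmod (w - q))\<^sup>2) - 0) - b)"
      unfolding v_def by (intro has_lap_diff has_lap_cmult has_lap_exp_norm_sq has_lap_const b)
    moreover have "4 * a\<^sup>2 * (cmod (w - q))\<^sup>2 + 4 * a = 4 / s ^ 4 * ((cmod (w - q))\<^sup>2 - s\<^sup>2)"
      using s by (simp add: a_def field_simps power2_eq_square power4_eq_xxxx)
    then have "4 * a\<^sup>2 * (cmod (w - q))\<^sup>2 + 4 * a \<ge> 0" using far by simp
    then have "m * ((4 * a\<^sup>2 * (cmod (w - q))\<^sup>2 + 4 * a) * exp (a * (cmod (w - q))\<^sup>2)) \<ge> 0"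
      using m by (intro mult_nonneg_nonneg) auto
    then have "m * ((4 * a\<^sup>2 * (cmod (w - q))\<^sup>2 + 4 * a) * exp (a * (cmod (w - q))\<^sup>2) - 0) - b \<ge> 0"
      using b(1) by simp
    ultimately show "\<exists>a\<ge>0. has_lap v w a" by blast
  qed
  then have "m * (exp (a * (cmod (z - q))\<^sup>2) - E) \<le> u z" by (simp add: v_def)
  moreover have "E * ((r\<^sup>2 - (cmod (z - q))\<^sup>2) / s\<^sup>2) \<le> exp (a * (cmod (z - q))\<^sup>2) - E"
  proof -
    have "a * (cmod (z - q))\<^sup>2 = a * r\<^sup>2 + (r\<^sup>2 - (cmod (z - q))\<^sup>2) / s\<^sup>2"
      using s by (simp add: a_def field_simps)
    then have "exp (a * (cmod (z - q))\<^sup>2) = E * exp ((r\<^sup>2 - (cmod (z - q))\<^sup>2) / s\<^sup>2)"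
      by (simp add: E_def exp_add)
    moreover have "E * (1 + (r\<^sup>2 - (cmod (z - q))\<^sup>2) / s\<^sup>2) \<le> E * exp ((r\<^sup>2 - (cmod (z - q))\<^sup>2) / s\<^sup>2)"
      by (rule mult_left_mono[OF exp_ge_add_one_self]) (simp add: E_def)
    ultimately show ?thesis by (simp add: algebra_simps)
  qed
  then have "m * (E * ((r\<^sup>2 - (cmod (z - q))\<^sup>2) / s\<^sup>2)) \<le> m * (exp (a * (cmod (z - q))\<^sup>2) - E)"
    using m by (rule mult_left_mono)
  ultimately show ?thesis by (simp add: E_def a_def mult.assoc)
qed

section \<open>The regular polygon of inradius one\<close>

lemma sin_ge_half: 
  assumes "0 \<le> x" "x \<le> pi / 2"
  shows "x / 2 \<le> sin x"
proof -
  have "concave_on {0..pi/2} sin"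
  proof (rule f''_le0_imp_concave)
    fix x :: real assume x: "x \<in> {0..pi/2}"
    show "(sin has_real_derivative cos x) (at x)" "(cos has_real_derivative - sin x) (at x)"
      by (auto intro!: derivative_eq_intros)
    show "- sin x \<le> 0" using x by (simp add: sin_ge_zero)
  qed simp
  from concave_onD_Icc'[OF this, of x] assms have "2 / pi * x \<le> sin x" by simp
  moreover have "1 / 2 * x \<le> 2 / pi * x"
    using pi_less_4 assms by (intro mult_right_mono) (auto simp: field_simps)
  ultimately show ?thesis by simp
qed

text \<open>Both sines are compared with their arguments through
  \<open>x / 2 \<le> sin x \<le> x\<close>; the factor 6 is twice the largest exponent 3.\<close>

lemma sin_mult_compare:
  assumes p: "1 \<le> p" "p \<le> 3" and t: "0 \<le> t" "p * t \<le> pi / 2"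
  shows "sin t / 2 \<le> sin (p * t)" "sin (p * t) \<le> 6 * sin t"
proof -
  have pt: "t \<le> p * t" "p * t \<le> 3 * t" using p t by (simp_all add: mult_right_mono mult_le_cancel_right1)
  have "sin t \<le> t" using t by (intro sin_x_le_x)
  then show "sin t / 2 \<le> sin (p * t)" using sin_ge_half[of "p * t"] pt t by linarith
  have "sin (p * t) \<le> p * t" using pt t by (intro sin_x_le_x) linarith
  then show "sin (p * t) \<le> 6 * sin t" using sin_ge_half[of t] pt t by linarith
qed

text \<open>The polygon is centred at 0 with inradius 1 and its vertex 0, the apex, on the positive real
  axis. \<open>side_gap n j\<close> is the signed distance to the line of side \<open>j\<close>, so \<open>n - 1\<close> and \<open>0\<close> are the sides
  at the apex; \<open>vsector\<close> consists of the points whose nearest vertex is the apex.\<close>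

definition side_gap :: "nat \<Rightarrow> nat \<Rightarrow> complex \<Rightarrow> real" where
  "side_gap n j z = 1 - Re (z * cis (- ((2 * real j + 1) * pi / real n)))"

definition poly_closed :: "nat \<Rightarrow> complex set" where
  "poly_closed n = {z. \<forall>j<n. 0 \<le> side_gap n j z}"

definition poly_open :: "nat \<Rightarrow> complex set" where
  "poly_open n = {z. \<forall>j<n. 0 < side_gap n j z}"

definition vsector :: "nat \<Rightarrow> complex set" where
  "vsector n = {z. \<exists>t\<ge>0. \<exists>\<gamma>. \<bar>\<gamma>\<bar> \<le> pi / real n \<and> z = of_real t * cis \<gamma>}"

definition corner_gap :: "nat \<Rightarrow> complex \<Rightarrow> real" where
  "corner_gap n z = min (side_gap n 0 z) (side_gap n (n - 1) z)"

definition apex :: "nat \<Rightarrow> complex" where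
  "apex n = of_real (1 / cos (pi / real n))"

text \<open>The quotient of pi by the interior angle \<open>(n - 2) pi / n\<close>.\<close>

definition corner_exp :: "nat \<Rightarrow> real" where
  "corner_exp n = real n / (real n - 2)"

text \<open>Taking the real part of a principal power avoids naming an angle. The branch cut causes
  no trouble because \<open>apex n - z\<close> has nonnegative real part on the polygon.\<close>

definition corner_fun :: "nat \<Rightarrow> complex \<Rightarrow> real" where
  "corner_fun n z = Re ((apex n - z) powr of_real (corner_exp n))"

lemma Re_polar_cis: "Re (of_real t * cis a * cis b) = t * cos (a + b)"
  by (simp add: cis_mult mult.assoc)

lemma side_gap_last:
  assumes "n \<ge> 1"
  shows "side_gap n (n - 1) z = 1 - Re (z * cis (pi / real n))"
proof -
  have "- ((2 * real (n - 1) + 1) * pi / real n) = pi / real n - 2 * pi"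
    using assms by (simp add: of_nat_diff field_simps)
  moreover have "cis (pi / real n - 2 * pi) = cis (pi / real n)"
    by (simp add: complex_eq_iff cos_diff sin_diff)
  ultimately show ?thesis by (simp add: side_gap_def)
qed

lemma side_gap_0: "side_gap n 0 z = 1 - Re (z * cis (- (pi / real n)))"
  by (simp add: side_gap_def)

lemma continuous_on_side_gap: "continuous_on A (side_gap n j)"
  unfolding side_gap_def by (intro continuous_intros)

lemma side_gap_lipschitz: "side_gap n j w \<ge> side_gap n j z - cmod (w - z)"
proof -
  have "Re ((w - z) * cis a) \<le> cmod (w - z)" for a
    using complex_Re_le_cmod[of "(w - z) * cis a"] by (simp add: norm_mult)
  from this[of "- ((2 * real j + 1) * pi / real n)"] show ?thesis
    by (simp add: side_gap_def algebra_simps)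
qed

lemma side_gap_0_at_origin [simp]: "side_gap n j 0 = 1"
  by (simp add: side_gap_def)

lemma ball_subset_poly_open:
  assumes "\<And>j. j < n \<Longrightarrow> side_gap n j z \<ge> r"
  shows "ball z r \<subseteq> poly_open n"
proof
  fix w assume "w \<in> ball z r"
  then have "cmod (w - z) < r" by (simp add: dist_norm norm_minus_commute)
  then have "0 < side_gap n j w" if "j < n" for j
    using side_gap_lipschitz[of n j z w] assms[OF that] by linarith
  then show "w \<in> poly_open n" by (simp add: poly_open_def)
qed

lemma unit_ball_subset_poly_open: "ball 0 1 \<subseteq> poly_open n"
  by (rule ball_subset_poly_open) simp

lemma poly_open_subset_closed: "poly_open n \<subseteq> poly_closed n"
  by (auto simp: poly_open_def poly_closed_def less_imp_le)

lemma unit_cball_subset_poly_closed: "cball 0 1 \<subseteq> poly_closed n"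
proof
  fix w assume "w \<in> cball (0::complex) 1"
  then have "0 \<le> side_gap n j w" for j
    using side_gap_lipschitz[of n j 0 w] by simp
  then show "w \<in> poly_closed n" by (simp add: poly_closed_def)
qed

lemma closed_poly_closed: "closed (poly_closed n)"
proof -
  have "poly_closed n = (\<Inter>j\<in>{..<n}. {z. 0 \<le> side_gap n j z})"
    by (auto simp: poly_closed_def)
  also have "closed \<dots>"
    by (intro closed_INT ballI closed_Collect_le continuous_on_side_gap continuous_intros)
  finally show ?thesis .
qed

lemma open_poly_open: "open (poly_open n)"
proof -
  have "poly_open n = (\<Inter>j\<in>{..<n}. {z. 0 < side_gap n j z})"
    by (auto simp: poly_open_def)
  also have "open \<dots>"
    by (intro open_INT ballI open_Collect_less continuous_on_side_gap continuous_intros) auto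
  finally show ?thesis .
qed

lemma poly_open_interior: "poly_open n \<subseteq> interior (poly_closed n)"
  using open_poly_open poly_open_subset_closed interior_maximal by blast

lemma side_gap_convex_combination:
  "side_gap n j ((1 - t) *\<^sub>R a + t *\<^sub>R b) = (1 - t) * side_gap n j a + t * side_gap n j b"
  by (simp add: side_gap_def algebra_simps)

text \<open>Rounding \<open>\<beta> n / (2 pi)\<close> to the nearest integer leaves an error of at
  most half a step, that is an angle of at most pi/n; the integer is then reduced modulo
  \<open>n\<close>.\<close>

lemma cis_sector_ex:
  assumes n: "n \<ge> 1"
  shows "\<exists>k<n. \<exists>\<gamma>. \<bar>\<gamma>\<bar> \<le> pi / real n \<and> cis \<beta> = cis (2 * pi * real k / real n + \<gamma>)"
proof -
  define N where "N = round (\<beta> * real n / (2 * pi))"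
  define \<gamma> where "\<gamma> = \<beta> - 2 * pi * of_int N / real n"
  define k where "k = nat (N mod int n)"
  have k: "k < n" "int k = N mod int n" using n by (auto simp: k_def nat_less_iff)
  have N: "of_int N = real k + real n * of_int (N div int n)"
  proof -
    have "N = int k + int n * (N div int n)" using k(2) by simp
    then have "real_of_int N = of_int (int k + int n * (N div int n))" by simp
    then show ?thesis by simp
  qed
  have "\<bar>of_int N - \<beta> * real n / (2 * pi)\<bar> \<le> 1 / 2"
    unfolding N_def by (rule of_int_round_abs_le)
  moreover have "\<gamma> = - ((of_int N - \<beta> * real n / (2 * pi)) * (2 * pi / real n))"
    using n by (simp add: \<gamma>_def field_simps)
  then have "\<bar>\<gamma>\<bar> = \<bar>of_int N - \<beta> * real n / (2 * pi)\<bar> * (2 * pi / real n)"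
    by (simp add: abs_mult)
  ultimately have "\<bar>\<gamma>\<bar> \<le> 1 / 2 * (2 * pi / real n)"
    using mult_right_mono[of _ "1/2" "2 * pi / real n"] by simp
  then have 1: "\<bar>\<gamma>\<bar> \<le> pi / real n" by simp
  have "\<beta> = (2 * pi * real k / real n + \<gamma>) + 2 * pi * of_int (N div int n)"
    using n by (simp add: \<gamma>_def N field_simps)
  then have "cis \<beta> = cis ((2 * pi * real k / real n + \<gamma>) + 2 * pi * of_int (N div int n))"
    by (rule arg_cong)
  also have "\<dots> = cis (2 * pi * real k / real n + \<gamma>) * cis (2 * pi * of_int (N div int n))"
    by (rule cis_mult[symmetric])
  also have "cis (2 * pi * of_int (N div int n)) = 1" by (rule cis_multiple_2pi) simp
  finally show ?thesis using 1 k(1) by auto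
qed

lemma vsector_rotate_ex:
  assumes n: "n \<ge> 1"
  shows "\<exists>k<n. z * cis (- (2 * pi * real k / real n)) \<in> vsector n"
proof -
  obtain k \<gamma> where k: "k < n" "\<bar>\<gamma>\<bar> \<le> pi / real n" "cis (Arg z) = cis (2 * pi * real k / real n + \<gamma>)"
    using cis_sector_ex[OF n, of "Arg z"] by blast
  have "z = of_real (cmod z) * cis (Arg z)"
    by (metis rcis_cmod_Arg rcis_def)
  then have "z * cis (- (2 * pi * real k / real n)) =
      of_real (cmod z) * (cis (2 * pi * real k / real n + \<gamma>) * cis (- (2 * pi * real k / real n)))"
    unfolding k(3) by (metis mult.assoc)
  also have "\<dots> = of_real (cmod z) * cis \<gamma>" unfolding cis_mult by simp
  finally have "z * cis (- (2 * pi * real k / real n)) = of_real (cmod z) * cis \<gamma>" .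
  then show ?thesis using k unfolding vsector_def mem_Collect_eq by (metis norm_ge_zero)
qed

text \<open>By \<open>cos_diff_cos\<close> the difference of two gaps is a nonnegative multiple of a
  product of two sines with arguments between 0 and pi. The sign of \<open>\<gamma>\<close> tells
  which of the two sides at the apex is the nearer one.\<close>

lemma corner_gap_le_side_gap:
  assumes n: "n \<ge> 1" and z: "z \<in> vsector n" and j: "j < n"
  shows "corner_gap n z \<le> side_gap n j z"
proof -
  define h where "h = pi / real n"
  have hn: "real n * h = pi" and h0: "h > 0" using n by (auto simp: h_def)
  obtain t \<gamma> where t: "t \<ge> 0" "\<bar>\<gamma>\<bar> \<le> h" "z = of_real t * cis \<gamma>"
    using z by (auto simp: vsector_def h_def)
  have jh: "0 \<le> real j * h" "(real j + 1) * h \<le> pi"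
    using h0 j mult_right_mono[of "real j + 1" "real n" h] hn by auto
  have jh1: "(real j + 1) * h = real j * h + h" by (simp add: algebra_simps)
  have gj: "side_gap n j z = 1 - t * cos (\<gamma> - (2 * real j + 1) * h)"
    unfolding side_gap_def t(3) Re_polar_cis by (simp add: h_def)
  have g0: "side_gap n 0 z = 1 - t * cos (\<gamma> - h)"
    unfolding side_gap_0 t(3) Re_polar_cis by (simp add: h_def)
  have g1: "side_gap n (n - 1) z = 1 - t * cos (\<gamma> + h)"
    unfolding side_gap_last[OF n] t(3) Re_polar_cis by (simp add: h_def)
  show ?thesis
  proof (cases "\<gamma> \<ge> 0")
    case True
    have "cos (\<gamma> - h) - cos (\<gamma> - (2 * real j + 1) * h) =
        2 * sin (((\<gamma> - h) + (\<gamma> - (2 * real j + 1) * h)) / 2) * sin (((\<gamma> - (2 * real j + 1) * h) - (\<gamma> - h)) / 2)"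
      by (rule cos_diff_cos)
    also have "((\<gamma> - h) + (\<gamma> - (2 * real j + 1) * h)) / 2 = - ((real j + 1) * h - \<gamma>)" by (simp add: field_simps)
    also have "((\<gamma> - (2 * real j + 1) * h) - (\<gamma> - h)) / 2 = - (real j * h)" by (simp add: field_simps)
    finally have "cos (\<gamma> - h) - cos (\<gamma> - (2 * real j + 1) * h) = 2 * sin ((real j + 1) * h - \<gamma>) * sin (real j * h)"
      unfolding sin_minus by simp
    moreover have "sin ((real j + 1) * h - \<gamma>) \<ge> 0" "sin (real j * h) \<ge> 0"
      using True t(2) jh h0 jh1 by (intro sin_ge_zero; linarith)+
    ultimately have "cos (\<gamma> - (2 * real j + 1) * h) \<le> cos (\<gamma> - h)"
      by (metis diff_ge_0_iff_ge mult_nonneg_nonneg zero_le_numeral)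
    then have "side_gap n 0 z \<le> side_gap n j z" using t(1) by (simp add: g0 gj mult_left_mono)
    then show ?thesis by (simp add: corner_gap_def)
  next
    case False
    have "cos (\<gamma> + h) - cos (\<gamma> - (2 * real j + 1) * h) =
        2 * sin (((\<gamma> + h) + (\<gamma> - (2 * real j + 1) * h)) / 2) * sin (((\<gamma> - (2 * real j + 1) * h) - (\<gamma> + h)) / 2)"
      by (rule cos_diff_cos)
    also have "((\<gamma> + h) + (\<gamma> - (2 * real j + 1) * h)) / 2 = - (real j * h - \<gamma>)" by (simp add: field_simps)
    also have "((\<gamma> - (2 * real j + 1) * h) - (\<gamma> + h)) / 2 = - ((real j + 1) * h)" by (simp add: field_simps)
    finally have "cos (\<gamma> + h) - cos (\<gamma> - (2 * real j + 1) * h) = 2 * sin (real j * h - \<gamma>) * sin ((real j + 1) * h)"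
      unfolding sin_minus by simp
    moreover have "sin (real j * h - \<gamma>) \<ge> 0" "sin ((real j + 1) * h) \<ge> 0"
      using False t(2) jh h0 jh1 by (intro sin_ge_zero; linarith)+
    ultimately have "cos (\<gamma> - (2 * real j + 1) * h) \<le> cos (\<gamma> + h)"
      by (metis diff_ge_0_iff_ge mult_nonneg_nonneg zero_le_numeral)
    then have "side_gap n (n - 1) z \<le> side_gap n j z" using t(1) unfolding g1 gj by (simp add: mult_left_mono)
    then show ?thesis by (simp add: corner_gap_def)
  qed
qed

lemma angle_bounds:
  assumes "n \<ge> 3"
  shows "0 < pi / real n" "pi / real n \<le> pi / 3" "cos (pi / real n) \<ge> 1 / 2" "sin (pi / real n) > 0"
    "tan (pi / real n) > 0"
proof -
  show 1: "0 < pi / real n" "pi / real n \<le> pi / 3" using assms by (auto simp: field_simps)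
  show "cos (pi / real n) \<ge> 1 / 2"
    using cos_monotone_0_pi_le[of "pi / real n" "pi / 3"] 1 by (simp add: cos_60)
  show "sin (pi / real n) > 0" using 1 pi_gt_zero by (intro sin_gt_zero) linarith+
  show "tan (pi / real n) > 0" using 1 pi_gt_zero by (intro tan_gt_zero) linarith+
qed

lemma apex_gaps:
  assumes n: "n \<ge> 3"
  shows "side_gap n 0 z = Re ((apex n - z) * cis (- (pi / real n)))"
    "side_gap n (n - 1) z = Re ((apex n - z) * cis (pi / real n))"
proof -
  have "Re (apex n * cis (pi / real n)) = 1" "Re (apex n * cis (- (pi / real n))) = 1"
    using angle_bounds(3)[OF n] by (auto simp: apex_def)
  then show "side_gap n 0 z = Re ((apex n - z) * cis (- (pi / real n)))"
    "side_gap n (n - 1) z = Re ((apex n - z) * cis (pi / real n))"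
    using n by (auto simp only: side_gap_0 side_gap_last left_diff_distrib minus_complex.sel)
qed

lemma corner_gap_le_dist:
  assumes n: "n \<ge> 3"
  shows "corner_gap n z \<le> cmod (apex n - z)"
proof -
  have "Re ((apex n - z) * cis a) \<le> cmod (apex n - z)" for a
    using complex_Re_le_cmod[of "(apex n - z) * cis a"] by (simp add: norm_mult)
  then show ?thesis unfolding corner_gap_def apex_gaps[OF n] by (meson min.coboundedI1)
qed

text \<open>Some outer normal makes an angle of at most pi/n with \<open>z\<close>, and
  \<open>cos (pi / n) \<ge> 1 / 2\<close>, so the gap of that side bounds the modulus. The shift of
  \<open>Arg z\<close> by pi/n turns the grid of vertex directions in \<open>cis_sector_ex\<close>
  into the grid of normals.\<close>

lemma poly_closed_bounded:
  assumes n: "n \<ge> 3" and z: "z \<in> poly_closed n"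
  shows "cmod z \<le> 2"
proof -
  have z0: "z = of_real (cmod z) * cis (Arg z)"
    by (metis rcis_cmod_Arg rcis_def)
  obtain k \<gamma> where k: "k < n" "\<bar>\<gamma>\<bar> \<le> pi / real n"
    "cis (Arg z - pi / real n) = cis (2 * pi * real k / real n + \<gamma>)"
    using cis_sector_ex[of n "Arg z - pi / real n"] n by auto
  have "cis (Arg z) = cis (Arg z - pi / real n) * cis (pi / real n)" by (simp add: cis_mult)
  also have "\<dots> = cis ((2 * real k + 1) * pi / real n + \<gamma>)"
    unfolding k(3) cis_mult by (simp add: algebra_simps add_divide_distrib)
  finally have "Re (z * cis (- ((2 * real k + 1) * pi / real n))) = cmod z * cos \<gamma>"
    by (subst z0) (simp add: Re_polar_cis mult.assoc cis_mult)
  moreover have "side_gap n k z \<ge> 0" using z k(1) by (simp add: poly_closed_def)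
  ultimately have "cmod z * cos \<gamma> \<le> 1" by (simp add: side_gap_def)
  moreover have "cos \<gamma> \<ge> 1 / 2"
  proof -
    have "cos (pi / 3) \<le> cos \<bar>\<gamma>\<bar>"
      using k(2) angle_bounds(2)[OF n] by (intro cos_monotone_0_pi_le) linarith+
    then show ?thesis by (simp add: cos_60)
  qed
  then have "cmod z * (1 / 2) \<le> cmod z * cos \<gamma>" by (intro mult_left_mono) auto
  ultimately show ?thesis by simp
qed

lemma compact_poly_closed:
  assumes "n \<ge> 3"
  shows "compact (poly_closed n)"
  using closed_poly_closed poly_closed_bounded[OF assms]
  by (auto simp: compact_eq_bounded_closed bounded_iff)

text \<open>The disc about the apex through the two adjacent midpoints is tangent to the rays from
  the centre through these midpoints.\<close>

lemma corner_disc_subset_vsector: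
  assumes n: "n \<ge> 3" and z: "cmod (apex n - z) \<le> tan (pi / real n)"
  shows "z \<in> vsector n"
proof -
  define h where "h = pi / real n"
  note ab = angle_bounds[OF n, folded h_def]
  have ap: "apex n = of_real (1 / cos h)" by (simp add: apex_def h_def)
  \<comment> \<open>Rotation by \<open>- h\<close> or \<open>h\<close> takes the apex to
    \<open>1 - i tan h\<close> or \<open>1 + i tan h\<close>, so the rotated disc touches the real
    axis and lies on one side of it.\<close>
  have *: "\<bar>Im ((apex n - z) * cis a)\<bar> \<le> sin h / cos h" for a
    using abs_Im_le_cmod[of "(apex n - z) * cis a"] z by (simp add: norm_mult tan_def h_def)
  have 1: "Im (z * cis (- h)) \<le> 0" using *[of "- h"] by (simp add: ap algebra_simps abs_le_iff)
  have 2: "Im (z * cis h) \<ge> 0" using *[of h] by (simp add: ap algebra_simps abs_le_iff)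
  have z0: "z = of_real (cmod z) * cis (Arg z)"
    by (metis rcis_cmod_Arg rcis_def)
  have "Re z \<ge> 0"
  proof -
    have "Re z * (2 * sin h) = Im (z * cis h) - Im (z * cis (- h))" by (simp add: algebra_simps)
    then have "Re z * (2 * sin h) \<ge> 0" using 1 2 by simp
    then show ?thesis using ab(4) by (simp add: zero_le_mult_iff)
  qed
  show ?thesis
  proof (cases "z = 0")
    case True
    then show ?thesis using ab by (auto simp: vsector_def h_def[symmetric] intro!: exI[of _ 0])
  next
    case False
    have A: "\<bar>Arg z\<bar> \<le> pi / 2" using \<open>Re z \<ge> 0\<close> by (simp only: Arg_Re_nonneg)
    have "cmod z * sin (Arg z - h) \<le> 0" 
      using 1 by (subst (asm) z0) (simp add: sin_diff cos_diff algebra_simps)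
    then have s1: "sin (Arg z - h) \<le> 0" using False by (simp add: mult_le_0_iff)
    have "cmod z * sin (Arg z + h) \<ge> 0"
      using 2 by (subst (asm) z0) (simp add: sin_add cos_add algebra_simps)
    then have s2: "sin (Arg z + h) \<ge> 0" using False by (simp add: zero_le_mult_iff)
    have "sin (- (Arg z + h)) \<le> 0" using s2 unfolding sin_minus by simp
    then have "- h \<le> Arg z" using sin_gt_zero[of "- (Arg z + h)"] A ab by linarith
    moreover have "Arg z \<le> h" using s1 sin_gt_zero[of "Arg z - h"] A ab by linarith
    ultimately have "\<bar>Arg z\<bar> \<le> pi / real n" by (simp add: h_def)
    then show ?thesis
      using z0 unfolding vsector_def mem_Collect_eq by (metis norm_ge_zero)
  qed
qed

section \<open>The harmonic function of the corner\<close>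

lemma corner_exp_bounds:
  assumes n: "n \<ge> 3"
  shows "1 \<le> corner_exp n" "corner_exp n \<le> 3" "corner_exp n * (pi / 2 - pi / real n) = pi / 2"
    "corner_exp n - 1 = 2 / (real n - 2)"
proof -
  have "real n \<ge> 3" using n by simp
  then show "1 \<le> corner_exp n" "corner_exp n \<le> 3" "corner_exp n * (pi / 2 - pi / real n) = pi / 2"
    "corner_exp n - 1 = 2 / (real n - 2)"
    by (auto simp: corner_exp_def field_simps)
qed

text \<open>The two gaps at the apex add up to \<open>2 cos (pi / n)\<close> times this real
  part.\<close>

lemma corner_Re_nonneg:
  assumes n: "n \<ge> 3"
  shows "z \<in> poly_closed n \<Longrightarrow> Re (apex n - z) \<ge> 0" "z \<in> poly_open n \<Longrightarrow> Re (apex n - z) > 0"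
proof -
  have c: "cos (pi / real n) > 0" using angle_bounds(3)[OF n] by simp
  have e: "side_gap n 0 z + side_gap n (n - 1) z = 2 * cos (pi / real n) * Re (apex n - z)"
    unfolding apex_gaps[OF n] by (simp add: algebra_simps)
  have n1: "0 < n" "n - 1 < n" using n by auto
  {
    assume "z \<in> poly_closed n"
    then have "0 \<le> side_gap n 0 z + side_gap n (n - 1) z" using n1 unfolding poly_closed_def by simp
    then have "0 \<le> cos (pi / real n) * Re (apex n - z)" unfolding e by simp
    then show "Re (apex n - z) \<ge> 0" using c by (simp only: zero_le_mult_iff) linarith
  next
    assume "z \<in> poly_open n"
    then have "0 < side_gap n 0 z + side_gap n (n - 1) z"
      using n1 unfolding poly_open_def by (intro add_pos_pos) auto
    then have "0 < cos (pi / real n) * Re (apex n - z)" unfolding e by simp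
    then show "Re (apex n - z) > 0" using c by (simp only: zero_less_mult_iff) linarith
  }
qed

text \<open>The signs of \<open>cos (\<psi> + h)\<close> and \<open>cos (\<psi> - h)\<close>
  determine the angle only modulo 2 pi; the bound \<open>\<bar>\<psi>\<bar> \<le> pi / 2\<close>,
  which comes from the nonnegative real part, selects the right interval.\<close>

lemma corner_polar:
  assumes n: "n \<ge> 3" and z: "z \<in> poly_closed n" "z \<noteq> apex n"
  obtains r \<psi> where "r = cmod (apex n - z)" "r > 0" "\<bar>\<psi>\<bar> \<le> pi / 2 - pi / real n"
    "apex n - z = of_real r * cis \<psi>"
proof -
  define h where "h = pi / real n"
  note ab = angle_bounds[OF n, folded h_def]
  define r where "r = cmod (apex n - z)"
  define \<psi> where "\<psi> = Arg (apex n - z)"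
  have r: "r > 0" using z(2) by (simp add: r_def)
  have pol: "apex n - z = of_real r * cis \<psi>"
    unfolding r_def \<psi>_def by (metis rcis_cmod_Arg rcis_def)
  have n1: "0 < n" "n - 1 < n" using n by auto
  have "side_gap n 0 z \<ge> 0" "side_gap n (n - 1) z \<ge> 0"
    using z(1) n1 unfolding poly_closed_def by blast+
  then have "r * cos (\<psi> - h) \<ge> 0" "r * cos (\<psi> + h) \<ge> 0"
    unfolding apex_gaps[OF n] pol Re_polar_cis by (auto simp: h_def)
  then have c: "cos (\<psi> - h) \<ge> 0" "cos (\<psi> + h) \<ge> 0" using r by (auto simp: zero_le_mult_iff)
  have A: "\<bar>\<psi>\<bar> \<le> pi / 2"
    unfolding \<psi>_def Arg_Re_nonneg by (rule corner_Re_nonneg(1)[OF n z(1)])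
  have cs: "cos x < 0" if "pi / 2 < x" "x < pi" for x
    using cos_monotone_0_pi[of "pi / 2" x] that by simp
  have "\<psi> + h \<le> pi / 2"
    using cs[of "\<psi> + h"] c(2) A ab(1,2) by linarith
  moreover have "h - \<psi> \<le> pi / 2"
  proof -
    have "cos (h - \<psi>) \<ge> 0" using c(1) cos_minus[of "\<psi> - h"] by simp
    then show ?thesis using cs[of "h - \<psi>"] A ab(1,2) by linarith
  qed
  ultimately have "\<bar>\<psi>\<bar> \<le> pi / 2 - pi / real n" by (simp add: h_def abs_le_iff)
  then show ?thesis using that r pol r_def by blast
qed

text \<open>Let \<open>\<omega>\<close> be the angle to the nearer adjacent side. The gap is
  \<open>r sin \<omega>\<close>, and since \<open>p (pi / 2 - h) = pi / 2\<close> the corner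
  function is \<open>r^p sin (p \<omega>)\<close>; \<open>sin_mult_compare\<close> relates the two.
  At the apex, where there is no angle, all terms vanish.\<close>

lemma corner_compare:
  assumes n: "n \<ge> 3" and z: "z \<in> poly_closed n"
  defines "r \<equiv> cmod (apex n - z)" and "p \<equiv> corner_exp n"
  shows "corner_gap n z * r powr (p - 1) / 2 \<le> corner_fun n z"
    "corner_fun n z \<le> 6 * (corner_gap n z * r powr (p - 1))"
proof -
  have "corner_gap n z * r powr (p - 1) / 2 \<le> corner_fun n z \<and>
    corner_fun n z \<le> 6 * (corner_gap n z * r powr (p - 1))"
  proof (cases "z = apex n")
    case True
    then show ?thesis by (simp add: r_def corner_fun_def)
  next
    case False
    define h where "h = pi / real n"
    note ab = angle_bounds[OF n, folded h_def]
    note pb = corner_exp_bounds[OF n, folded h_def p_def]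
    obtain \<psi> where r0: "r > 0" and \<psi>: "\<bar>\<psi>\<bar> \<le> pi / 2 - h" "apex n - z = of_real r * cis \<psi>"
      using corner_polar[OF n z False] unfolding r_def h_def by metis
    define \<omega> where "\<omega> = pi / 2 - h - \<bar>\<psi>\<bar>"
    have \<omega>: "0 \<le> \<omega>" "\<omega> \<le> pi / 2 - h" using \<psi>(1) by (auto simp: \<omega>_def)
    have g0: "side_gap n 0 z = r * cos (\<psi> - h)" and g1: "side_gap n (n - 1) z = r * cos (\<psi> + h)"
      unfolding apex_gaps[OF n] \<psi>(2) Re_polar_cis by (auto simp: h_def)
    have sw: "sin \<omega> = cos (\<bar>\<psi>\<bar> + h)" by (simp add: \<omega>_def cos_sin_eq algebra_simps)
    have gap: "corner_gap n z = r * sin \<omega>"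
    proof (cases "\<psi> \<ge> 0")
      case True
      have "cos (\<psi> + h) \<le> cos \<bar>\<psi> - h\<bar>"
        using True \<psi>(1) ab(1,2) pi_gt_zero by (intro cos_monotone_0_pi_le) linarith+
      then show ?thesis using True r0 unfolding corner_gap_def g0 g1 sw by (simp add: min_def)
    next
      case False
      have "cos (h - \<psi>) \<le> cos \<bar>\<psi> + h\<bar>"
        using False \<psi>(1) ab(1,2) pi_gt_zero by (intro cos_monotone_0_pi_le) linarith+
      moreover have "cos (\<psi> - h) = cos (h - \<psi>)" using cos_minus[of "\<psi> - h"] by simp
      ultimately show ?thesis using False r0 unfolding corner_gap_def g0 g1 sw by (simp add: min_def)
    qed
    have "corner_fun n z = r powr p * cos (p * \<psi>)"
    proof -
      have "Ln (of_real r * cis \<psi>) = of_real (ln r) + \<i> * of_real \<psi>"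
      proof (rule Ln_unique)
        show "exp (of_real (ln r) + \<i> * of_real \<psi>) = of_real r * cis \<psi>"
          using r0 by (simp add: exp_add cis_conv_exp exp_of_real)
      qed (simp, use \<psi>(1) ab(1,2) pi_gt_zero in linarith)+
      moreover have "of_real r * cis \<psi> \<noteq> 0" using r0 by simp
      ultimately show ?thesis
        unfolding corner_fun_def \<psi>(2) powr_def p_def[symmetric]
        using r0 by (simp add: Re_exp powr_def)
    qed
    also have "cos (p * \<psi>) = sin (p * \<omega>)"
    proof -
      have "cos (p * \<psi>) = cos (p * \<bar>\<psi>\<bar>)" by (cases "\<psi> \<ge> 0") auto
      moreover have "p * \<omega> = pi / 2 - p * \<bar>\<psi>\<bar>" using pb(3) by (simp add: \<omega>_def algebra_simps)
      ultimately show ?thesis by (simp add: cos_sin_eq)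
    qed
    finally have w: "corner_fun n z = r powr p * sin (p * \<omega>)" .
    have "p * \<omega> \<le> pi / 2" using mult_left_mono[OF \<omega>(2), of p] pb by simp
    note sm = sin_mult_compare[OF pb(1,2) \<omega>(1) this]
    have rp: "r powr p = r powr (p - 1) * r" using r0 by (simp add: powr_diff)
    have "r powr p * (sin \<omega> / 2) \<le> r powr p * sin (p * \<omega>)" 
      "r powr p * sin (p * \<omega>) \<le> r powr p * (6 * sin \<omega>)"
      by (rule mult_left_mono, use sm in simp, simp)+
    then show ?thesis unfolding w gap by (simp add: rp algebra_simps)
  qed
  then show "corner_gap n z * r powr (p - 1) / 2 \<le> corner_fun n z"
    "corner_fun n z \<le> 6 * (corner_gap n z * r powr (p - 1))" by auto
qed

lemma corner_gap_nonneg: "n \<ge> 1 \<Longrightarrow> z \<in> poly_closed n \<Longrightarrow> corner_gap n z \<ge> 0"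
  by (auto simp: corner_gap_def poly_closed_def)

lemma corner_fun_nonneg:
  assumes "n \<ge> 3" "z \<in> poly_closed n"
  shows "corner_fun n z \<ge> 0"
proof -
  have "0 \<le> corner_gap n z * cmod (apex n - z) powr (corner_exp n - 1) / 2"
    using corner_gap_nonneg[of n z] assms by auto
  also have "\<dots> \<le> corner_fun n z" by (rule corner_compare(1)[OF assms])
  finally show ?thesis .
qed

lemma continuous_on_corner_fun:
  assumes "n \<ge> 3"
  shows "continuous_on (poly_closed n) (corner_fun n)"
  unfolding corner_fun_def
  by (intro continuous_intros)
    (use corner_Re_nonneg(1)[OF assms] corner_exp_bounds(1)[OF assms] in auto)

text \<open>Euler's relation for the homogeneous function \<open>(apex n - z)^p\<close> turns the
  mixed term of the product formula into a multiple of the function itself. The case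
  \<open>a = 0\<close> gives harmonicity, a negative \<open>a\<close> the supersolution near the
  vertex.\<close>

lemma has_lap_corner_fun_mult:
  assumes n: "n \<ge> 3" and z: "z \<in> poly_open n"
  shows "has_lap (\<lambda>w. corner_fun n w * (b + a * (cmod (w - apex n))\<^sup>2)) z
    (4 * a * (corner_exp n + 1) * corner_fun n z)"
proof -
  define p where "p = complex_of_real (corner_exp n)"
  define F where "F = (\<lambda>w. (apex n - w) powr p)"
  define F' where "F' = (\<lambda>w. - p * (apex n - w) powr (p - 1))"
  define F'' where "F'' = (\<lambda>w. p * (p - 1) * (apex n - w) powr (p - 1 - 1))"
  have np: "apex n - w \<notin> \<real>\<^sub>\<le>\<^sub>0" if "w \<in> poly_open n" for w
    using corner_Re_nonneg(2)[OF n that] by (auto simp: complex_nonpos_Reals_iff)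
  have sub: "((\<lambda>w. apex n - w) has_field_derivative -1) (at w)" for w
    by (auto intro!: derivative_eq_intros)
  have D: "((\<lambda>w. (apex n - w) powr s) has_field_derivative (s * (apex n - w) powr (s - 1)) * (-1)) (at w)"
    if "w \<in> poly_open n" for w s
    using DERIV_chain2[OF has_field_derivative_powr[OF np[OF that]] sub] .
  have "has_lap (\<lambda>w. Re (F w) * (b + a * (cmod (w - apex n))\<^sup>2)) z
      (4 * a * (Re (F' z * (z - apex n)) + Re (F z)))"
  proof (rule has_lap_Re_holomorphic_mult_quadratic[OF open_poly_open z])
    fix w assume w: "w \<in> poly_open n"
    show "(F has_field_derivative F' w) (at w)"
      using D[OF w, of p] by (simp add: F_def F'_def)
    show "(F' has_field_derivative F'' w) (at w)"
      using DERIV_cmult[OF D[OF w, of "p - 1"], of "- p"] unfolding F'_def F''_def by (simp add: mult.assoc)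
  qed
  moreover have "F' z * (z - apex n) = p * F z"
  proof -
    have "apex n - z \<noteq> 0" using np[OF z] by auto
    then have "(apex n - z) powr (p - 1) * (apex n - z) = (apex n - z) powr p"
      by (simp add: powr_diff)
    then show ?thesis by (simp add: F'_def F_def algebra_simps)
  qed
  then have "4 * a * (Re (F' z * (z - apex n)) + Re (F z)) = 4 * a * (corner_exp n + 1) * Re (F z)"
    by (simp add: p_def algebra_simps)
  ultimately have "has_lap (\<lambda>w. Re (F w) * (b + a * (cmod (w - apex n))\<^sup>2)) z
      (4 * a * (corner_exp n + 1) * Re (F z))" by (simp only:)
  then show ?thesis unfolding F_def corner_fun_def p_def .
qed

section \<open>Reflection in the axis of the corner; the corner disc against the incircle\<close>

lemma vsector_cnj: "cnj z \<in> vsector n \<longleftrightarrow> z \<in> vsector n"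
proof -
  have "cnj z \<in> vsector n" if "z \<in> vsector n" for z
  proof -
    obtain t \<gamma> where "t \<ge> 0" "\<bar>\<gamma>\<bar> \<le> pi / real n" "z = of_real t * cis \<gamma>"
      using \<open>z \<in> vsector n\<close> unfolding vsector_def by blast
    then have "cnj z = of_real t * cis (- \<gamma>)" "\<bar>- \<gamma>\<bar> \<le> pi / real n" "t \<ge> 0" by (auto simp: cis_cnj)
    then show ?thesis unfolding vsector_def by blast
  qed
  from this[of z] this[of "cnj z"] show ?thesis by auto
qed

lemma apex_real: "cnj (apex n) = apex n"
  by (simp add: apex_def)

lemma side_gap_cnj:
  assumes n: "n \<ge> 3"
  shows "side_gap n 0 (cnj z) = side_gap n (n - 1) z"
  unfolding apex_gaps[OF n] using apex_real[of n] by (auto simp: complex_eq_iff)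

lemma apex_cis:
  assumes n: "n \<ge> 3"
  shows "apex n * cis (pi / real n) = Complex 1 (tan (pi / real n))"
    "apex n * cis (- (pi / real n)) = Complex 1 (- tan (pi / real n))"
  using angle_bounds(3)[OF n] by (auto simp: apex_def complex_eq_iff tan_def)

lemma corner_gap_cnj: "n \<ge> 3 \<Longrightarrow> corner_gap n (cnj z) = corner_gap n z"
  using side_gap_cnj[of n z] side_gap_cnj[of n "cnj z"] by (simp add: corner_gap_def min.commute)

lemma poly_closed_cnj:
  assumes n: "n \<ge> 3" and z: "z \<in> vsector n" "z \<in> poly_closed n"
  shows "cnj z \<in> poly_closed n"
proof -
  have n1: "n \<ge> 1" using n by simp
  have "corner_gap n (cnj z) \<ge> 0" unfolding corner_gap_cnj[OF n] by (rule corner_gap_nonneg[OF n1 z(2)])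
  then have "0 \<le> side_gap n j (cnj z)" if "j < n" for j
    using corner_gap_le_side_gap[OF n1 _ that, of "cnj z"] z(1) vsector_cnj by force
  then show ?thesis by (simp add: poly_closed_def)
qed

text \<open>\<open>(X, -Y)\<close> are the coordinates of \<open>z\<close> along and across the normal of side 0; the bound on \<open>Y\<close>
  implies that the foot of the perpendicular from \<open>z\<close> lies on the side and not only on its line.\<close>

lemma half_sector:
  assumes n: "n \<ge> 3" and z: "z \<in> poly_closed n"
    and t: "t \<ge> 0" "0 \<le> \<gamma>" "\<gamma> \<le> pi / real n" "z = of_real t * cis \<gamma>"
  defines "X \<equiv> t * cos (pi / real n - \<gamma>)" and "Y \<equiv> t * sin (pi / real n - \<gamma>)"
  shows "side_gap n 0 z = 1 - X" "corner_gap n z = 1 - X" "0 \<le> X" "X \<le> 1" "0 \<le> Y"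
    "Y \<le> X * tan (pi / real n)" "z = Complex X (- Y) * cis (pi / real n)"
proof -
  define h where "h = pi / real n"
  note ab = angle_bounds[OF n, folded h_def]
  have n1: "n \<ge> 1" using n by simp
  have cs: "cos (\<gamma> - h) = cos (h - \<gamma>)" using cos_minus[of "\<gamma> - h"] by simp
  have g0: "side_gap n 0 z = 1 - t * cos (h - \<gamma>)"
    unfolding side_gap_0 t(4) Re_polar_cis by (simp add: h_def[symmetric] cs)
  have g1: "side_gap n (n - 1) z = 1 - t * cos (\<gamma> + h)"
    unfolding side_gap_last[OF n1] t(4) Re_polar_cis by (simp add: h_def)
  show s: "side_gap n 0 z = 1 - X" by (simp add: g0 X_def h_def)
  have "cos (\<gamma> + h) \<le> cos (h - \<gamma>)"
    using t ab pi_gt_zero unfolding h_def[symmetric] by (intro cos_monotone_0_pi_le) linarith+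
  then have "side_gap n 0 z \<le> side_gap n (n - 1) z" unfolding g0 g1 using t(1) by (simp add: mult_left_mono)
  then show "corner_gap n z = 1 - X" by (simp add: corner_gap_def s)
  have "side_gap n 0 z \<ge> 0" using z n unfolding poly_closed_def by simp
  then show "X \<le> 1" by (simp add: s)
  have "cos (h - \<gamma>) \<ge> cos h" using t ab pi_gt_zero unfolding h_def[symmetric] by (intro cos_monotone_0_pi_le) linarith+
  then have "cos (h - \<gamma>) \<ge> 0" using ab(3) by linarith
  then show "0 \<le> X" using t(1) by (simp add: X_def h_def)
  show "0 \<le> Y" unfolding Y_def h_def[symmetric]
    using t ab pi_gt_zero unfolding h_def[symmetric] by (intro mult_nonneg_nonneg sin_ge_zero) linarith+
  have c0: "cos h > 0" using ab(3) by simp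
  have "sin \<gamma> \<ge> 0" using t ab pi_gt_zero unfolding h_def[symmetric] by (intro sin_ge_zero) linarith+
  moreover have "sin \<gamma> = sin (h - (h - \<gamma>))" by simp
  then have "sin \<gamma> = sin h * cos (h - \<gamma>) - cos h * sin (h - \<gamma>)" by (simp only: sin_diff)
  ultimately have "cos h * sin (h - \<gamma>) \<le> sin h * cos (h - \<gamma>)" by simp
  then have "sin (h - \<gamma>) \<le> cos (h - \<gamma>) * tan h" using c0 by (simp add: tan_def field_simps)
  then show "Y \<le> X * tan (pi / real n)"
    using t(1) unfolding X_def Y_def mult.assoc h_def by (rule mult_left_mono)
  have "Complex X (- Y) = of_real t * cis (\<gamma> - h)"
    using cs sin_minus[of "h - \<gamma>"] by (simp add: complex_eq_iff X_def Y_def h_def)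
  then have "Complex X (- Y) * cis h = of_real t * (cis (\<gamma> - h) * cis h)" by simp
  also have "\<dots> = z" unfolding cis_mult by (simp add: t(4))
  finally show "z = Complex X (- Y) * cis (pi / real n)" by (simp add: h_def)
qed

lemma vsector_half:
  assumes z: "z \<in> vsector n"
  obtains t \<gamma> where "t \<ge> 0" "0 \<le> \<gamma>" "\<gamma> \<le> pi / real n" "z = of_real t * cis \<gamma> \<or> cnj z = of_real t * cis \<gamma>"
proof -
  obtain t \<gamma> where t: "t \<ge> 0" "\<bar>\<gamma>\<bar> \<le> pi / real n" "z = of_real t * cis \<gamma>"
    using z unfolding vsector_def by blast
  show ?thesis
  proof (cases "\<gamma> \<ge> 0")
    case True
    then show ?thesis using that[of t \<gamma>] t by auto
  next
    case False
    then show ?thesis using that[of t "- \<gamma>"] t by (auto simp: cis_cnj)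
  qed
qed

text \<open>The hypothesis \<open>out\<close> says that \<open>(X, -Y)\<close> has distance at least
  \<open>T\<close> from the vertex \<open>(1, -T)\<close>. With \<open>Y \<le> T\<close> it yields
  \<open>Y^2 \<le> (1 - X)^2\<close>, hence a margin of \<open>2 X (1 - X)\<close> to the unit
  circle, which suffices for \<open>X > 1 / 4\<close>. For smaller \<open>X\<close> the bounds
  \<open>Y \<le> X T\<close> and \<open>T^2 \<le> 3\<close> keep the modulus below 1/2 or equal to
  it.\<close>

lemma unit_disc_gap:
  fixes X Y T :: real
  assumes X: "X \<le> 1" "Y \<ge> 0" "Y \<le> X * T" and T: "T > 0" "T\<^sup>2 \<le> 3"
    and out: "X\<^sup>2 + Y\<^sup>2 + 1 \<ge> 2 * (X + Y * T)"
  shows "(1 - X) / 2 \<le> 1 - (X\<^sup>2 + Y\<^sup>2)"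
proof -
  have X0: "X \<ge> 0" using X T by (metis linorder_not_le mult_neg_pos order_less_le_trans order_trans)
  have YT: "Y \<le> T" using X T mult_right_mono[of X 1 T] by linarith
  show ?thesis
  proof (cases "X \<le> 1 / 4")
    case True
    have "Y\<^sup>2 \<le> (X * T)\<^sup>2" using X by (intro power_mono) auto
    also have "\<dots> \<le> X\<^sup>2 * 3" using T by (simp add: power_mult_distrib mult_left_mono)
    finally have "X\<^sup>2 + Y\<^sup>2 \<le> 4 * X\<^sup>2" by simp
    also have "\<dots> \<le> 4 * (1 / 4)\<^sup>2" using True X0 by (intro mult_left_mono power_mono) auto
    finally have "X\<^sup>2 + Y\<^sup>2 \<le> 1 / 4" by (simp add: power2_eq_square)
    then show ?thesis using X0 by simp
  next
    case False
    have "Y * Y \<le> Y * T" using YT X by (intro mult_left_mono) auto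
    then have "Y\<^sup>2 \<le> (1 - X)\<^sup>2" using out by (simp add: power2_eq_square algebra_simps)
    then have "1 - (X\<^sup>2 + Y\<^sup>2) \<ge> 2 * X * (1 - X)" by (simp add: power2_eq_square algebra_simps)
    moreover have "2 * X * (1 - X) \<ge> 2 * (1 / 4) * (1 - X)" using False X by (intro mult_right_mono) auto
    ultimately show ?thesis by simp
  qed
qed

lemma tan_angle_bound:
  assumes n: "n \<ge> 3"
  shows "(tan (pi / real n))\<^sup>2 \<le> 3" "tan (pi / real n) \<le> 2" "tan (pi / real n) \<ge> 3 / (2 * real n)"
    "(cmod (apex n))\<^sup>2 = 1 + (tan (pi / real n))\<^sup>2" "cmod (apex n) \<le> 2"
proof -
  define h where "h = pi / real n"
  note ab = angle_bounds[OF n, folded h_def]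
  have c0: "cos h > 0" using ab(3) by simp
  have t: "(tan h)\<^sup>2 + 1 = inverse (cos h ^ 2)" using tan_sec[of h] c0 by (simp add: power_inverse)
  have "inverse ((cos h)\<^sup>2) \<le> inverse ((1 / 2)\<^sup>2)"
    using ab(3) by (intro le_imp_inverse_le power_mono) auto
  then show t3: "(tan (pi / real n))\<^sup>2 \<le> 3" using t by (simp add: h_def power2_eq_square)
  have "(tan h)\<^sup>2 \<le> 2\<^sup>2" using t3 by (simp add: h_def)
  then show "tan (pi / real n) \<le> 2" unfolding h_def[symmetric] by (rule power2_le_imp_le) simp
  have "h / 2 \<le> sin h" using ab pi_gt_zero by (intro sin_ge_half) linarith+
  also have "\<dots> \<le> sin h / cos h" using ab(4) c0 cos_le_one[of h] by (simp add: le_divide_eq)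
  finally have "h / 2 \<le> tan h" by (simp add: tan_def)
  moreover have "3 / real n \<le> h" using pi_gt3 n unfolding h_def by (intro divide_right_mono) auto
  ultimately show "tan (pi / real n) \<ge> 3 / (2 * real n)" by (simp add: h_def field_simps)
  have "cmod (apex n) = inverse (cos h)" using c0 by (simp add: apex_def h_def norm_divide inverse_eq_divide)
  then show "(cmod (apex n))\<^sup>2 = 1 + (tan (pi / real n))\<^sup>2"
    using t by (simp add: h_def power_inverse)
  then have "(cmod (apex n))\<^sup>2 \<le> 2\<^sup>2" using t3 by simp
  then show "cmod (apex n) \<le> 2" by (rule power2_le_imp_le) simp
qed

text \<open>Beyond the corner disc the factor \<open>1 - |z|^2\<close> of the bound on the unit disc
  is comparable to the gap. This gives the boundary data on the arc of the corner disc and also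
  settles the lower bound on the rest of the sector.\<close>

lemma corner_gap_le_outside:
  assumes n: "n \<ge> 3" and z: "z \<in> poly_closed n" "z \<in> vsector n"
    and out: "tan (pi / real n) \<le> cmod (apex n - z)"
  shows "corner_gap n z / 2 \<le> 1 - (cmod z)\<^sup>2"
proof -
  define T where "T = tan (pi / real n)"
  have T: "T > 0" using angle_bounds(5)[OF n] by (simp add: T_def)
  obtain t \<gamma> where t: "t \<ge> 0" "0 \<le> \<gamma>" "\<gamma> \<le> pi / real n"
    "z = of_real t * cis \<gamma> \<or> cnj z = of_real t * cis \<gamma>"
    using vsector_half[OF z(2)] by blast
  define w where "w = of_real t * cis \<gamma>"
  have w: "w \<in> poly_closed n \<and> corner_gap n w = corner_gap n z \<and> cmod w = cmod z \<and>
    cmod (apex n - w) = cmod (apex n - z)"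
    using t(4)
  proof
    assume "z = of_real t * cis \<gamma>"
    then show ?thesis using z(1) by (simp add: w_def)
  next
    assume "cnj z = of_real t * cis \<gamma>"
    then have "w = cnj z" by (simp add: w_def)
    moreover have "cmod (apex n - cnj z) = cmod (cnj (apex n - z))" by (simp add: apex_real)
    ultimately show ?thesis
      using poly_closed_cnj[OF n z(2,1)] corner_gap_cnj[OF n, of z] by (simp only: complex_mod_cnj simp_thms)
  qed
  define X where "X = t * cos (pi / real n - \<gamma>)"
  define Y where "Y = t * sin (pi / real n - \<gamma>)"
  note hs = half_sector[OF n conjunct1[OF w] t(1-3) w_def, folded X_def Y_def T_def]
  have "apex n = Complex 1 (- T) * cis (pi / real n)"
    unfolding T_def apex_cis(2)[OF n, symmetric] mult.assoc cis_mult by simp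
  then have "apex n - w = (Complex 1 (- T) - Complex X (- Y)) * cis (pi / real n)"
    using hs(7) by (metis left_diff_distrib)
  then have "(cmod (apex n - w))\<^sup>2 = (1 - X)\<^sup>2 + (Y - T)\<^sup>2" by (simp add: norm_mult cmod_power2)
  moreover have "T\<^sup>2 \<le> (cmod (apex n - w))\<^sup>2"
    using out T w by (intro power_mono) (auto simp: T_def)
  ultimately have "X\<^sup>2 + Y\<^sup>2 + 1 \<ge> 2 * (X + Y * T)" by (simp add: power2_eq_square algebra_simps)
  then have "(1 - X) / 2 \<le> 1 - (X\<^sup>2 + Y\<^sup>2)"
    using hs T tan_angle_bound(1)[OF n] by (intro unit_disc_gap[of X Y T]) (auto simp: T_def)
  moreover have "cmod z = cmod (Complex X (- Y))"
    using w hs(7) by (metis norm_mult norm_cis mult_1_right)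
  then have "(cmod z)\<^sup>2 = X\<^sup>2 + Y\<^sup>2" by (simp add: cmod_power2)
  ultimately show ?thesis using hs(2) w by simp
qed

text \<open>In real exponents: \<open>(4 n)^(2/(n-2))\<close> is at most 144, with equality at
  \<open>n = 3\<close>. Here \<open>4 n\<close> is the reciprocal of the lower bound for
  \<open>tan (pi / n) / 6\<close>. From \<open>n\<close> to \<open>n + 1\<close> the left side grows
  by a factor of at most 4.\<close>

lemma square_le_power_144: "n \<ge> 3 \<Longrightarrow> (4 * n)\<^sup>2 \<le> (144::nat) ^ (n - 2)"
proof (induction n rule: nat_induct_at_least)
  case (Suc n)
  have "(4 * Suc n)\<^sup>2 = (4 * n + 4)\<^sup>2" by simp
  also have "\<dots> \<le> (8 * n)\<^sup>2" using Suc by (intro power_mono) auto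
  also have "\<dots> = 4 * (4 * n)\<^sup>2" by (simp add: power2_eq_square)
  also have "\<dots> \<le> 144 * 144 ^ (n - 2)" using Suc.IH by simp
  also have "\<dots> = 144 ^ (Suc n - 2)" using Suc.hyps by (simp add: Suc_diff_le flip: power_Suc)
  finally show ?case .
qed simp

text \<open>In the first bound the radius has order 1/n and is tamed by the exponent 2/(n-2); in the
  other two the base is at most 2 or 4 and \<open>p - 1 \<le> 2\<close> is enough.\<close>

lemma corner_scale_bounds:
  assumes n: "n \<ge> 3"
  defines "p \<equiv> corner_exp n"
  shows "1 / 144 \<le> (tan (pi / real n) / 6) powr (p - 1)"
    "tan (pi / real n) powr (p - 1) \<le> 4"
    "0 \<le> r \<Longrightarrow> r \<le> 4 \<Longrightarrow> r powr (p - 1) \<le> 16"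
proof -
  note pb = corner_exp_bounds[OF n, folded p_def]
  have n3: "real n - 2 > 0" using n by simp
  have "((4 * real n)\<^sup>2) \<le> 144 powr (real n - 2)"
  proof -
    have "real ((4 * n)\<^sup>2) \<le> real (144 ^ (n - 2))" using square_le_power_144[OF n] by (rule of_nat_mono)
    also have "\<dots> = 144 powr (real n - 2)" using n by (simp add: of_nat_diff flip: powr_realpow)
    finally show ?thesis by simp
  qed
  then have "((4 * real n)\<^sup>2) powr (1 / (real n - 2)) \<le> (144 powr (real n - 2)) powr (1 / (real n - 2))"
    using n3 by (intro powr_mono2) auto
  also have "\<dots> = 144" using n3 by (simp add: powr_powr)
  also have "((4 * real n)\<^sup>2) powr (1 / (real n - 2)) = (4 * real n) powr (p - 1)"
    unfolding pb(4) using n by (subst powr_numeral[symmetric]) (auto simp only: powr_powr, auto)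
  finally have "1 / 144 \<le> (1 / (4 * real n)) powr (p - 1)"
    using n by (simp add: powr_divide field_simps)
  also have "\<dots> \<le> (tan (pi / real n) / 6) powr (p - 1)"
    using tan_angle_bound(3)[OF n] pb(1) n by (intro powr_mono2) (auto simp: field_simps)
  finally show "1 / 144 \<le> (tan (pi / real n) / 6) powr (p - 1)" .
  have "tan (pi / real n) powr (p - 1) \<le> 2 powr (p - 1)"
    using tan_angle_bound(2)[OF n] angle_bounds(5)[OF n] pb(1) by (intro powr_mono2) auto
  also have "\<dots> \<le> 2 powr 2" using pb(2) by (intro powr_mono) auto
  finally show "tan (pi / real n) powr (p - 1) \<le> 4" by simp
  assume r: "0 \<le> r" "r \<le> 4"
  have "r powr (p - 1) \<le> 4 powr (p - 1)" using r pb(1) by (intro powr_mono2) auto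
  also have "\<dots> \<le> 4 powr 2" using pb(2) by (intro powr_mono) auto
  finally show "r powr (p - 1) \<le> 16" by simp
qed

section \<open>Two-sided bounds on the normalised polygon\<close>

text \<open>Consecutive centres are at most \<open>s\<close> apart, so the next disc lies within
  \<open>2 s\<close> of the current centre. With outer radius \<open>4 s\<close>,
  \<open>annulus_lower_bound\<close> gives the factor \<open>exp (-16)\<close> times 16 - 4 =
  12.\<close>

lemma harnack_chain:
  assumes s: "s > 0" and m: "m \<ge> 0" and N: "cmod (z1 - z0) \<le> real N * s"
    and sub: "\<And>t. 0 \<le> t \<Longrightarrow> t \<le> 1 \<Longrightarrow> cball (z0 + of_real t * (z1 - z0)) (4 * s) \<subseteq> D"
    and cont: "continuous_on D u"
    and nonneg: "\<And>z. z \<in> D \<Longrightarrow> u z \<ge> 0"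
    and lap: "\<And>z. z \<in> D \<Longrightarrow> \<exists>a\<le>0. has_lap u z a"
    and low: "\<And>z. z \<in> cball z0 s \<Longrightarrow> m \<le> u z"
    and z: "z \<in> cball z1 s"
  shows "(12 * exp (-16)) ^ N * m \<le> u z"
proof -
  define q where "q = (\<lambda>k. z0 + of_real (real k / real N) * (z1 - z0))"
  have step: "\<forall>z\<in>cball (q k) s. (12 * exp (-16)) ^ k * m \<le> u z" if "k \<le> N" for k
    using that
  proof (induction k)
    case 0
    then show ?case using low by (simp add: q_def)
  next
    case (Suc k)
    show ?case
    proof
      fix z assume z: "z \<in> cball (q (Suc k)) s"
      have NN: "real N > 0" using Suc.prems by simp
      have "q (Suc k) - q k = of_real (1 / real N) * (z1 - z0)"
        by (simp add: q_def add_divide_distrib distrib_right)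
      then have "cmod (q (Suc k) - q k) = cmod (z1 - z0) / real N" by (simp add: norm_mult norm_divide)
      also have "\<dots> \<le> s" using N NN by (simp add: field_simps)
      finally have "cmod (q (Suc k) - q k) \<le> s" .
      then have dz: "cmod (z - q k) \<le> 2 * s"
        using z norm_triangle_ineq[of "z - q (Suc k)" "q (Suc k) - q k"]
        by (simp add: dist_norm norm_minus_commute)
      have k1: "real k / real N \<le> 1" using Suc.prems by simp
      have inD: "cball (q k) (4 * s) \<subseteq> D"
        unfolding q_def by (rule sub) (use k1 in auto)
      have "((12 * exp (-16)) ^ k * m) * exp (- ((4 * s)\<^sup>2 / s\<^sup>2)) * (((4 * s)\<^sup>2 - (cmod (z - q k))\<^sup>2) / s\<^sup>2) \<le> u z"
      proof (rule annulus_lower_bound)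
        show "continuous_on (cball (q k) (4 * s)) u" using inD cont continuous_on_subset by blast
        show "\<exists>a\<le>0. has_lap u z a" if "z \<in> ball (q k) (4 * s)" for z
          using lap inD that ball_subset_cball by blast
        show "z \<in> cball (q k) (4 * s)" using dz s by (simp add: dist_norm norm_minus_commute)
      qed (use s m Suc inD nonneg in auto)
      moreover have "exp (- ((4 * s)\<^sup>2 / s\<^sup>2)) = exp (-16)" using s by (simp add: power_mult_distrib)
      moreover have "((4 * s)\<^sup>2 - (cmod (z - q k))\<^sup>2) / s\<^sup>2 \<ge> 12"
      proof -
        have "(cmod (z - q k))\<^sup>2 \<le> (2 * s)\<^sup>2" using dz by (intro power_mono) auto
        then show ?thesis using s by (simp add: power_mult_distrib field_simps)
      qed
      then have "((12 * exp (-16)) ^ k * m) * exp (-16) * 12 \<le>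
          ((12 * exp (-16)) ^ k * m) * exp (-16) * (((4 * s)\<^sup>2 - (cmod (z - q k))\<^sup>2) / s\<^sup>2)"
        using m by (intro mult_left_mono) auto
      ultimately show "(12 * exp (-16)) ^ Suc k * m \<le> u z" by (simp add: mult_ac)
    qed
  qed
  have "q N = z1" if "N > 0" using that by (simp add: q_def)
  \<comment> \<open>For \<open>N = 0\<close> the quotient in \<open>q\<close> is 0/0 = 0, so
    \<open>q N\<close> is \<open>z0\<close>, and the length condition forces
    \<open>z1 = z0\<close>.\<close>
  moreover have "z1 = z0" if "N = 0" using N that by simp
  ultimately have "cball z1 s = cball (q N) s" by (cases "N > 0") (auto simp: q_def)
  then show ?thesis using step[of N] z by simp
qed

text \<open>The maximum point has distance at most 2 to the centre and the discs have radius 1/2000. The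
  length is a constant of its own to keep the simplifier from evaluating the power below.\<close>

definition chain_length :: nat where
  "chain_length = 4000"

text \<open>The final 1/2 is the starting value of the chain: on the disc about the maximum point
  the bound is \<open>M / 2\<close>.\<close>

definition center_const :: real where
  "center_const = (12 * exp (-16)) ^ chain_length / 2"

text \<open>The factor in \<open>annulus_lower_bound\<close> for inner radius 1/2000 and outer
  radius 1.\<close>

definition disc_const :: real where
  "disc_const = center_const * exp (- (1 / (1 / 2000)\<^sup>2)) * (1 / (1 / 2000)\<^sup>2)"

lemma const_pos: "center_const > 0" "disc_const > 0"
proof -
  show "center_const > 0" unfolding center_const_def by (intro divide_pos_pos zero_less_power mult_pos_pos) auto
  then show "disc_const > 0" unfolding disc_const_def by (intro mult_pos_pos) auto
qed

text \<open>\<open>lam\<close> is the eigenvalue after rescaling to inradius 1 and \<open>M\<close>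
  the maximum. Both are parameters, so that a single pair can serve all rotated copies of an
  eigenfunction.\<close>

definition polygon_eigenfunction :: "nat \<Rightarrow> (complex \<Rightarrow> real) \<Rightarrow> real \<Rightarrow> real \<Rightarrow> bool" where
  "polygon_eigenfunction n u lam M \<longleftrightarrow>
     n \<ge> 3 \<and> continuous_on (poly_closed n) u \<and> (\<forall>z\<in>poly_open n. u z > 0) \<and>
     (\<forall>z\<in>poly_closed n - poly_open n. u z = 0) \<and>
     (\<forall>z\<in>poly_open n. has_lap u z (- lam * u z)) \<and>
     (\<forall>z\<in>poly_closed n. u z \<le> M) \<and> (\<exists>z\<in>poly_open n. u z = M)"

context
  fixes n :: nat and u :: "complex \<Rightarrow> real" and lam M :: real
  assumes eigen: "polygon_eigenfunction n u lam M"
begin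

lemma
  shows eigen_n: "n \<ge> 3"
    and eigen_cont: "continuous_on (poly_closed n) u"
    and eigen_pos: "z \<in> poly_open n \<Longrightarrow> u z > 0"
    and eigen_zero: "z \<in> poly_closed n \<Longrightarrow> z \<notin> poly_open n \<Longrightarrow> u z = 0"
    and eigen_lap: "z \<in> poly_open n \<Longrightarrow> has_lap u z (- lam * u z)"
    and eigen_le_max: "z \<in> poly_closed n \<Longrightarrow> u z \<le> M"
    and eigen_max_attained: "\<exists>z\<in>poly_open n. u z = M"
  using eigen by (auto simp: polygon_eigenfunction_def)

lemma eigen_nonneg: "z \<in> poly_closed n \<Longrightarrow> u z \<ge> 0"
  using eigen_pos[of z] eigen_zero[of z] by (cases "z \<in> poly_open n") auto

lemma eigen_max_pos: "M > 0"
  using eigen_max_attained eigen_pos by blast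

lemma eigen_index_bounds: "0 < n" "n - 1 < n" "1 \<le> n"
  using eigen_n by auto

section \<open>The eigenvalue, decay at the sides, and the region of the maximum\<close>

lemma eigen_lam_nonneg: "lam \<ge> 0"
proof -
  obtain z where z: "z \<in> poly_open n" "u z = M" using eigen_max_attained by blast
  have "- lam * u z \<le> 0"
    using has_lap_local_max[OF eigen_lap[OF z(1)], of "poly_closed n"] z eigen_le_max poly_open_interior by auto
  then show ?thesis using z(2) eigen_max_pos by (simp add: zero_le_mult_iff)
qed

lemma eigen_superharmonic: "z \<in> poly_open n \<Longrightarrow> \<exists>a\<le>0. has_lap u z a"
  using eigen_lap[of z] eigen_lam_nonneg eigen_pos[of z] by (intro exI[of _ "- lam * u z"]) simp

text \<open>The eigenfunction \<open>S\<close> of the unit square has eigenvalue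
  \<open>2 pi^2\<close>, below 2 * 4^2 = 32. If \<open>lam\<close> exceeded it, \<open>u\<close>
  could serve as the positive function \<open>Z\<close> of \<open>max_principle\<close>, and
  \<open>S\<close> would be nonpositive, although \<open>S 0 = 1\<close>.\<close>

lemma eigen_lam_le: "lam \<le> 32"
proof (rule ccontr)
  assume "\<not> lam \<le> 32"
  moreover have "pi\<^sup>2 < 4\<^sup>2" using pi_less_4 by (intro power_strict_mono) auto
  ultimately have lam: "2 * pi\<^sup>2 < lam" by simp
  define Q where "Q = {z. \<bar>Re z\<bar> \<le> 1 / 2 \<and> \<bar>Im z\<bar> \<le> 1 / 2}"
  define S where "S = (\<lambda>z. cos (pi * Re z) * cos (pi * Im z))"
  have norm: "cmod z < 1" if "z \<in> Q" for z
  proof -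
    have "(Re z)\<^sup>2 \<le> (1 / 2)\<^sup>2" "(Im z)\<^sup>2 \<le> (1 / 2)\<^sup>2"
      using that power_mono[of "\<bar>Re z\<bar>" "1/2" 2] power_mono[of "\<bar>Im z\<bar>" "1/2" 2] by (auto simp: Q_def)
    then have "(cmod z)\<^sup>2 < 1\<^sup>2" unfolding cmod_power2 by (simp add: power2_eq_square)
    then show ?thesis by (rule power_less_imp_less_base) simp
  qed
  have QD: "Q \<subseteq> poly_open n" using norm unit_ball_subset_poly_open[of n] by auto
  have "S 0 \<le> 0"
  proof (rule max_principle[where K = Q and Z = u])
    have "closed Q"
      unfolding Q_def by (intro closed_Collect_conj closed_Collect_le continuous_intros)
    then show "compact Q" using norm by (auto simp: compact_eq_bounded_closed bounded_iff intro!: exI[of _ 1] less_imp_le)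
    show "continuous_on Q S" unfolding S_def by (intro continuous_intros)
    show "continuous_on Q u" using QD poly_open_subset_closed[of n] by (intro continuous_on_subset[OF eigen_cont]) auto
    show "u z > 0" if "z \<in> Q" for z using QD that eigen_pos by blast
    show "0 \<in> Q" by (simp add: Q_def)
    fix z assume z: "z \<in> Q" "S z > 0"
    have half: "cos (pi * x) = 0" if "\<bar>x\<bar> = 1 / 2" for x
    proof -
      have "cos (pi * x) = cos (pi * \<bar>x\<bar>)" by (cases "x \<ge> 0") auto
      then show ?thesis by (simp add: that)
    qed
    have "\<bar>Re z\<bar> \<noteq> 1 / 2" "\<bar>Im z\<bar> \<noteq> 1 / 2" using z(2) half[of "Re z"] half[of "Im z"] by (auto simp: S_def)
    then have "z \<in> {z. \<bar>Re z\<bar> < 1 / 2 \<and> \<bar>Im z\<bar> < 1 / 2}" using z(1) by (auto simp: Q_def)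
    moreover have "open {z. \<bar>Re z\<bar> < 1 / 2 \<and> \<bar>Im z\<bar> < 1 / 2}"
      by (intro open_Collect_conj open_Collect_less continuous_intros)
    moreover have "{z. \<bar>Re z\<bar> < 1 / 2 \<and> \<bar>Im z\<bar> < 1 / 2} \<subseteq> Q" by (auto simp: Q_def)
    ultimately show "z \<in> interior Q" using interior_maximal by blast
    have zD: "z \<in> poly_open n" using z QD by blast
    have "has_lap S z (- (2 * pi\<^sup>2) * S z)" unfolding S_def by (rule has_lap_cos_cos)
    moreover have "(2 * pi\<^sup>2) * (S z * u z) < lam * (S z * u z)"
      using lam z(2) eigen_pos[OF zD] by (intro mult_strict_right_mono mult_pos_pos)
    then have "(- lam * u z) * S z < (- (2 * pi\<^sup>2) * S z) * u z" by (simp add: mult_ac)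
    ultimately show "\<exists>a b. has_lap S z a \<and> has_lap u z b \<and> b * S z < a * u z"
      using eigen_lap[OF zD] by blast
  qed
  then show False by (simp add: S_def)
qed

text \<open>In terms of the gap \<open>g\<close> the parabola is \<open>c (6 g - g^2)\<close> with
  Laplacian \<open>- 2 c = - lam M\<close>. On the polygon \<open>0 \<le> g \<le> 3\<close>, so it
  is nonnegative, and it is at most \<open>6 c g = 3 lam M g\<close>; \<open>lam \<le> 32\<close>
  gives 96.\<close>

lemma eigen_le_side_gap:
  assumes j: "j < n" and z: "z \<in> poly_closed n"
  shows "u z \<le> 96 * M * side_gap n j z"
proof -
  define e where "e = cis (- ((2 * real j + 1) * pi / real n))"
  define X where "X = (\<lambda>z. Re ((z - cnj e) * e))"
  define c where "c = lam * M / 2"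
  define W where "W = (\<lambda>z. c * (- 6 * X z - (X z)\<^sup>2))"
  have c0: "c \<ge> 0" using eigen_lam_nonneg eigen_max_pos by (simp add: c_def)
  have gap: "side_gap n j z = - X z" for z
  proof -
    have "Re (cnj e * e) = 1" unfolding e_def by (simp add: cis_cnj cis_mult)
    then show ?thesis by (simp add: X_def side_gap_def e_def left_diff_distrib)
  qed
  have X: "X z \<le> 0" "- X z \<le> 3" if "z \<in> poly_closed n" for z
  proof -
    have "side_gap n j z \<ge> 0" using that j by (simp add: poly_closed_def)
    then show "X z \<le> 0" by (simp add: gap)
    have "- Re (z * e) \<le> cmod (z * e)" using abs_Re_le_cmod[of "z * e"] by linarith
    then have "- Re (z * e) \<le> cmod z" by (simp add: norm_mult e_def)
    then have "side_gap n j z \<le> 1 + cmod z" by (simp add: side_gap_def e_def)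
    then show "- X z \<le> 3" using poly_closed_bounded[OF eigen_n that] by (simp add: gap)
  qed
  have W0: "W z \<ge> 0" if "z \<in> poly_closed n" for z
  proof -
    have "- 6 * X z - (X z)\<^sup>2 = (- X z) * (6 + X z)" by (simp add: power2_eq_square algebra_simps)
    moreover have "(- X z) * (6 + X z) \<ge> 0" using X[OF that] by (intro mult_nonneg_nonneg) auto
    ultimately show ?thesis using mult_nonneg_nonneg[OF c0] unfolding W_def by metis
  qed
  have "u z - W z \<le> 0"
  proof (rule max_principle_subharmonic[OF compact_poly_closed[OF eigen_n] _ _ _ z])
    show "continuous_on (poly_closed n) (\<lambda>z. u z - W z)"
      unfolding W_def X_def by (intro continuous_intros eigen_cont)
    fix w assume w: "w \<in> poly_closed n" "u w - W w > 0"
    then have wD: "w \<in> poly_open n" using eigen_zero[of w] W0[of w] by force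
    then show "w \<in> interior (poly_closed n)" using poly_open_interior by blast
    have "has_lap (\<lambda>z. u z - W z) w (- lam * u w - c * (- 6 * 0 - 2 * (cmod e)\<^sup>2))"
      unfolding W_def X_def
      by (intro has_lap_diff has_lap_cmult has_lap_affine has_lap_affine_sq eigen_lap wD)
    moreover have "- lam * u w - c * (- 6 * 0 - 2 * (cmod e)\<^sup>2) = lam * (M - u w)"
      by (simp add: c_def e_def algebra_simps)
    moreover have "lam * (M - u w) \<ge> 0" using eigen_lam_nonneg eigen_le_max[OF w(1)] by simp
    ultimately show "\<exists>a\<ge>0. has_lap (\<lambda>z. u z - W z) w a" by metis
  qed
  then have "u z \<le> c * (- 6 * X z - (X z)\<^sup>2)" by (simp add: W_def)
  also have "\<dots> \<le> c * (6 * side_gap n j z)" using c0 by (intro mult_left_mono) (auto simp: gap)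
  also have "\<dots> = lam * (3 * M * side_gap n j z)" by (simp add: c_def)
  also have "\<dots> \<le> 32 * (3 * M * side_gap n j z)"
    using eigen_lam_le mult_nonneg_nonneg[of M "- X z"] eigen_max_pos X[OF z] by (intro mult_right_mono) (auto simp: gap)
  finally show ?thesis by simp
qed

lemma eigen_le_corner_gap: "z \<in> poly_closed n \<Longrightarrow> u z \<le> 96 * M * corner_gap n z"
  using eigen_le_side_gap[of 0 z] eigen_le_side_gap[of "n - 1" z] eigen_index_bounds by (simp add: corner_gap_def min_def)

lemma eigen_side_gap_at_max:
  assumes "z0 \<in> poly_open n" "u z0 = M" "j < n"
  shows "side_gap n j z0 \<ge> 1 / 96"
  using eigen_le_side_gap[OF assms(3), of z0] assms eigen_max_pos poly_open_subset_closed[of n] by auto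

text \<open>The point is reached by a horizontal and a vertical step, each costing at most
  \<open>M / 4\<close>. For \<open>s = 1 / 400\<close> the gradient constant is at most 1000, and
  reflection about the midpoint of a step uses half its length, at most 1/4000. The discs of radius
  \<open>2 s\<close> stay within 1/1000 + 1/200 < 1/96 of the maximum point.\<close>

lemma eigen_lower_bound_near_max:
  assumes z0: "z0 \<in> poly_open n" "u z0 = M" and z: "z \<in> cball z0 (1 / 2000)"
  shows "M / 2 \<le> u z"
proof -
  note gaps = eigen_side_gap_at_max[OF z0]
  have D: "ball z0 (1 / 96) \<subseteq> poly_open n" by (rule ball_subset_poly_open) (rule gaps)
  have grad: "u a - u (a + of_real d * e) \<le> M / 4"
    if a: "cmod (a - z0) \<le> 1 / 2000" and d: "0 \<le> d" "d \<le> 1 / 2000" and e: "e \<in> {1, -1, \<i>, - \<i>}" for a d e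
  proof -
    define q where "q = a + of_real (d / 2) * e"
    have e1: "cmod e = 1" using e by auto
    have q: "cmod (q - z0) \<le> 1 / 1000"
      using norm_triangle_ineq[of "a - z0" "of_real (d / 2) * e"] a d
      by (simp add: q_def norm_mult e1 algebra_simps)
    have sub: "cball q (2 * (1 / 400)) \<subseteq> poly_open n"
    proof -
      have "cball q (2 * (1 / 400)) \<subseteq> ball z0 (1 / 96)"
        using q by (simp add: cball_subset_ball_iff dist_norm)
      then show ?thesis using D by blast
    qed
    have subK: "cball q (2 * (1 / 400)) \<subseteq> poly_closed n"
      using sub poly_open_subset_closed by blast
    have "u (q + of_real (d / 2) * (- e)) - u (q - of_real (d / 2) * (- e)) \<le>
        (2 / (1 / 400) + lam * (1 / 400)) * M * (d / 2)"
    proof (rule reflection_gradient_bound)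
      show "- e \<in> {1, -1, \<i>, - \<i>}" using e by auto
      show "continuous_on (cball q (2 * (1 / 400))) u" by (rule continuous_on_subset[OF eigen_cont subK])
      show "0 \<le> u z \<and> u z \<le> M" if "z \<in> cball q (2 * (1 / 400))" for z
        using that subK eigen_nonneg eigen_le_max by blast
      show "has_lap u z (- lam * u z)" if "z \<in> cball q (2 * (1 / 400))" for z
        using that sub eigen_lap by blast
    qed (use eigen_lam_nonneg eigen_max_pos d in auto)
    also have "\<dots> \<le> 1000 * M * (1 / 4000)"
      using eigen_lam_le eigen_lam_nonneg eigen_max_pos d by (intro mult_mono) auto
    finally show ?thesis by (simp add: q_def algebra_simps)
  qed
  define x y where "x = Re (z - z0)" and "y = Im (z - z0)"
  have "cmod (z - z0) \<le> 1 / 2000" using z by (simp add: dist_norm norm_minus_commute)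
  then have xy: "\<bar>x\<bar> \<le> 1 / 2000" "\<bar>y\<bar> \<le> 1 / 2000"
    using abs_Re_le_cmod[of "z - z0"] abs_Im_le_cmod[of "z - z0"] unfolding x_def y_def by linarith+
  have "u z0 - u (z0 + of_real \<bar>x\<bar> * of_real (if x \<ge> 0 then 1 else - 1)) \<le> M / 4"
    by (rule grad) (use xy in auto)
  moreover have "of_real \<bar>x\<bar> * of_real (if x \<ge> 0 then 1 else - 1) = complex_of_real x" by simp
  ultimately have 1: "u z0 - u (z0 + of_real x) \<le> M / 4" by (simp only:)
  have "u (z0 + of_real x) - u ((z0 + of_real x) + of_real \<bar>y\<bar> * (if y \<ge> 0 then \<i> else - \<i>)) \<le> M / 4"
    by (rule grad) (use xy in auto)
  moreover have "(z0 + of_real x) + of_real \<bar>y\<bar> * (if y \<ge> 0 then \<i> else - \<i>) = z"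
    by (auto simp: x_def y_def complex_eq_iff)
  ultimately have "u (z0 + of_real x) - u z \<le> M / 4" by (simp only:)
  with 1 show ?thesis using z0(2) by simp
qed

text \<open>Gaps are affine and equal 1 at the centre, so along the segment from the maximum point
  to 0 they stay at least 1/96, which leaves room for the discs of the chain. From the small central
  disc the annulus bound reaches the whole incircle.\<close>

lemma eigen_disc_lower_bound:
  assumes z: "z \<in> cball 0 1"
  shows "disc_const * M * (1 - (cmod z)\<^sup>2) \<le> u z"
proof -
  obtain z0 where z0: "z0 \<in> poly_open n" "u z0 = M" using eigen_max_attained by blast
  note gaps = eigen_side_gap_at_max[OF z0]
  have center: "center_const * M \<le> u w" if w: "w \<in> cball 0 (1 / 2000)" for w
  proof -
    have "(12 * exp (-16)) ^ chain_length * (M / 2) \<le> u w"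
    proof (rule harnack_chain[where D = "poly_open n" and ?z0.0 = z0 and ?z1.0 = 0 and s = "1 / 2000"])
      show "cmod (0 - z0) \<le> real chain_length * (1 / 2000)"
        using poly_closed_bounded[OF eigen_n, of z0] z0 poly_open_subset_closed[of n]
        by (auto simp: chain_length_def)
      show "cball (z0 + of_real t * (0 - z0)) (4 * (1 / 2000)) \<subseteq> poly_open n" if t: "0 \<le> t" "t \<le> 1" for t
      proof -
        have "side_gap n j (z0 + of_real t * (0 - z0)) \<ge> 1 / 96" if "j < n" for j
        proof -
          have "z0 + of_real t * (0 - z0) = (1 - t) *\<^sub>R z0 + t *\<^sub>R 0"
            by (simp add: scaleR_conv_of_real algebra_simps)
          then have "side_gap n j (z0 + of_real t * (0 - z0)) = (1 - t) * side_gap n j z0 + t * 1"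
            using side_gap_convex_combination[of n j t z0 0] by simp
          moreover have "(1 - t) * (1 / 96) \<le> (1 - t) * side_gap n j z0"
            using gaps[OF that] t by (intro mult_left_mono) auto
          ultimately show ?thesis using t by simp
        qed
        then have "ball (z0 + of_real t * (0 - z0)) (1 / 96) \<subseteq> poly_open n" by (rule ball_subset_poly_open)
        moreover have "cball (z0 + of_real t * (0 - z0)) (4 * (1 / 2000)) \<subseteq> ball (z0 + of_real t * (0 - z0)) (1 / 96)"
          by (auto simp: dist_norm)
        ultimately show ?thesis by blast
      qed
      show "continuous_on (poly_open n) u" by (rule continuous_on_subset[OF eigen_cont poly_open_subset_closed])
      show "u z \<ge> 0" if "z \<in> poly_open n" for z using eigen_pos[OF that] by simp
      show "M / 2 \<le> u z" if "z \<in> cball z0 (1 / 2000)" for z by (rule eigen_lower_bound_near_max[OF z0 that])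
    qed (use eigen_superharmonic eigen_max_pos w in auto)
    then show ?thesis by (simp add: center_const_def)
  qed
  have "(center_const * M) * exp (- (1\<^sup>2 / (1 / 2000)\<^sup>2)) * ((1\<^sup>2 - (cmod (z - 0))\<^sup>2) / (1 / 2000)\<^sup>2) \<le> u z"
  proof (rule annulus_lower_bound)
    show "continuous_on (cball 0 1) u" by (rule continuous_on_subset[OF eigen_cont unit_cball_subset_poly_closed])
    show "u z \<ge> 0" if "z \<in> cball 0 1" for z using that unit_cball_subset_poly_closed eigen_nonneg by blast
    show "\<exists>a\<le>0. has_lap u z a" if "z \<in> ball 0 1" for z
      using that unit_ball_subset_poly_open eigen_superharmonic by blast
    show "0 \<le> center_const * M" using const_pos eigen_max_pos by simp
  qed (use center z in auto)
  then show ?thesis unfolding disc_const_def by (simp add: algebra_simps diff_divide_distrib)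
qed

text \<open>\<open>A\<close> is fixed by the arc: there \<open>corner_fun\<close> is at most 6 times
  gap times \<open>r^(p-1)\<close>, and the bound on the unit disc provides
  \<open>disc_const * M\<close> times half the gap, whence 12 = 6 * 2. On the sides the corner
  function vanishes.\<close>

lemma eigen_corner_lower_bound:
  assumes z: "z \<in> poly_closed n" "cmod (apex n - z) \<le> tan (pi / real n)"
  defines "A \<equiv> disc_const * M / (12 * tan (pi / real n) powr (corner_exp n - 1))"
  shows "A * corner_fun n z \<le> u z"
proof -
  define r where "r = tan (pi / real n)"
  define p where "p = corner_exp n"
  have r0: "r > 0" using angle_bounds(5)[OF eigen_n] by (simp add: r_def)
  have A: "A \<ge> 0" using const_pos eigen_max_pos by (simp add: A_def)
  define K where "K = poly_closed n \<inter> cball (apex n) r"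
  define v where "v = (\<lambda>z. A * corner_fun n z - u z)"
  have Kd: "z \<in> poly_closed n" "cmod (apex n - z) \<le> r" if "z \<in> K" for z
    using that by (auto simp: K_def dist_norm)
  have "v z \<le> 0"
  proof (rule max_principle_subharmonic)
    show "compact K" unfolding K_def by (intro compact_Int compact_poly_closed[OF eigen_n] compact_cball)
    show "continuous_on K v"
      unfolding v_def
      by (intro continuous_intros continuous_on_subset[OF eigen_cont] continuous_on_subset[OF continuous_on_corner_fun[OF eigen_n]])
        (auto simp: K_def)
    show "z \<in> K" using z by (simp add: K_def r_def dist_norm)
    fix w assume w: "w \<in> K" "v w > 0"
    note wK = Kd[OF w(1)]
    have sec: "w \<in> vsector n" using corner_disc_subset_vsector[OF eigen_n] wK(2) by (simp add: r_def)
    have wD: "w \<in> poly_open n"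
    proof (rule ccontr)
      assume nD: "w \<notin> poly_open n"
      then obtain j where j: "j < n" "side_gap n j w \<le> 0" by (auto simp: poly_open_def not_less)
      \<comment> \<open>In the sector the adjacent gaps are the smallest, so a vanishing gap of any
        side makes \<open>corner_gap\<close> vanish.\<close>
      have "corner_gap n w = 0"
        using corner_gap_le_side_gap[OF eigen_index_bounds(3) sec j(1)] j(2) corner_gap_nonneg[OF eigen_index_bounds(3) wK(1)] by simp
      then have "corner_fun n w \<le> 0" using corner_compare(2)[OF eigen_n wK(1)] by simp
      then have "A * corner_fun n w \<le> 0" using A by (simp add: mult_nonneg_nonpos)
      then show False using w(2) eigen_nonneg[OF wK(1)] by (simp add: v_def)
    qed
    have "cmod (apex n - w) \<noteq> r"
    proof
      assume eq: "cmod (apex n - w) = r"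
      have g: "corner_gap n w / 2 \<le> 1 - (cmod w)\<^sup>2"
        using corner_gap_le_outside[OF eigen_n wK(1) sec] eq by (simp add: r_def)
      then have "(cmod w)\<^sup>2 \<le> 1\<^sup>2" using corner_gap_nonneg[OF eigen_index_bounds(3) wK(1)] by simp
      then have "cmod w \<le> 1" by (rule power2_le_imp_le) simp
      then have "disc_const * M * (1 - (cmod w)\<^sup>2) \<le> u w" by (intro eigen_disc_lower_bound) simp
      moreover have "disc_const * M * (corner_gap n w / 2) \<le> disc_const * M * (1 - (cmod w)\<^sup>2)"
        using g const_pos eigen_max_pos by (intro mult_left_mono) auto
      moreover have "A * corner_fun n w \<le> A * (6 * (corner_gap n w * r powr (p - 1)))"
        using corner_compare(2)[OF eigen_n wK(1)] A by (intro mult_left_mono) (auto simp: eq p_def)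
      moreover have "A * (6 * (corner_gap n w * r powr (p - 1))) = disc_const * M * (corner_gap n w / 2)"
        using r0 by (simp add: A_def r_def p_def)
      ultimately show False using w(2) by (simp add: v_def)
    qed
    then show "w \<in> interior K"
      using wD wK(2) poly_open_interior by (auto simp: K_def interior_cball dist_norm)
    obtain a where a: "a \<le> 0" "has_lap u w a" using eigen_superharmonic[OF wD] by blast
    have "has_lap (corner_fun n) w 0" using has_lap_corner_fun_mult[OF eigen_n wD, of 1 0] by simp
    then have "has_lap v w (A * 0 - a)" unfolding v_def by (intro has_lap_diff has_lap_cmult a)
    then show "\<exists>a\<ge>0. has_lap v w a" using a(1) by (intro exI[of _ "A * 0 - a"]) simp
  qed
  then show ?thesis by (simp add: v_def)
qed

text \<open>The radius \<open>tan (pi / n) / 6\<close> has square at most 3/36 = 1/12, so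
  \<open>W\<close> lies between half the corner function and the corner function. Its Laplacian is
  \<open>- 16 (p + 1)\<close> times that function, and 16 (p + 1) is at least 32, hence at least
  \<open>lam\<close>. On the arc, 96 times 2 from \<open>corner_compare\<close> times 2 for passing
  to \<open>W\<close> gives 384.\<close>

lemma eigen_corner_upper_bound:
  assumes z: "z \<in> poly_closed n" "cmod (apex n - z) \<le> tan (pi / real n) / 6"
  defines "A \<equiv> 384 * M / (tan (pi / real n) / 6) powr (corner_exp n - 1)"
  shows "u z \<le> A * corner_fun n z"
proof -
  define r where "r = tan (pi / real n) / 6"
  define p where "p = corner_exp n"
  have r0: "r > 0" using angle_bounds(5)[OF eigen_n] by (simp add: r_def)
  have r2: "r\<^sup>2 \<le> 1 / 12" using tan_angle_bound(1)[OF eigen_n] by (simp add: r_def power_divide)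
  have A: "A \<ge> 0" using eigen_max_pos by (simp add: A_def)
  define K where "K = poly_closed n \<inter> cball (apex n) r"
  define W where "W = (\<lambda>z. corner_fun n z * (1 + (- 4) * (cmod (z - apex n))\<^sup>2))"
  define v where "v = (\<lambda>z. u z - A * W z)"
  \<comment> \<open>The difference \<open>v\<close> satisfies only Laplacian at least
    \<open>- lam v\<close>, so a positive function with \<open>- Laplacian > lam Z\<close> is
    required: here the Laplacian is -36, \<open>Z \<le> 1\<close> and \<open>lam \<le> 32\<close>,
    and the radius keeps \<open>Z\<close> at least 1/4.\<close>
  define Z where "Z = (\<lambda>z. 1 - 9 * (cmod (z - apex n))\<^sup>2)"
  have Kd: "z \<in> poly_closed n" "cmod (apex n - z) \<le> r" "(cmod (z - apex n))\<^sup>2 \<le> 1 / 12" if "z \<in> K" for z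
  proof -
    show 1: "z \<in> poly_closed n" "cmod (apex n - z) \<le> r" using that by (auto simp: K_def dist_norm)
    have "(cmod (z - apex n))\<^sup>2 \<le> r\<^sup>2" using 1(2) by (intro power_mono) (auto simp: norm_minus_commute)
    then show "(cmod (z - apex n))\<^sup>2 \<le> 1 / 12" using r2 by simp
  qed
  have Zpos: "Z z > 0" if "z \<in> K" for z using Kd(3)[OF that] by (simp add: Z_def)
  have W: "corner_fun n z * (1 / 2) \<le> W z" "W z \<le> corner_fun n z * 1" if "z \<in> K" for z
    unfolding W_def using Kd[OF that] corner_fun_nonneg[OF eigen_n] by (intro mult_left_mono; simp)+
  have zK: "z \<in> K" using z by (simp add: K_def r_def dist_norm)
  have "v z \<le> 0"
  proof (rule max_principle[where Z = Z and K = K])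
    show "compact K" unfolding K_def by (intro compact_Int compact_poly_closed[OF eigen_n] compact_cball)
    show "continuous_on K v"
      unfolding v_def W_def
      by (intro continuous_intros continuous_on_subset[OF eigen_cont] continuous_on_subset[OF continuous_on_corner_fun[OF eigen_n]])
        (auto simp: K_def)
    show "continuous_on K Z" unfolding Z_def by (intro continuous_intros)
    show "z \<in> K" by (rule zK)
    fix w assume w: "w \<in> K" "v w > 0"
    note wK = Kd[OF w(1)] and Ww = W[OF w(1)]
    have cf: "corner_fun n w \<ge> 0" using corner_fun_nonneg[OF eigen_n wK(1)] .
    then have "A * W w \<ge> 0" using A Ww(1) by simp
    then have wD: "w \<in> poly_open n" using w(2) eigen_zero[OF wK(1)] by (auto simp: v_def)
    have "cmod (apex n - w) \<noteq> r"
    proof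
      assume eq: "cmod (apex n - w) = r"
      have rp: "r powr (p - 1) > 0" using r0 by simp
      have "corner_gap n w * r powr (p - 1) \<le> 2 * corner_fun n w"
        using corner_compare(1)[OF eigen_n wK(1)] by (simp add: eq p_def)
      then have "corner_gap n w \<le> 2 * corner_fun n w / r powr (p - 1)" using rp by (simp add: field_simps)
      then have "96 * M * corner_gap n w \<le> 96 * M * (2 * corner_fun n w / r powr (p - 1))"
        using eigen_max_pos by (intro mult_left_mono) auto
      also have "\<dots> = A * (corner_fun n w * (1 / 2))" by (simp add: A_def r_def p_def)
      also have "\<dots> \<le> A * W w" using Ww(1) A by (rule mult_left_mono)
      finally show False using w(2) eigen_le_corner_gap[OF wK(1)] by (simp add: v_def)
    qed
    then show "w \<in> interior K"
      using wD wK(2) poly_open_interior by (auto simp: K_def interior_cball dist_norm)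
    have "has_lap v w (- lam * u w - A * (4 * (- 4) * (p + 1) * corner_fun n w))"
      unfolding v_def W_def p_def by (intro has_lap_diff has_lap_cmult eigen_lap[OF wD] has_lap_corner_fun_mult[OF eigen_n wD])
    moreover have "has_lap Z w (0 - 9 * 4)"
      unfolding Z_def by (intro has_lap_diff has_lap_cmult has_lap_const has_lap_norm_sq)
    moreover have "(0 - 9 * 4) * v w < (- lam * u w - A * (4 * (- 4) * (p + 1) * corner_fun n w)) * Z w"
    proof -
      have "lam * (A * W w) \<le> 32 * (A * corner_fun n w)"
        using eigen_lam_le eigen_lam_nonneg A Ww(2) \<open>A * W w \<ge> 0\<close> by (intro mult_mono mult_left_mono) auto
      also have "\<dots> \<le> (16 * (p + 1)) * (A * corner_fun n w)"
        using corner_exp_bounds(1)[OF eigen_n] A cf by (intro mult_right_mono) (auto simp: p_def)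
      finally have "- lam * v w \<le> - lam * u w - A * (4 * (- 4) * (p + 1) * corner_fun n w)"
        by (simp add: v_def algebra_simps)
      then have "(- lam * v w) * Z w \<le> (- lam * u w - A * (4 * (- 4) * (p + 1) * corner_fun n w)) * Z w"
        using Zpos[OF w(1)] by (intro mult_right_mono) auto
      moreover have "(lam * Z w) * v w \<le> (32 * 1) * v w"
        using eigen_lam_le eigen_lam_nonneg w(2) Zpos[OF w(1)] by (intro mult_right_mono mult_mono) (auto simp: Z_def)
      then have "- 36 * v w < (- lam * v w) * Z w" using w(2) by (simp add: mult_ac)
      ultimately show ?thesis by simp
    qed
    ultimately show "\<exists>a b. has_lap v w a \<and> has_lap Z w b \<and> b * v w < a * Z w" by blast
  qed (use Zpos in auto)
  then have "u z \<le> A * W z" by (simp add: v_def)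
  also have "\<dots> \<le> A * corner_fun n z" using W(2)[OF zK] A by (intro mult_left_mono) auto
  finally show ?thesis .
qed

text \<open>Near the apex the corner barriers apply: 12 * 4 * 2 = 96 and 384 * 144 * 6 = 331776.
  Farther away \<open>r^(p-1)\<close> lies between absolute constants, and the bounds in terms of
  the gap alone take over.\<close>

theorem eigen_two_sided_bound:
  assumes z: "z \<in> poly_closed n" "z \<in> vsector n"
  defines "T \<equiv> corner_gap n z * cmod (apex n - z) powr (corner_exp n - 1)"
  shows "disc_const / 96 * M * T \<le> u z" "u z \<le> 331776 * M * T"
proof -
  define r where "r = cmod (apex n - z)"
  define p where "p = corner_exp n"
  define t where "t = tan (pi / real n)"
  have t0: "t > 0" using angle_bounds(5)[OF eigen_n] by (simp add: t_def)
  note sc = corner_scale_bounds[OF eigen_n, folded p_def t_def]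
  note cc = corner_compare[OF eigen_n z(1), folded p_def r_def]
  have T: "T = corner_gap n z * r powr (p - 1)" by (simp add: T_def r_def p_def)
  have g: "corner_gap n z \<ge> 0" by (rule corner_gap_nonneg[OF eigen_index_bounds(3) z(1)])
  have T0: "T \<ge> 0" using g by (simp add: T)
  have d0: "disc_const * M > 0" using const_pos eigen_max_pos by simp
  show "disc_const / 96 * M * T \<le> u z"
  proof (cases "r \<le> t")
    case True
    have tp: "t powr (p - 1) > 0" using t0 by simp
    have "disc_const * M / 96 \<le> disc_const * M / (12 * t powr (p - 1)) / 2"
      using mult_left_mono[OF sc(2) less_imp_le[OF d0]] tp by (simp add: field_simps)
    then have "disc_const * M / 96 * T \<le> disc_const * M / (12 * t powr (p - 1)) / 2 * T"
      using T0 by (rule mult_right_mono)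
    also have "\<dots> = disc_const * M / (12 * t powr (p - 1)) * (T / 2)" by simp
    also have "\<dots> \<le> disc_const * M / (12 * t powr (p - 1)) * corner_fun n z"
      using cc(1) d0 tp by (intro mult_left_mono) (auto simp: T)
    also have "\<dots> \<le> u z" unfolding t_def p_def by (rule eigen_corner_lower_bound) (use z True in \<open>auto simp: r_def t_def\<close>)
    finally show ?thesis by simp
  next
    case False
    have o: "corner_gap n z / 2 \<le> 1 - (cmod z)\<^sup>2"
      using corner_gap_le_outside[OF eigen_n z] False by (simp add: r_def t_def)
    then have "(cmod z)\<^sup>2 \<le> 1\<^sup>2" using g by simp
    then have z1: "cmod z \<le> 1" by (rule power2_le_imp_le) simp
    have "r \<le> cmod (apex n) + cmod z" unfolding r_def by (rule norm_triangle_ineq4)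
    then have "r \<le> 4" using tan_angle_bound(5)[OF eigen_n] z1 by simp
    then have "r powr (p - 1) \<le> 16" by (intro sc(3)) (auto simp: r_def)
    then have "T \<le> corner_gap n z * 16" unfolding T using g by (intro mult_left_mono)
    then have "disc_const * M / 96 * T \<le> disc_const * M / 96 * (corner_gap n z * 16)"
      using d0 by (intro mult_left_mono) auto
    also have "\<dots> \<le> disc_const * M * (corner_gap n z / 2)"
      using mult_nonneg_nonneg[OF less_imp_le[OF d0] g] by (simp add: mult_ac)
    also have "\<dots> \<le> disc_const * M * (1 - (cmod z)\<^sup>2)" using o d0 by (intro mult_left_mono) auto
    also have "\<dots> \<le> u z" using z1 by (intro eigen_disc_lower_bound) simp
    finally show ?thesis by simp
  qed
  have tp: "(t / 6) powr (p - 1) > 0" using t0 by simp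
  show "u z \<le> 331776 * M * T"
  proof (cases "r \<le> t / 6")
    case True
    have "u z \<le> 384 * M / (t / 6) powr (p - 1) * corner_fun n z"
      unfolding t_def p_def by (rule eigen_corner_upper_bound) (use z True in \<open>auto simp: r_def t_def\<close>)
    also have "\<dots> \<le> 384 * M / (1 / 144) * (6 * T)"
      using sc(1) tp eigen_max_pos cc(2) corner_fun_nonneg[OF eigen_n z(1)]
      by (intro mult_mono divide_left_mono) (auto simp: T)
    finally show ?thesis by simp
  next
    case False
    have "1 / 144 \<le> (t / 6) powr (p - 1)" by (rule sc(1))
    also have "\<dots> \<le> r powr (p - 1)"
      using False t0 corner_exp_bounds(1)[OF eigen_n] by (intro powr_mono2) (auto simp: p_def)
    finally have "corner_gap n z * (1 / 144) \<le> T" unfolding T using g by (intro mult_left_mono)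
    then have "96 * M * corner_gap n z \<le> 96 * M * (144 * T)" using eigen_max_pos by (intro mult_left_mono) auto
    moreover have "96 * M * (144 * T) \<le> 331776 * M * T" using eigen_max_pos T0 by simp
    ultimately show ?thesis using eigen_le_corner_gap[OF z(1)] by linarith
  qed
qed

end

section \<open>Distances to the sides\<close>

definition poly_vertex :: "nat \<Rightarrow> nat \<Rightarrow> complex" where
  "poly_vertex n k = apex n * cis (2 * pi * real k / real n)"

definition poly_side :: "nat \<Rightarrow> nat \<Rightarrow> complex set" where
  "poly_side n i = closed_segment (poly_vertex n i) (poly_vertex n (Suc i))"

lemma cis_turn:
  assumes "n \<ge> 1"
  shows "cis (2 * pi * real (k mod n) / real n) = cis (2 * pi * real k / real n)"
proof -
  have "real k = real (k mod n) + real n * real (k div n)"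
    by (metis mult_div_mod_eq of_nat_add of_nat_mult add.commute)
  then have "2 * pi * real k / real n = 2 * pi * real (k mod n) / real n + 2 * pi * real (k div n)"
    using assms by (simp add: field_simps)
  then have "cis (2 * pi * real k / real n) = cis (2 * pi * real (k mod n) / real n + 2 * pi * real (k div n))"
    by (rule arg_cong)
  also have "\<dots> = cis (2 * pi * real (k mod n) / real n) * cis (2 * pi * real (k div n))"
    by (rule cis_mult[symmetric])
  also have "cis (2 * pi * real (k div n)) = 1" by (rule cis_multiple_2pi) simp
  finally show ?thesis by simp
qed

lemma poly_vertex_mod: "n \<ge> 1 \<Longrightarrow> poly_vertex n (k mod n) = poly_vertex n k"
  unfolding poly_vertex_def by (simp only: cis_turn)

lemma side_gap_rotate:
  "side_gap n (j + k) (z * cis (2 * pi * real k / real n)) = side_gap n j z"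
proof -
  have "2 * pi * real k / real n + - ((2 * real (j + k) + 1) * pi / real n) = - ((2 * real j + 1) * pi / real n)"
    by (simp add: add_divide_distrib algebra_simps)
  then show ?thesis unfolding side_gap_def mult.assoc cis_mult by (simp only:)
qed

lemma side_gap_mod:
  assumes "n \<ge> 1"
  shows "side_gap n (j mod n) z = side_gap n j z"
proof -
  have e: "cis (- ((2 * real j + 1) * pi / real n)) = cnj (cis (2 * pi * real j / real n)) * cis (- (pi / real n))" for j
    unfolding cis_cnj cis_mult by (simp add: add_divide_distrib algebra_simps)
  show ?thesis unfolding side_gap_def e cis_turn[OF assms] ..
qed

lemma poly_closed_iff:
  assumes n: "n \<ge> 1"
  shows "z \<in> poly_closed n \<longleftrightarrow> (\<forall>j. 0 \<le> side_gap n j z)"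
proof -
  have "j mod n < n" for j using n by simp
  then show ?thesis unfolding poly_closed_def mem_Collect_eq using side_gap_mod[OF n, of _ z] by metis
qed

lemma poly_open_iff:
  assumes n: "n \<ge> 1"
  shows "z \<in> poly_open n \<longleftrightarrow> (\<forall>j. 0 < side_gap n j z)"
proof -
  have "j mod n < n" for j using n by simp
  then show ?thesis unfolding poly_open_def mem_Collect_eq using side_gap_mod[OF n, of _ z] by metis
qed

text \<open>Adding \<open>k (n - 1)\<close> replaces the subtraction of \<open>k\<close>, which is
  truncated on natural numbers: together with the shift by \<open>k\<close> it makes a multiple of
  the period \<open>n\<close>.\<close>

lemma all_shift:
  assumes "n \<ge> 1" "\<And>j::nat. P (j mod n) = P j"
  shows "(\<forall>j. P (j + k)) \<longleftrightarrow> (\<forall>j. P j)"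
proof safe
  fix j assume "\<forall>j. P (j + k)"
  then have "P ((j + k * (n - 1)) + k)" by blast
  also have "(j + k * (n - 1)) + k = j + n * k" using assms(1) by (cases n) auto
  also have "P (j + n * k) = P j" using assms(2)[of "j + n * k"] assms(2)[of j] by simp
  finally show "P j" .
qed auto

lemma poly_rotate:
  assumes n: "n \<ge> 1"
  shows "z * cis (2 * pi * real k / real n) \<in> poly_closed n \<longleftrightarrow> z \<in> poly_closed n"
    "z * cis (2 * pi * real k / real n) \<in> poly_open n \<longleftrightarrow> z \<in> poly_open n"
proof -
  let ?w = "z * cis (2 * pi * real k / real n)"
  have "(\<forall>j. 0 \<le> side_gap n (j + k) ?w) \<longleftrightarrow> (\<forall>j. 0 \<le> side_gap n j ?w)"
    by (rule all_shift[OF n]) (simp only: side_gap_mod[OF n])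
  then show "?w \<in> poly_closed n \<longleftrightarrow> z \<in> poly_closed n"
    by (simp only: poly_closed_iff[OF n] side_gap_rotate)
  have "(\<forall>j. 0 < side_gap n (j + k) ?w) \<longleftrightarrow> (\<forall>j. 0 < side_gap n j ?w)"
    by (rule all_shift[OF n]) (simp only: side_gap_mod[OF n])
  then show "?w \<in> poly_open n \<longleftrightarrow> z \<in> poly_open n"
    by (simp only: poly_open_iff[OF n] side_gap_rotate)
qed

lemma poly_rotate_back:
  assumes n: "n \<ge> 1"
  shows "z * cis (- (2 * pi * real k / real n)) \<in> poly_closed n \<longleftrightarrow> z \<in> poly_closed n"
    "z * cis (- (2 * pi * real k / real n)) \<in> poly_open n \<longleftrightarrow> z \<in> poly_open n"
  using poly_rotate[OF n, of "z * cis (- (2 * pi * real k / real n))" k]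
  by (simp_all add: mult.assoc cis_mult)

section \<open>The polygon as the hull of its vertices\<close>

lemma interior_poly_closed:
  assumes n: "n \<ge> 1"
  shows "interior (poly_closed n) = poly_open n"
proof
  show "interior (poly_closed n) \<subseteq> poly_open n"
  proof
    fix z assume z: "z \<in> interior (poly_closed n)"
    then obtain e where e: "e > 0" "ball z e \<subseteq> poly_closed n" by (meson mem_interior)
    have "0 < side_gap n j z" if "j < n" for j
    proof -
      define a where "a = (2 * real j + 1) * pi / real n"
      \<comment> \<open>Moving along the outer normal of side \<open>j\<close> by
        \<open>e / 2\<close> lowers its gap by exactly that amount.\<close>
      have "z + of_real (e / 2) * cis a \<in> ball z e" using e(1) by (simp add: dist_norm norm_mult)
      then have "0 \<le> side_gap n j (z + of_real (e / 2) * cis a)" using e(2) that by (auto simp: poly_closed_def)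
      also have "side_gap n j (z + of_real (e / 2) * cis a) = side_gap n j z - e / 2"
      proof -
        have sg: "side_gap n j w = 1 - Re (w * cis (- a))" for w by (simp only: side_gap_def a_def)
        have "Re (of_real (e / 2) * cis a * cis (- a)) = e / 2" unfolding Re_polar_cis by simp
        then show ?thesis unfolding sg distrib_right plus_complex.sel by linarith
      qed
      finally show ?thesis using e(1) by simp
    qed
    then show "z \<in> poly_open n" by (simp add: poly_open_def)
  qed
qed (rule poly_open_interior)

lemma apex_in_vsector:
  assumes n: "n \<ge> 3"
  shows "apex n \<in> vsector n"
  using corner_disc_subset_vsector[OF n, of "apex n"] angle_bounds(5)[OF n] by simp

lemma poly_vertex_in_closed:
  assumes n: "n \<ge> 3"
  shows "poly_vertex n k \<in> poly_closed n"
proof -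
  have "corner_gap n (apex n) = 0" unfolding corner_gap_def apex_gaps[OF n] by simp
  then have "0 \<le> side_gap n j (apex n)" if "j < n" for j
    using corner_gap_le_side_gap[OF _ apex_in_vsector[OF n] that] n by simp
  then have "apex n \<in> poly_closed n" by (simp add: poly_closed_def)
  then show ?thesis unfolding poly_vertex_def using poly_rotate(1)[of n] n by simp
qed

text \<open>A geometric sum over a root of unity different from 1. It exhibits the centre as the
  mean of the vertices, so the centre lies in their hull.\<close>

lemma sum_poly_vertex:
  assumes n: "n \<ge> 3"
  shows "(\<Sum>k<n. poly_vertex n k) = 0"
proof -
  define w where "w = cis (2 * pi / real n)"
  have "w ^ k = cis (2 * pi * real k / real n)" for k
  proof -
    have "real k * (2 * pi / real n) = 2 * pi * real k / real n" by simp
    then show ?thesis unfolding w_def Complex.DeMoivre by (simp only:)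
  qed
  then have pv: "poly_vertex n k = apex n * w ^ k" for k by (simp add: poly_vertex_def)
  have wn: "w ^ n = 1" using n by (simp add: w_def Complex.DeMoivre)
  have "w \<noteq> 1"
  proof
    assume "w = 1"
    then have "Im w = 0" by simp
    moreover have "Im w > 0"
      unfolding w_def cis.sel using n by (intro sin_gt_zero) (auto simp: field_simps)
    ultimately show False by simp
  qed
  then have "(\<Sum>k<n. w ^ k) = 0" by (simp add: geometric_sum wn)
  then show ?thesis by (simp add: pv flip: sum_distrib_left)
qed

lemma poly_vertex_first:
  assumes n: "n \<ge> 3"
  shows "poly_vertex n 0 = Complex 1 (- tan (pi / real n)) * cis (pi / real n)"
    "poly_vertex n 1 = Complex 1 (tan (pi / real n)) * cis (pi / real n)"
    "poly_vertex n 0 = apex n"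
  unfolding poly_vertex_def apex_cis[OF n, symmetric] mult.assoc cis_mult by simp_all

lemma poly_side_0_foot:
  assumes n: "n \<ge> 3" and Y: "\<bar>Y\<bar> \<le> tan (pi / real n)"
  shows "Complex 1 Y * cis (pi / real n) \<in> poly_side n 0"
proof -
  define T where "T = tan (pi / real n)"
  have T: "T > 0" using angle_bounds(5)[OF n] by (simp add: T_def)
  define s where "s = (Y + T) / (2 * T)"
  have s: "0 \<le> s" "s \<le> 1" using Y T unfolding s_def T_def[symmetric] by (auto simp: field_simps abs_le_iff)
  have "Complex 1 Y = (1 - s) *\<^sub>R Complex 1 (- T) + s *\<^sub>R Complex 1 T"
    using T by (auto simp: complex_eq_iff s_def field_simps)
  then have "Complex 1 Y * cis (pi / real n) =
      (1 - s) *\<^sub>R (Complex 1 (- T) * cis (pi / real n)) + s *\<^sub>R (Complex 1 T * cis (pi / real n))"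
    by (simp add: distrib_right)
  then have "\<exists>s. Complex 1 Y * cis (pi / real n) =
      (1 - s) *\<^sub>R (Complex 1 (- T) * cis (pi / real n)) + s *\<^sub>R (Complex 1 T * cis (pi / real n)) \<and> 0 \<le> s \<and> s \<le> 1"
    using s by blast
  then show ?thesis
    unfolding poly_side_def One_nat_def[symmetric] poly_vertex_first(1,2)[OF n]
    by (simp add: in_segment T_def[symmetric]) blast
qed

lemma convex_poly_closed: "convex (poly_closed n)"
proof (rule convexI)
  fix x y and u v :: real
  assume xy: "x \<in> poly_closed n" "y \<in> poly_closed n" and uv: "0 \<le> u" "0 \<le> v" "u + v = 1"
  have "0 \<le> side_gap n j (u *\<^sub>R x + v *\<^sub>R y)" if "j < n" for j
  proof -
    have "u = 1 - v" using uv by simp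
    then have "side_gap n j (u *\<^sub>R x + v *\<^sub>R y) = u * side_gap n j x + v * side_gap n j y"
      by (simp only: side_gap_convex_combination)
    then show ?thesis using xy uv that by (simp add: poly_closed_def)
  qed
  then show "u *\<^sub>R x + v *\<^sub>R y \<in> poly_closed n" by (simp add: poly_closed_def)
qed

text \<open>For the nontrivial inclusion a point is placed in the triangle spanned by the centre and
  two consecutive vertices; the weight that the two vertices leave over goes to the centre.\<close>

lemma convex_hull_poly_vertex:
  assumes n: "n \<ge> 3"
  shows "convex hull (poly_vertex n ` {..<n}) = poly_closed n"
proof
  show "convex hull (poly_vertex n ` {..<n}) \<subseteq> poly_closed n"
    using poly_vertex_in_closed[OF n] by (intro hull_minimal convex_poly_closed) auto
  have n1: "n \<ge> 1" using n by simp
  let ?H = "convex hull (poly_vertex n ` {..<n})"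
  have V: "poly_vertex n k \<in> ?H" for k
    using n1 poly_vertex_mod[OF n1, of k] by (metis hull_inc imageI lessThan_iff mod_less_divisor less_eq_Suc_le One_nat_def)
  have "(\<Sum>k<n. (1 / real n) *\<^sub>R poly_vertex n k) \<in> ?H"
    using n V by (intro convex_sum convex_convex_hull) auto
  then have zero: "0 \<in> ?H" using sum_poly_vertex[OF n] by (simp flip: scaleR_sum_right)
  define T where "T = tan (pi / real n)"
  have T: "T > 0" using angle_bounds(5)[OF n] by (simp add: T_def)
  have comb: "of_real X * a + of_real Y * b \<in> ?H" if "a \<in> ?H" "b \<in> ?H" "X \<ge> 0" "Y \<ge> 0" "X + Y \<le> 1" for X Y a b
  proof -
    have "X *\<^sub>R a + Y *\<^sub>R b \<in> ?H"
    proof (cases "X + Y = 0")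
      case True
      then have "X = 0" "Y = 0" using that by linarith+
      then show ?thesis using zero by simp
    next
      case False
      then have s: "X + Y > 0" using that by simp
      have "(X / (X + Y)) *\<^sub>R a + (Y / (X + Y)) *\<^sub>R b \<in> ?H"
        using that s by (intro convexD[OF convex_convex_hull]) (auto simp: add_divide_distrib[symmetric])
      from convexD[OF convex_convex_hull this zero, of "X + Y" "1 - (X + Y)"]
      show ?thesis using that s by (simp add: scaleR_add_right)
    qed
    then show ?thesis by (simp add: scaleR_conv_of_real)
  qed
  show "poly_closed n \<subseteq> ?H"
  proof
    fix z assume z: "z \<in> poly_closed n"
    obtain k where k: "k < n" "z * cis (- (2 * pi * real k / real n)) \<in> vsector n"
      using vsector_rotate_ex[OF n1] by blast
    define w where "w = z * cis (- (2 * pi * real k / real n))"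
    have wK: "w \<in> poly_closed n" unfolding w_def using poly_rotate_back(1)[OF n1] z by blast
    have zw: "z = w * cis (2 * pi * real k / real n)" by (simp add: w_def mult.assoc cis_mult)
    obtain t \<gamma> where t: "t \<ge> 0" "0 \<le> \<gamma>" "\<gamma> \<le> pi / real n" "w = of_real t * cis \<gamma> \<or> cnj w = of_real t * cis \<gamma>"
      using vsector_half k(2) unfolding w_def by blast
    define w' where "w' = of_real t * cis \<gamma>"
    have w'K: "w' \<in> poly_closed n" using t(4) wK poly_closed_cnj[OF n k(2)] by (auto simp: w'_def w_def)
    define X where "X = t * cos (pi / real n - \<gamma>)"
    define Y where "Y = t * sin (pi / real n - \<gamma>)"
    note hs = half_sector[OF n w'K t(1-3) w'_def, folded X_def Y_def T_def]
    \<comment> \<open>\<open>a\<close> and \<open>b\<close> solve \<open>a + b = X\<close> and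
      \<open>a - b = Y / T\<close>, the coordinates with respect to the vertices
      \<open>(1, -T)\<close> and \<open>(1, T)\<close>. The inequality \<open>Y \<le> X T\<close>
      makes \<open>b\<close> nonnegative and \<open>X \<le> 1\<close> bounds the sum.\<close>
    define a where "a = (X + Y / T) / 2"
    define b where "b = (X - Y / T) / 2"
    have ab: "a \<ge> 0" "b \<ge> 0" "a + b \<le> 1" using hs T by (auto simp: a_def b_def field_simps)
    have "Complex X (- Y) = of_real a * Complex 1 (- T) + of_real b * Complex 1 T"
      using T by (auto simp: complex_eq_iff a_def b_def field_simps)
    then have w': "w' = of_real a * apex n + of_real b * (apex n * cis (2 * pi / real n))"
      using hs(7) poly_vertex_first[OF n, folded T_def] unfolding poly_vertex_def
      by (simp add: distrib_right mult.assoc)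
    from t(4) show "z \<in> ?H"
    proof
      assume "w = of_real t * cis \<gamma>"
      then have "z = of_real a * poly_vertex n k + of_real b * poly_vertex n (Suc k)"
        unfolding zw w'_def[symmetric] w' poly_vertex_def
        by (simp add: distrib_right mult.assoc cis_mult add_divide_distrib algebra_simps)
      then show ?thesis using comb[OF V V] ab by simp
    next
      assume "cnj w = of_real t * cis \<gamma>"
      then have "w = cnj w'" by (metis complex_cnj_cnj w'_def)
      also have "\<dots> = of_real a * apex n + of_real b * (apex n * cis (- (2 * pi / real n)))"
        unfolding w' by (simp add: apex_real cis_cnj)
      also have "cis (- (2 * pi / real n)) = cis (2 * pi * real (n - 1) / real n)"
      proof -
        have "2 * pi * real (n - 1) / real n = - (2 * pi / real n) + 2 * pi"
          using n by (simp add: of_nat_diff field_simps)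
        then show ?thesis by (simp add: complex_eq_iff)
      qed
      finally have w: "w = of_real a * apex n + of_real b * (apex n * cis (2 * pi * real (n - 1) / real n))" .
      have "cis (2 * pi * real (n - 1) / real n) * cis (2 * pi * real k / real n) = cis (2 * pi * real (n - 1 + k) / real n)"
        unfolding cis_mult by (simp add: add_divide_distrib algebra_simps)
      then have "z = of_real a * poly_vertex n k + of_real b * poly_vertex n (n - 1 + k)"
        unfolding zw w poly_vertex_def distrib_right mult.assoc by simp
      then show ?thesis using comb[OF V V] ab by simp
    qed
  qed
qed

section \<open>Distances to sides against distances to side lines and vertices\<close>

lemma infdist_similarity_image:
  assumes "\<rho> > 0" "\<And>x y. dist (T x) (T y) = \<rho> * dist x y"
  shows "infdist (T x) (T ` S) = \<rho> * infdist x S"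
proof (cases "S = {}")
  case False
  have "\<rho> * infdist x S \<le> infdist (T x) (T ` S)"
  proof -
    have "\<rho> * infdist x S \<le> dist (T x) (T a)" if "a \<in> S" for a
      using infdist_le[OF that, of x] assms by (simp add: mult_left_mono)
    then show ?thesis unfolding infdist_def[of "T x"] using False by (auto intro!: cINF_greatest)
  qed
  moreover have "infdist (T x) (T ` S) / \<rho> \<le> infdist x S"
  proof -
    have "infdist (T x) (T ` S) / \<rho> \<le> dist x a" if "a \<in> S" for a
      using infdist_le[of "T a" "T ` S" "T x"] that assms by (simp add: field_simps)
    then show ?thesis unfolding infdist_def[of x] using False by (auto intro!: cINF_greatest)
  qed
  ultimately show ?thesis using assms(1) by (simp add: field_simps)
qed (simp add: infdist_def)

text \<open>The distance to the segment. It can exceed \<open>side_gap\<close>, the distance to the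
  line, when the foot of the perpendicular falls outside the side.\<close>

definition poly_side_dist :: "nat \<Rightarrow> nat \<Rightarrow> complex \<Rightarrow> real" where
  "poly_side_dist n i z = infdist z (poly_side n i)"

lemma poly_side_mod: "n \<ge> 1 \<Longrightarrow> poly_side n (i mod n) = poly_side n i"
  unfolding poly_side_def by (metis mod_Suc_eq poly_vertex_mod)

lemma poly_vertex_rotate: "poly_vertex n i * cis (2 * pi * real k / real n) = poly_vertex n (i + k)"
  unfolding poly_vertex_def mult.assoc cis_mult by (simp add: add_divide_distrib algebra_simps)

lemma poly_side_dist_rotate:
  "poly_side_dist n (i + k) (z * cis (2 * pi * real k / real n)) = poly_side_dist n i z"
proof -
  define T where "T = (\<lambda>w. w * cis (2 * pi * real k / real n))"
  have "linear T" unfolding T_def by (intro linearI) (auto simp: algebra_simps)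
  then have "poly_side n (i + k) = T ` poly_side n i"
    unfolding poly_side_def closed_segment_linear_image[symmetric, OF \<open>linear T\<close>]
    by (simp only: T_def poly_vertex_rotate add_Suc)
  moreover have "infdist (T z) (T ` poly_side n i) = 1 * infdist z (poly_side n i)"
    by (rule infdist_similarity_image) (auto simp: T_def dist_norm norm_mult simp flip: left_diff_distrib)
  ultimately show ?thesis by (simp add: poly_side_dist_def T_def)
qed

lemma poly_side_dist_cnj:
  assumes n: "n \<ge> 3"
  shows "poly_side_dist n (n - 1) (cnj z) = poly_side_dist n 0 z"
proof -
  have "linear cnj" by (intro linearI) auto
  have "2 * pi * real (n - 1) / real n = - (2 * pi / real n) + 2 * pi"
    using n by (simp add: of_nat_diff field_simps)
  then have "poly_vertex n (n - 1) = cnj (poly_vertex n 1)"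
    unfolding poly_vertex_def by (simp add: apex_real complex_eq_iff)
  moreover have "poly_vertex n (Suc (n - 1)) = cnj (poly_vertex n 0)"
    using n poly_vertex_mod[of n n] by (simp add: poly_vertex_def apex_real)
  ultimately have "poly_side n (n - 1) = closed_segment (cnj (poly_vertex n 0)) (cnj (poly_vertex n 1))"
    unfolding poly_side_def by (simp only: closed_segment_commute)
  also have "\<dots> = cnj ` poly_side n 0"
    unfolding closed_segment_linear_image[OF \<open>linear cnj\<close>] poly_side_def by simp
  finally have "poly_side n (n - 1) = cnj ` poly_side n 0" .
  moreover have "infdist (cnj z) (cnj ` poly_side n 0) = 1 * infdist z (poly_side n 0)"
    by (rule infdist_similarity_image) (auto simp: dist_norm simp flip: complex_cnj_diff)
  ultimately show ?thesis by (simp add: poly_side_dist_def)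
qed

lemma poly_side_nonempty: "poly_side n i \<noteq> {}"
  by (simp add: poly_side_def)

text \<open>The gap is affine, vanishes at both ends of the side, hence on all of it, and decreases
  at rate at most 1.\<close>

lemma side_gap_le_poly_side_dist:
  assumes n: "n \<ge> 3"
  shows "side_gap n i z \<le> poly_side_dist n i z"
proof -
  have n1: "n \<ge> 1" using n by simp
  have a: "side_gap n 0 (apex n) = 0" "side_gap n (n - 1) (apex n) = 0"
    unfolding apex_gaps[OF n] by simp_all
  have v0: "side_gap n i (poly_vertex n i) = 0"
    using side_gap_rotate[of n 0 i "apex n"] a(1) by (simp add: poly_vertex_def)
  \<comment> \<open>Vertex \<open>i + 1\<close> is the apex after \<open>i + 1\<close> turns; these
    carry side \<open>n - 1\<close>, the other side at the apex, to side \<open>i\<close> modulo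
    \<open>n\<close>.\<close>
  have "side_gap n (n - 1 + Suc i) (poly_vertex n (Suc i)) = 0"
    unfolding poly_vertex_def side_gap_rotate by (rule a(2))
  moreover have "(n - 1 + Suc i) mod n = i mod n" using n by (simp add: mod_add_left_eq)
  ultimately have v1: "side_gap n i (poly_vertex n (Suc i)) = 0"
    by (metis side_gap_mod[OF n1])
  have "side_gap n i z \<le> dist z q" if qs: "q \<in> poly_side n i" for q
  proof -
    obtain s where q: "q = (1 - s) *\<^sub>R poly_vertex n i + s *\<^sub>R poly_vertex n (Suc i)"
      using qs unfolding poly_side_def in_segment by blast
    have "side_gap n i q = 0" unfolding q side_gap_convex_combination v0 v1 by simp
    then show ?thesis using side_gap_lipschitz[of n i z q] by (simp add: dist_norm norm_minus_commute)
  qed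
  then show ?thesis
    unfolding poly_side_dist_def infdist_def using poly_side_nonempty by (auto intro!: cINF_greatest)
qed

text \<open>Side 0 leaves the apex into the upper half-plane while \<open>w\<close> lies in the
  closed lower one. Completing the square in the position \<open>\<sigma>\<close> along the side
  gives a distance of at least \<open>r cos h\<close>, and \<open>cos h \<ge> 1 / 2\<close>.\<close>

lemma poly_side_0_dist_lower:
  assumes n: "n \<ge> 3" and Im: "Im (apex n - w) \<ge> 0"
  shows "cmod (apex n - w) / 2 \<le> poly_side_dist n 0 w"
proof -
  define h where "h = pi / real n"
  note ab = angle_bounds[OF n, folded h_def]
  define \<zeta> where "\<zeta> = apex n - w"
  define r where "r = cmod \<zeta>"
  have s34: "(sin h)\<^sup>2 \<le> 3 / 4"
  proof -
    have "(1 / 2)\<^sup>2 \<le> (cos h)\<^sup>2" using ab(3) by (intro power_mono) auto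
    then show ?thesis using sin_cos_squared_add[of h] by (simp add: power2_eq_square)
  qed
  have "r / 2 \<le> dist w q" if qs: "q \<in> poly_side n 0" for q
  proof -
    obtain s where s: "0 \<le> s" "q = (1 - s) *\<^sub>R poly_vertex n 0 + s *\<^sub>R poly_vertex n (Suc 0)"
      using qs unfolding poly_side_def in_segment by blast
    define \<sigma> where "\<sigma> = 2 * s * tan h"
    have \<sigma>: "\<sigma> \<ge> 0" using s(1) ab(5) by (simp add: \<sigma>_def)
    have "q = (Complex 1 (- tan h) + \<i> * of_real \<sigma>) * cis h"
      unfolding s(2) One_nat_def[symmetric] poly_vertex_first(1,2)[OF n] h_def[symmetric]
      by (simp add: complex_eq_iff \<sigma>_def algebra_simps)
    also have "\<dots> = apex n + \<i> * of_real \<sigma> * cis h"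
      using poly_vertex_first(1,3)[OF n] by (simp add: distrib_right h_def)
    finally have "w - q = - (\<zeta> + \<i> * of_real \<sigma> * cis h)" by (simp add: \<zeta>_def)
    then have "(dist w q)\<^sup>2 = (cmod (\<zeta> + \<i> * of_real \<sigma> * cis h))\<^sup>2" by (simp only: dist_norm norm_minus_cancel)
    also have "\<dots> = r\<^sup>2 + \<sigma>\<^sup>2 * ((sin h)\<^sup>2 + (cos h)\<^sup>2) + 2 * \<sigma> * (Im \<zeta> * cos h - Re \<zeta> * sin h)"
      unfolding r_def cmod_power2
      by (simp add: power2_eq_square algebra_simps del: sin_cos_squared_add sin_cos_squared_add2 sin_cos_squared_add3)
    also have "\<dots> = r\<^sup>2 + \<sigma>\<^sup>2 + 2 * \<sigma> * (Im \<zeta> * cos h - Re \<zeta> * sin h)"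
      by (simp only: sin_cos_squared_add mult_1_right)
    also have "\<dots> \<ge> r\<^sup>2 + \<sigma>\<^sup>2 + 2 * \<sigma> * (- (r * sin h))"
    proof -
      have "Re \<zeta> * sin h \<le> r * sin h" using complex_Re_le_cmod[of \<zeta>] ab(4) by (simp add: r_def)
      moreover have "Im \<zeta> * cos h \<ge> 0" using Im ab(3) by (simp add: \<zeta>_def)
      ultimately show ?thesis using \<sigma> by (intro add_left_mono mult_left_mono) auto
    qed
    finally have "(dist w q)\<^sup>2 \<ge> (\<sigma> - r * sin h)\<^sup>2 + r\<^sup>2 * (1 - (sin h)\<^sup>2)"
      by (simp add: power2_eq_square algebra_simps)
    moreover have "r\<^sup>2 * (1 - (sin h)\<^sup>2) \<ge> r\<^sup>2 * (1 / 4)" using s34 by (intro mult_left_mono) auto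
    moreover have "(r / 2)\<^sup>2 = r\<^sup>2 * (1 / 4)" by (simp add: power2_eq_square)
    ultimately have "(r / 2)\<^sup>2 \<le> (dist w q)\<^sup>2" using zero_le_power2[of "\<sigma> - r * sin h"] by linarith
    then show ?thesis by (rule power2_le_imp_le) simp
  qed
  then show ?thesis
    unfolding poly_side_dist_def infdist_notempty[OF poly_side_nonempty] r_def \<zeta>_def
    by (intro cINF_greatest poly_side_nonempty)
qed

text \<open>After rotating the vertex to the apex, the point lies on one side of the axis of
  symmetry, and the adjacent side across the axis is the far one; conjugation exchanges the two
  cases.\<close>

lemma poly_side_dist_vertex_lower:
  assumes n: "n \<ge> 3"
  shows "cmod (z - poly_vertex n (Suc i)) / 2 \<le> max (poly_side_dist n i z) (poly_side_dist n (Suc i) z)"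
proof -
  have n1: "n \<ge> 1" using n by simp
  define w where "w = z * cis (- (2 * pi * real (Suc i) / real n))"
  have z: "z = w * cis (2 * pi * real (Suc i) / real n)" by (simp add: w_def mult.assoc cis_mult)
  have "cmod (z - poly_vertex n (Suc i)) = cmod (apex n - w)"
    unfolding z poly_vertex_def left_diff_distrib[symmetric] by (simp add: norm_mult norm_minus_commute)
  moreover have "poly_side_dist n (Suc i) z = poly_side_dist n 0 w"
    unfolding z using poly_side_dist_rotate[of n 0 "Suc i" w] by simp
  moreover have "poly_side_dist n i z = poly_side_dist n (n - 1) w"
  proof -
    have "poly_side_dist n (n - 1 + Suc i) z = poly_side_dist n (n - 1) w"
      unfolding z by (rule poly_side_dist_rotate)
    moreover have "(n - 1 + Suc i) mod n = i mod n" using n by (simp add: mod_add_left_eq)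
    ultimately show ?thesis unfolding poly_side_dist_def by (metis poly_side_mod[OF n1])
  qed
  moreover have "cmod (apex n - w) / 2 \<le> max (poly_side_dist n (n - 1) w) (poly_side_dist n 0 w)"
  proof (cases "Im (apex n - w) \<ge> 0")
    case True
    then show ?thesis using poly_side_0_dist_lower[OF n] by (simp add: le_max_iff_disj)
  next
    case False
    then have "Im (apex n - cnj w) \<ge> 0" by (simp add: apex_def)
    from poly_side_0_dist_lower[OF n this]
    have "cmod (cnj (apex n - w)) / 2 \<le> poly_side_dist n (n - 1) w"
      using poly_side_dist_cnj[OF n, of "cnj w"] by (simp add: apex_real)
    then show ?thesis by (simp only: complex_mod_cnj le_max_iff_disj simp_thms)
  qed
  ultimately show ?thesis by simp
qed

text \<open>All vertices have the same modulus, so by the law of cosines the nearest one has the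
  largest cosine of the angle to \<open>w\<close>; the cosines are compared by the product
  formula.\<close>

lemma vsector_nearest_vertex:
  assumes n: "n \<ge> 3" and w: "w \<in> vsector n"
  shows "cmod (apex n - w) \<le> cmod (w - poly_vertex n j)"
proof -
  define h where "h = pi / real n"
  note ab = angle_bounds[OF n, folded h_def]
  have hn: "real n * h = pi" using n by (simp add: h_def)
  have n1: "n \<ge> 1" using n by simp
  obtain t \<gamma> where t: "t \<ge> 0" "\<bar>\<gamma>\<bar> \<le> h" "w = of_real t * cis \<gamma>"
    using w by (auto simp: vsector_def h_def)
  define R where "R = 1 / cos h"
  have R: "R > 0" using ab(3) by (simp add: R_def)
  have ap: "apex n = of_real R" by (simp add: apex_def R_def h_def)
  define i where "i = j mod n"
  have i: "i < n" using n by (simp add: i_def)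
  have sq: "(cmod (w - of_real R * cis a))\<^sup>2 = t\<^sup>2 + R\<^sup>2 - 2 * t * R * cos (\<gamma> - a)" for a
  proof -
    have "(cmod (w - of_real R * cis a))\<^sup>2 = t\<^sup>2 * ((sin \<gamma>)\<^sup>2 + (cos \<gamma>)\<^sup>2) + R\<^sup>2 * ((sin a)\<^sup>2 + (cos a)\<^sup>2) - 2 * t * R * cos (\<gamma> - a)"
      unfolding cmod_power2 cos_diff t(3)
      by (simp add: power2_eq_square algebra_simps del: sin_cos_squared_add sin_cos_squared_add2 sin_cos_squared_add3)
    then show ?thesis by (simp only: sin_cos_squared_add mult_1_right)
  qed
  have "cos (\<gamma> - 2 * (real i * h)) \<le> cos \<gamma>"
  proof (cases "i = 0")
    case False
    have "real i * h \<ge> 1 * h" "(real i + 1) * h \<le> pi"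
      using False i ab(1) mult_right_mono[of "real i + 1" "real n" h] hn by (auto intro: mult_right_mono)
    then have ih: "real i * h \<ge> h" "real i * h + h \<le> pi" by (simp_all add: algebra_simps)
    have "cos \<gamma> - cos (\<gamma> - 2 * (real i * h)) =
        2 * sin ((\<gamma> + (\<gamma> - 2 * (real i * h))) / 2) * sin (((\<gamma> - 2 * (real i * h)) - \<gamma>) / 2)"
      by (rule cos_diff_cos)
    also have "(\<gamma> + (\<gamma> - 2 * (real i * h))) / 2 = - (real i * h - \<gamma>)" by (simp add: field_simps)
    also have "((\<gamma> - 2 * (real i * h)) - \<gamma>) / 2 = - (real i * h)" by (simp add: field_simps)
    finally have "cos \<gamma> - cos (\<gamma> - 2 * (real i * h)) = 2 * sin (real i * h - \<gamma>) * sin (real i * h)"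
      unfolding sin_minus by simp
    moreover have "sin (real i * h - \<gamma>) \<ge> 0" using t(2) ih ab by (intro sin_ge_zero) linarith+
    moreover have "sin (real i * h) \<ge> 0" using ih ab by (intro sin_ge_zero) linarith+
    ultimately show ?thesis by (metis diff_ge_0_iff_ge mult_nonneg_nonneg zero_le_numeral)
  qed simp
  then have "2 * t * R * cos (\<gamma> - 2 * (real i * h)) \<le> 2 * t * R * cos \<gamma>"
    using t(1) R by (intro mult_left_mono) auto
  moreover have "poly_vertex n j = of_real R * cis (2 * (real i * h))"
  proof -
    have "poly_vertex n j = poly_vertex n i" by (simp add: i_def poly_vertex_mod[OF n1])
    then show ?thesis by (simp add: poly_vertex_def ap h_def mult_ac)
  qed
  ultimately have "(cmod (w - of_real R * cis 0))\<^sup>2 \<le> (cmod (w - poly_vertex n j))\<^sup>2"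
    using sq[of 0] sq[of "2 * (real i * h)"] by simp
  then have "cmod (w - of_real R * cis 0) \<le> cmod (w - poly_vertex n j)" by (rule power2_le_imp_le) simp
  then show ?thesis by (simp add: ap norm_minus_commute)
qed

text \<open>In a half sector the perpendicular to the nearer side line meets the side itself, by the
  bound on \<open>Y\<close> in \<open>half_sector\<close>, so there the segment is no farther than
  its line. The other two bounds hold because the apex is an end of both sides.\<close>

lemma corner_side_dist_upper:
  assumes n: "n \<ge> 3" and w: "w \<in> vsector n" "w \<in> poly_closed n"
  shows "min (poly_side_dist n (n - 1) w) (poly_side_dist n 0 w) \<le> corner_gap n w"
    "poly_side_dist n (n - 1) w \<le> cmod (apex n - w)" "poly_side_dist n 0 w \<le> cmod (apex n - w)"
proof -
  have d0: "poly_side_dist n 0 w \<le> cmod (apex n - w)" for w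
  proof -
    have "apex n \<in> poly_side n 0" using poly_vertex_first(3)[OF n] by (simp add: poly_side_def)
    from infdist_le[OF this, of w] show ?thesis
      by (simp add: poly_side_dist_def dist_norm norm_minus_commute)
  qed
  show "poly_side_dist n 0 w \<le> cmod (apex n - w)" by (rule d0)
  have "poly_side_dist n (n - 1) w \<le> cmod (cnj (apex n - w))"
    using d0[of "cnj w"] poly_side_dist_cnj[OF n, of "cnj w"] by (simp add: apex_real)
  then show "poly_side_dist n (n - 1) w \<le> cmod (apex n - w)" by (simp only: complex_mod_cnj)
  obtain t \<gamma> where t: "t \<ge> 0" "0 \<le> \<gamma>" "\<gamma> \<le> pi / real n" "w = of_real t * cis \<gamma> \<or> cnj w = of_real t * cis \<gamma>"
    using vsector_half w(1) by blast
  have half: "poly_side_dist n 0 w' \<le> corner_gap n w'" if w': "w' \<in> poly_closed n" "w' = of_real t * cis \<gamma>" for w'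
  proof -
    define X where "X = t * cos (pi / real n - \<gamma>)"
    define Y where "Y = t * sin (pi / real n - \<gamma>)"
    note hs = half_sector[OF n w'(1) t(1-3) w'(2), folded X_def Y_def]
    have "Y \<le> tan (pi / real n)"
      using hs(4,6) angle_bounds(5)[OF n] mult_right_mono[of X 1 "tan (pi / real n)"] by linarith
    then have "Complex 1 (- Y) * cis (pi / real n) \<in> poly_side n 0"
      using hs(5) by (intro poly_side_0_foot[OF n]) auto
    from infdist_le[OF this, of w']
    have "poly_side_dist n 0 w' \<le> cmod (w' - Complex 1 (- Y) * cis (pi / real n))"
      by (simp add: poly_side_dist_def dist_norm)
    also have "w' - Complex 1 (- Y) * cis (pi / real n) = of_real (X - 1) * cis (pi / real n)"
      unfolding hs(7) left_diff_distrib[symmetric] by (simp add: complex_eq_iff)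
    also have "cmod (of_real (X - 1) * cis (pi / real n)) = 1 - X"
      using hs(4) by (simp only: norm_mult norm_of_real norm_cis mult_1_right)
    finally show ?thesis using hs(2) by simp
  qed
  from t(4) show "min (poly_side_dist n (n - 1) w) (poly_side_dist n 0 w) \<le> corner_gap n w"
  proof
    assume "w = of_real t * cis \<gamma>"
    then show ?thesis using half[OF w(2)] by (simp add: min_le_iff_disj)
  next
    assume "cnj w = of_real t * cis \<gamma>"
    then have "poly_side_dist n 0 (cnj w) \<le> corner_gap n (cnj w)"
      using half poly_closed_cnj[OF n w] by blast
    then show ?thesis using poly_side_dist_cnj[OF n, of "cnj w"] corner_gap_cnj[OF n, of w]
      by (simp add: min_le_iff_disj)
  qed
qed

text \<open>For consecutive sides the product of the distances is their minimum, at least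
  \<open>m\<close>, times their maximum, at least \<open>r / 2\<close> because no vertex is nearer
  than the apex is to \<open>w\<close>. The pair meeting at the nearest vertex shows that both
  orders are attained.\<close>

lemma poly_side_dist_bounds:
  assumes n: "n \<ge> 3" and k: "k < n" and z: "z \<in> poly_closed n"
  defines "w \<equiv> z * cis (- (2 * pi * real k / real n))"
  defines "m \<equiv> corner_gap n w" and "r \<equiv> cmod (apex n - w)"
    and "d \<equiv> (\<lambda>i. poly_side_dist n i z)"
  assumes sec: "w \<in> vsector n"
  shows "m * r / 2 \<le> (MIN i\<in>{..<n}. d i * d (Suc i mod n))"
    "(MIN i\<in>{..<n}. d i * d (Suc i mod n)) \<le> m * r"
    "r / 2 \<le> (MIN i\<in>{..<n}. d i + d (Suc i mod n))"
    "(MIN i\<in>{..<n}. d i + d (Suc i mod n)) \<le> 2 * r"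
proof -
  have n1: "n \<ge> 1" using n by simp
  have zw: "z = w * cis (2 * pi * real k / real n)" by (simp add: w_def mult.assoc cis_mult)
  have wK: "w \<in> poly_closed n" unfolding w_def using poly_rotate_back(1)[OF n1] z by blast
  have m0: "m \<ge> 0" unfolding m_def by (rule corner_gap_nonneg[OF n1 wK])
  have dmod: "d (i mod n) = d i" for i by (simp add: d_def poly_side_dist_def poly_side_mod[OF n1])
  have dm: "m \<le> d i" for i
  proof -
    \<comment> \<open>Side \<open>i\<close> seen from \<open>w\<close> has number
      \<open>i - k\<close> modulo \<open>n\<close>, written without subtraction.\<close>
    have "(i + k * (n - 1)) + k = i + n * k" using n by (cases n) auto
    then have "((i + k * (n - 1)) + k) mod n = i mod n" by (simp only: mod_mult_self2)
    then have "side_gap n i z = side_gap n ((i + k * (n - 1)) + k) z" by (metis side_gap_mod[OF n1])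
    also have "\<dots> = side_gap n ((i + k * (n - 1)) mod n) w"
      unfolding zw side_gap_rotate by (rule side_gap_mod[OF n1, symmetric])
    also have "\<dots> \<ge> m" unfolding m_def using n by (intro corner_gap_le_side_gap[OF n1 sec]) simp
    finally show ?thesis using side_gap_le_poly_side_dist[OF n, of i z] by (simp add: d_def)
  qed
  have dmax: "r / 2 \<le> max (d i) (d (Suc i))" for i
  proof -
    have "(Suc i + k * (n - 1)) + k = Suc i + n * k" using n by (cases n) auto
    then have "((Suc i + k * (n - 1)) + k) mod n = Suc i mod n" by (simp only: mod_mult_self2)
    then have "poly_vertex n (Suc i) = poly_vertex n ((Suc i + k * (n - 1)) + k)" by (metis poly_vertex_mod[OF n1])
    also have "\<dots> = poly_vertex n (Suc i + k * (n - 1)) * cis (2 * pi * real k / real n)"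
      by (rule poly_vertex_rotate[symmetric])
    finally have "cmod (z - poly_vertex n (Suc i)) = cmod (w - poly_vertex n (Suc i + k * (n - 1)))"
      unfolding zw by (simp add: norm_mult flip: left_diff_distrib)
    also have "\<dots> \<ge> r" unfolding r_def by (rule vsector_nearest_vertex[OF n sec])
    finally show ?thesis using poly_side_dist_vertex_lower[OF n, of z i] by (simp add: d_def)
  qed
  have fin: "finite ((\<lambda>i. f i) ` {..<n})" "(\<lambda>i. f i) ` {..<n} \<noteq> {}" for f :: "nat \<Rightarrow> real"
    using n by (auto simp: lessThan_empty_iff)
  show "m * r / 2 \<le> (MIN i\<in>{..<n}. d i * d (Suc i mod n))"
  proof (rule Min.boundedI[OF fin])
    fix a assume "a \<in> (\<lambda>i. d i * d (Suc i mod n)) ` {..<n}"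
    then obtain i where a: "a = d i * d (Suc i)" by (auto simp: dmod)
    have "m * (r / 2) \<le> min (d i) (d (Suc i)) * max (d i) (d (Suc i))"
      using dm m0 dmax[of i] by (intro mult_mono) (auto intro: order_trans[OF m0 dm] simp: r_def le_max_iff_disj)
    also have "\<dots> = a" by (simp add: a min_def max_def)
    finally show "m * r / 2 \<le> a" by simp
  qed
  show "r / 2 \<le> (MIN i\<in>{..<n}. d i + d (Suc i mod n))"
  proof (rule Min.boundedI[OF fin])
    fix a assume "a \<in> (\<lambda>i. d i + d (Suc i mod n)) ` {..<n}"
    then obtain i where a: "a = d i + d (Suc i)" by (auto simp: dmod)
    have "d i \<ge> 0" "d (Suc i) \<ge> 0" using dm m0 order_trans by blast+
    then show "r / 2 \<le> a" using dmax[of i] unfolding a by linarith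
  qed
  \<comment> \<open>Side \<open>i\<close> runs from vertex \<open>i\<close> to vertex
    \<open>i + 1\<close>, so vertex \<open>k\<close> is the common end of sides \<open>k - 1\<close>
    and \<open>k\<close>; \<open>n - 1 + k\<close> stands for \<open>k - 1\<close>, also when
    \<open>k = 0\<close>.\<close>
  define i where "i = (n - 1 + k) mod n"
  have i: "i < n" using n by (simp add: i_def)
  have "Suc i mod n = k"
  proof -
    have "Suc i mod n = Suc (n - 1 + k) mod n" unfolding i_def by (rule mod_Suc_eq)
    also have "Suc (n - 1 + k) = n + k" using n by simp
    finally show ?thesis using k by simp
  qed
  moreover have "d k = poly_side_dist n 0 w"
    unfolding d_def zw using poly_side_dist_rotate[of n 0 k w] by simp
  moreover have "d i = poly_side_dist n (n - 1) w"
    unfolding i_def dmod unfolding d_def zw by (rule poly_side_dist_rotate)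
  ultimately have c: "min (d i) (d (Suc i mod n)) \<le> m" "d i \<le> r" "d (Suc i mod n) \<le> r"
    using corner_side_dist_upper[OF n sec wK] by (simp_all add: m_def r_def)
  have d0: "d i \<ge> 0" "d (Suc i mod n) \<ge> 0" using dm m0 order_trans by blast+
  have "(MIN i\<in>{..<n}. d i * d (Suc i mod n)) \<le> d i * d (Suc i mod n)" using i by (intro Min_le) auto
  also have "\<dots> = min (d i) (d (Suc i mod n)) * max (d i) (d (Suc i mod n))" by (simp add: min_def max_def)
  also have "\<dots> \<le> m * r" using c d0 m0 by (intro mult_mono) auto
  finally show "(MIN i\<in>{..<n}. d i * d (Suc i mod n)) \<le> m * r" .
  have "(MIN i\<in>{..<n}. d i + d (Suc i mod n)) \<le> d i + d (Suc i mod n)" using i by (intro Min_le) auto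
  then show "(MIN i\<in>{..<n}. d i + d (Suc i mod n)) \<le> 2 * r" using c by linarith
qed

section \<open>Transfer to the regular polygon in the plane\<close>

definition cvec :: "complex \<Rightarrow> real^2" where
  "cvec z = vector [Re z, Im z]"

lemma cvec_nth [simp]: "cvec z $ 1 = Re z" "cvec z $ 2 = Im z"
  by (simp_all add: cvec_def)

lemma linear_cvec: "linear cvec"
  by (intro linearI) (simp_all add: vec_eq_iff forall_2)

lemma norm_cvec: "norm (cvec z) = cmod z"
  by (simp add: norm_vec_def L2_set_def sum_2 cmod_def)

text \<open>The similarity from the normalised polygon to the given one. With
  \<open>\<beta> = \<theta> + 2 pi k / n\<close> it carries the apex to vertex
  \<open>k\<close>.\<close>

definition poly_map :: "real \<Rightarrow> real^2 \<Rightarrow> real \<Rightarrow> complex \<Rightarrow> real^2" where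
  "poly_map \<rho> c \<beta> z = c + \<rho> *\<^sub>R cvec (z * cis \<beta>)"

lemma linear_poly_map_part: "linear (\<lambda>z. \<rho> *\<^sub>R cvec (z * cis \<beta>))"
  by (intro linearI) (simp_all add: distrib_right linear_add[OF linear_cvec] linear_scale[OF linear_cvec] scaleR_add_right)

lemma dist_poly_map:
  assumes "\<rho> > 0"
  shows "dist (poly_map \<rho> c \<beta> z) (poly_map \<rho> c \<beta> w) = \<rho> * dist z w"
proof -
  have "poly_map \<rho> c \<beta> z - poly_map \<rho> c \<beta> w = \<rho> *\<^sub>R cvec ((z - w) * cis \<beta>)"
    by (simp add: poly_map_def left_diff_distrib linear_diff[OF linear_cvec] scaleR_diff_right)
  then show ?thesis using assms by (simp add: dist_norm norm_cvec norm_mult)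
qed

lemma bij_poly_map_part:
  assumes "\<rho> > 0"
  shows "bij (\<lambda>z. \<rho> *\<^sub>R cvec (z * cis \<beta>))"
proof (rule bijI)
  show "inj (\<lambda>z. \<rho> *\<^sub>R cvec (z * cis \<beta>))"
  proof (rule injI)
    fix z w assume "\<rho> *\<^sub>R cvec (z * cis \<beta>) = \<rho> *\<^sub>R cvec (w * cis \<beta>)"
    then have "poly_map \<rho> 0 \<beta> z = poly_map \<rho> 0 \<beta> w" by (simp add: poly_map_def)
    then show "z = w" using dist_poly_map[OF assms, of 0 \<beta> z w] assms by simp
  qed
  show "surj (\<lambda>z. \<rho> *\<^sub>R cvec (z * cis \<beta>))"
  proof (rule surjI)
    fix v :: "real^2"
    let ?z = "Complex (v $ 1 / \<rho>) (v $ 2 / \<rho>)"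
    have "\<rho> *\<^sub>R cvec (?z * cis (- \<beta>) * cis \<beta>) = \<rho> *\<^sub>R cvec ?z" by (simp only: mult.assoc cis_mult) simp
    also have "\<dots> = v" using assms by (simp add: vec_eq_iff forall_2)
    finally show "\<rho> *\<^sub>R cvec (?z * cis (- \<beta>) * cis \<beta>) = v" .
  qed
qed

lemma inj_poly_map: "\<rho> > 0 \<Longrightarrow> inj (poly_map \<rho> c \<beta>)"
  using dist_poly_map[of \<rho> c \<beta>] by (intro injI) (metis dist_eq_0_iff mult_eq_0_iff less_irrefl)

lemma poly_map_rotate: "poly_map \<rho> c (\<theta> + a) z = poly_map \<rho> c \<theta> (z * cis a)"
  by (simp add: poly_map_def mult.assoc cis_mult add.commute)

lemma continuous_on_poly_map: "continuous_on A (poly_map \<rho> c \<beta>)"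
  unfolding poly_map_def
  by (rule continuous_on_add[OF continuous_on_const linear_continuous_on])
    (simp only: linear_conv_bounded_linear[symmetric] linear_poly_map_part)

definition inradius :: "nat \<Rightarrow> real \<Rightarrow> real" where
  "inradius n l = l / (2 * tan (pi / real n))"

lemma regular_polygon_vertex_eq:
  assumes n: "n \<ge> 3"
  shows "regular_polygon_vertex n l c \<theta> k = poly_map (inradius n l) c \<theta> (poly_vertex n k)"
proof -
  have "poly_vertex n k * cis \<theta> = of_real (1 / cos (pi / real n)) * cis (\<theta> + 2 * pi * real k / real n)"
    unfolding poly_vertex_def apex_def mult.assoc cis_mult by (simp add: add.commute)
  moreover have "inradius n l * (1 / cos (pi / real n)) = l / (2 * sin (pi / real n))"
    using angle_bounds(3,4)[OF n] by (simp add: inradius_def tan_def)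
  moreover have "cvec (of_real s * cis a) = s *\<^sub>R vector [cos a, sin a]" for s a
    by (simp add: vec_eq_iff forall_2)
  ultimately show ?thesis
    unfolding regular_polygon_vertex_def poly_map_def by (simp only: scaleR_scaleR)
qed

lemma convex_hull_regular_polygon:
  assumes n: "n \<ge> 3"
  shows "convex hull (regular_polygon_vertex n l c \<theta> ` {..<n}) = poly_map (inradius n l) c \<theta> ` poly_closed n"
proof -
  define L where "L = (\<lambda>z. inradius n l *\<^sub>R cvec (z * cis \<theta>))"
  have L: "linear L" unfolding L_def by (rule linear_poly_map_part)
  have pm: "poly_map (inradius n l) c \<theta> ` S = (\<lambda>x. c + x) ` (L ` S)" for S
    by (auto simp: poly_map_def L_def)
  have "regular_polygon_vertex n l c \<theta> ` {..<n} = poly_map (inradius n l) c \<theta> ` (poly_vertex n ` {..<n})"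
    using regular_polygon_vertex_eq[OF n] by (auto simp: image_image)
  then show ?thesis
    unfolding pm convex_hull_poly_vertex[OF n, symmetric]
    by (simp only: convex_hull_translation convex_hull_linear_image[OF L])
qed

text \<open>The closure is obtained from convexity: a convex set with nonempty interior has the same
  closure as its interior, and the hull is compact.\<close>

lemma regular_polygon_eq:
  assumes n: "n \<ge> 3" and l: "l > 0"
  shows "regular_polygon n l c \<theta> = poly_map (inradius n l) c \<theta> ` poly_open n"
    "closure (regular_polygon n l c \<theta>) = poly_map (inradius n l) c \<theta> ` poly_closed n"
proof -
  have n1: "n \<ge> 1" using n by simp
  have \<rho>: "inradius n l > 0" using l angle_bounds(5)[OF n] by (simp add: inradius_def)
  define L where "L = (\<lambda>z. inradius n l *\<^sub>R cvec (z * cis \<theta>))"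
  have L: "linear L" "bij L" unfolding L_def by (rule linear_poly_map_part, rule bij_poly_map_part[OF \<rho>])
  have pm: "poly_map (inradius n l) c \<theta> ` S = (\<lambda>x. c + x) ` (L ` S)" for S
    by (auto simp: poly_map_def L_def)
  show 1: "regular_polygon n l c \<theta> = poly_map (inradius n l) c \<theta> ` poly_open n"
    unfolding regular_polygon_def convex_hull_regular_polygon[OF n] pm interior_translation
      interior_bijective_linear_image[OF L] interior_poly_closed[OF n1] ..
  have "0 \<in> poly_open n" using unit_ball_subset_poly_open[of n] by auto
  then have "interior (convex hull (regular_polygon_vertex n l c \<theta> ` {..<n})) \<noteq> {}"
    using 1 unfolding regular_polygon_def by auto
  from convex_closure_interior[OF convex_convex_hull this]
  have "closure (regular_polygon n l c \<theta>) = closure (poly_map (inradius n l) c \<theta> ` poly_closed n)"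
    unfolding regular_polygon_def convex_hull_regular_polygon[OF n] .
  also have "closed (poly_map (inradius n l) c \<theta> ` poly_closed n)"
    by (intro compact_imp_closed compact_continuous_image continuous_on_poly_map compact_poly_closed[OF n])
  then have "closure (poly_map (inradius n l) c \<theta> ` poly_closed n) = poly_map (inradius n l) c \<theta> ` poly_closed n"
    by (rule closure_closed)
  finally show "closure (regular_polygon n l c \<theta>) = poly_map (inradius n l) c \<theta> ` poly_closed n" .
qed

lemma side_dist_poly_map:
  assumes n: "n \<ge> 3" and l: "l > 0"
  shows "side_dist n l c \<theta> i (poly_map (inradius n l) c \<theta> z) = inradius n l * poly_side_dist n i z"
proof -
  have n1: "n \<ge> 1" using n by simp
  have \<rho>: "inradius n l > 0" using l angle_bounds(5)[OF n] by (simp add: inradius_def)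
  define L where "L = (\<lambda>z. inradius n l *\<^sub>R cvec (z * cis \<theta>))"
  have L: "linear L" unfolding L_def by (rule linear_poly_map_part)
  have pm: "poly_map (inradius n l) c \<theta> z = c + L z" for z by (simp add: poly_map_def L_def)
  have "regular_polygon_side n l c \<theta> i = closed_segment (c + L (poly_vertex n i)) (c + L (poly_vertex n (Suc i)))"
    unfolding regular_polygon_side_def regular_polygon_vertex_eq[OF n] poly_vertex_mod[OF n1] pm ..
  also have "\<dots> = (\<lambda>z. c + L z) ` poly_side n i"
    unfolding closed_segment_translation closed_segment_linear_image[OF L] poly_side_def image_image ..
  finally have "regular_polygon_side n l c \<theta> i = poly_map (inradius n l) c \<theta> ` poly_side n i"
    unfolding pm[abs_def] .
  then show ?thesis
    unfolding side_dist_def poly_side_dist_def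
    using infdist_similarity_image[OF \<rho>, of "poly_map (inradius n l) c \<theta>"] dist_poly_map[OF \<rho>] by simp
qed

section \<open>Second derivatives and the eigenfunction under the similarity\<close>

lemma has_deriv2_deriv:
  assumes "has_deriv2 f a t"
  shows "(deriv ^^ 2) f t = a"
proof -
  from assms obtain f' where
    f: "\<forall>\<^sub>F s in nhds t. (f has_real_derivative f' s) (at s)" "(f' has_real_derivative a) (at t)"
    unfolding has_deriv2_def by blast
  have "\<forall>\<^sub>F s in nhds t. deriv f s = f' s"
    using f(1) by eventually_elim (rule DERIV_imp_deriv)
  then have "deriv (deriv f) t = deriv f' t" by (intro deriv_cong_ev) auto
  also have "\<dots> = a" by (rule DERIV_imp_deriv[OF f(2)])
  finally show ?thesis by (simp add: numeral_2_eq_2)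
qed

text \<open>The point is one bilinear form for all directions \<open>h\<close>; it allows the axes
  to be rotated afterwards.\<close>

lemma C2_on_has_deriv2:
  fixes u :: "'a::euclidean_space \<Rightarrow> real"
  assumes "C2_on U u" "open U" "x \<in> U"
  obtains D2 :: "'a \<Rightarrow>\<^sub>L 'a \<Rightarrow>\<^sub>L real" where
    "\<And>h. has_deriv2 (\<lambda>t. u (x + t *\<^sub>R h)) (D2 h h) 0"
proof -
  from assms(1) obtain Du :: "'a \<Rightarrow> 'a \<Rightarrow>\<^sub>L real" and D2u :: "'a \<Rightarrow> 'a \<Rightarrow>\<^sub>L 'a \<Rightarrow>\<^sub>L real" where
    D: "\<And>x. x \<in> U \<Longrightarrow> (u has_derivative blinfun_apply (Du x)) (at x)"
    "\<And>x. x \<in> U \<Longrightarrow> (Du has_derivative blinfun_apply (D2u x)) (at x)"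
    unfolding C2_on_def by blast
  have "has_deriv2 (\<lambda>t. u (x + t *\<^sub>R h)) (D2u x h h) 0" for h
  proof -
    have line: "((\<lambda>t. x + t *\<^sub>R h) has_derivative (\<lambda>s. s *\<^sub>R h)) (at t)" for t
      by (auto intro!: derivative_eq_intros)
    have "\<forall>\<^sub>F t in nhds 0. x + t *\<^sub>R h \<in> U"
    proof -
      have "((\<lambda>t. x + t *\<^sub>R h) \<longlongrightarrow> x + 0 *\<^sub>R h) (nhds 0)" by (intro tendsto_intros filterlim_ident)
      then show ?thesis using assms(2,3) by (auto simp: tendsto_def)
    qed
    then have 1: "\<forall>\<^sub>F t in nhds 0. ((\<lambda>t. u (x + t *\<^sub>R h)) has_real_derivative Du (x + t *\<^sub>R h) h) (at t)"
    proof eventually_elim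
      case (elim t)
      from has_derivative_compose[OF line D(1)[OF elim]] show ?case
        by (simp add: has_field_derivative_def blinfun.scaleR_right mult_commute_abs)
    qed
    have "(Du has_derivative blinfun_apply (D2u x)) (at (x + 0 *\<^sub>R h))" using D(2)[OF assms(3)] by simp
    from has_derivative_compose[OF line this]
    have "((\<lambda>t. Du (x + t *\<^sub>R h)) has_derivative (\<lambda>s. D2u x (s *\<^sub>R h))) (at 0)" .
    from bounded_linear.has_derivative[OF blinfun.bounded_linear_left this, of h]
    have "((\<lambda>t. Du (x + t *\<^sub>R h) h) has_real_derivative D2u x h h) (at 0)"
      by (simp add: has_field_derivative_def blinfun.scaleR_right blinfun.scaleR_left mult_commute_abs)
    with 1 show ?thesis unfolding has_deriv2_def
      by (intro exI[of _ "\<lambda>t. Du (x + t *\<^sub>R h) h"]) simp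
  qed
  then show ?thesis using that by blast
qed

text \<open>The map sends the directions 1 and i to orthogonal vectors of length
  \<open>\<rho>\<close>. The trace of the second derivative is invariant under rotation, as the
  mixed terms cancel, and picks up the factor \<open>\<rho>^2\<close>.\<close>

lemma has_lap_poly_map:
  assumes "C2_on U u" "open U" "poly_map \<rho> c \<beta> z \<in> U"
  shows "has_lap (\<lambda>z. u (poly_map \<rho> c \<beta> z)) z (\<rho>\<^sup>2 * laplacian u (poly_map \<rho> c \<beta> z))"
proof -
  define x where "x = poly_map \<rho> c \<beta> z"
  obtain D2 where D2: "\<And>h. has_deriv2 (\<lambda>t. u (x + t *\<^sub>R h)) (blinfun_apply (blinfun_apply D2 h) h) 0"
    using C2_on_has_deriv2[OF assms(1,2)] assms(3) unfolding x_def by blast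
  define e1 e2 :: "real^2" where "e1 = axis 1 1" and "e2 = axis 2 1"
  have ne: "e1 \<noteq> e2" by (simp add: e1_def e2_def axis_eq_axis)
  have B: "Basis = {e1, e2}"
    by (auto simp: Basis_vec_def e1_def e2_def UNIV_2)
  have lap: "laplacian u x = D2 e1 e1 + D2 e2 e2"
    unfolding laplacian_def has_deriv2_deriv[OF D2] B using ne by simp
  have cv: "cvec w = Re w *\<^sub>R e1 + Im w *\<^sub>R e2" for w
    by (simp add: vec_eq_iff forall_2 e1_def e2_def axis_def)
  define h1 h2 where "h1 = \<rho> *\<^sub>R cvec (cis \<beta>)" and "h2 = \<rho> *\<^sub>R cvec (\<i> * cis \<beta>)"
  have line1: "poly_map \<rho> c \<beta> (z + of_real t) = x + t *\<^sub>R h1" for t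
    by (simp add: poly_map_def x_def h1_def distrib_right cv algebra_simps)
  have line2: "poly_map \<rho> c \<beta> (z + \<i> * of_real t) = x + t *\<^sub>R h2" for t
    by (simp add: poly_map_def x_def h2_def distrib_right cv algebra_simps)
  show ?thesis
  proof (rule has_lapI)
    show "has_deriv2 (\<lambda>t. u (poly_map \<rho> c \<beta> (z + of_real t))) (D2 h1 h1) 0" unfolding line1 by (rule D2)
    show "has_deriv2 (\<lambda>t. u (poly_map \<rho> c \<beta> (z + \<i> * of_real t))) (D2 h2 h2) 0" unfolding line2 by (rule D2)
    have "D2 h1 h1 + D2 h2 h2 = \<rho>\<^sup>2 * ((sin \<beta>)\<^sup>2 + (cos \<beta>)\<^sup>2) * (D2 e1 e1 + D2 e2 e2)"
      unfolding h1_def h2_def cv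
      by (simp add: blinfun.add_right blinfun.add_left blinfun.diff_right blinfun.diff_left
          blinfun.scaleR_right blinfun.scaleR_left blinfun.minus_right blinfun.minus_left power2_eq_square algebra_simps
          del: sin_cos_squared_add sin_cos_squared_add2 sin_cos_squared_add3)
    then show "\<rho>\<^sup>2 * laplacian u (poly_map \<rho> c \<beta> z) = D2 h1 h1 + D2 h2 h2"
      by (simp only: sin_cos_squared_add mult_1_right lap x_def[symmetric])
  qed
qed

text \<open>Rotation by \<open>2 pi k / n\<close> preserves the polygon, so
  \<open>lam = \<mu> \<rho>^2\<close> and the maximum are the same for all \<open>k\<close>; the
  choice of \<open>k\<close> later brings the vertex nearest to a given point to the apex. The
  maximum is interior because \<open>\<phi>\<close> is positive inside and zero on the
  frontier.\<close>

lemma polygon_eigenfunction_poly_map: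
  assumes n: "n \<ge> 3" and l: "l > 0"
    and eig: "principal_dirichlet_eigenfunction (regular_polygon n l c \<theta>) \<phi>"
  obtains lam M where
    "\<And>k. polygon_eigenfunction n (\<lambda>z. \<phi> (poly_map (inradius n l) c (\<theta> + 2 * pi * real k / real n) z)) lam M"
proof -
  define \<rho> where "\<rho> = inradius n l"
  define P where "P = regular_polygon n l c \<theta>"
  have n1: "n \<ge> 1" using n by simp
  have \<rho>: "\<rho> > 0" using l angle_bounds(5)[OF n] by (simp add: \<rho>_def inradius_def)
  note P = regular_polygon_eq[OF n l, of c \<theta>, folded P_def \<rho>_def]
  obtain \<mu> where e: "dirichlet_eigenfunction P \<mu> \<phi>" and pos: "\<And>x. x \<in> P \<Longrightarrow> \<phi> x > 0"
    using eig unfolding principal_dirichlet_eigenfunction_def P_def by blast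
  have C2: "C2_on P \<phi>" and cont: "continuous_on (closure P) \<phi>"
    and lap: "\<And>x. x \<in> P \<Longrightarrow> - laplacian \<phi> x = \<mu> * \<phi> x"
    and zero: "\<And>x. x \<in> frontier P \<Longrightarrow> \<phi> x = 0"
    using e unfolding dirichlet_eigenfunction_def by blast+
  have openP: "open P" by (simp add: P_def regular_polygon_def)
  have "compact (closure P)"
    unfolding P(2) by (intro compact_continuous_image continuous_on_poly_map compact_poly_closed[OF n])
  moreover have "0 \<in> poly_open n" using unit_ball_subset_poly_open[of n] by auto
  then obtain x1 where x1: "x1 \<in> P" using P(1) by blast
  ultimately obtain x0 where x0: "x0 \<in> closure P" "\<And>x. x \<in> closure P \<Longrightarrow> \<phi> x \<le> \<phi> x0"
    using continuous_attains_sup[of "closure P" \<phi>] cont closure_subset by blast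
  have x0P: "x0 \<in> P"
  proof (rule ccontr)
    assume "x0 \<notin> P"
    then have "\<phi> x0 = 0" using x0(1) zero openP by (simp add: frontier_def interior_open)
    moreover have "\<phi> x1 \<le> \<phi> x0" using x1 closure_subset x0(2) by blast
    ultimately show False using pos[OF x1] by simp
  qed
  have "polygon_eigenfunction n (\<lambda>z. \<phi> (poly_map \<rho> c (\<theta> + 2 * pi * real k / real n) z)) (\<mu> * \<rho>\<^sup>2) (\<phi> x0)" for k
  proof -
    define T where "T = poly_map \<rho> c (\<theta> + 2 * pi * real k / real n)"
    have T: "T z = poly_map \<rho> c \<theta> (z * cis (2 * pi * real k / real n))" for z
      unfolding T_def by (rule poly_map_rotate)
    have inj: "inj (poly_map \<rho> c \<theta>)" by (rule inj_poly_map[OF \<rho>])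
    have TP: "T z \<in> P \<longleftrightarrow> z \<in> poly_open n" for z
      unfolding T P(1) inj_image_mem_iff[OF inj] by (rule poly_rotate(2)[OF n1])
    have TK: "T z \<in> closure P \<longleftrightarrow> z \<in> poly_closed n" for z
      unfolding T P(2) inj_image_mem_iff[OF inj] by (rule poly_rotate(1)[OF n1])
    have "polygon_eigenfunction n (\<lambda>z. \<phi> (T z)) (\<mu> * \<rho>\<^sup>2) (\<phi> x0)"
      unfolding polygon_eigenfunction_def
    proof (intro conjI ballI)
      show "3 \<le> n" by (rule n)
      show "continuous_on (poly_closed n) (\<lambda>z. \<phi> (T z))"
      proof (rule continuous_on_compose2[OF cont])
        show "continuous_on (poly_closed n) T" unfolding T_def by (rule continuous_on_poly_map)
        show "T ` poly_closed n \<subseteq> closure P" using TK by blast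
      qed
      show "\<phi> (T z) > 0" if "z \<in> poly_open n" for z using that by (intro pos) (simp only: TP)
      show "\<phi> (T z) = 0" if "z \<in> poly_closed n - poly_open n" for z
        using that openP by (intro zero) (simp add: frontier_def interior_open TP TK)
      show "has_lap (\<lambda>z. \<phi> (T z)) z (- (\<mu> * \<rho>\<^sup>2) * \<phi> (T z))" if "z \<in> poly_open n" for z
      proof -
        have TzP: "T z \<in> P" using that by (simp only: TP)
        have "has_lap (\<lambda>z. \<phi> (T z)) z (\<rho>\<^sup>2 * laplacian \<phi> (T z))"
          unfolding T_def by (rule has_lap_poly_map[OF C2 openP]) (use TzP in \<open>simp add: T_def\<close>)
        moreover have "\<rho>\<^sup>2 * laplacian \<phi> (T z) = - (\<mu> * \<rho>\<^sup>2) * \<phi> (T z)"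
        proof -
          have "laplacian \<phi> (T z) = - (\<mu> * \<phi> (T z))" using lap[OF TzP] by linarith
          then show ?thesis by simp
        qed
        ultimately show ?thesis by simp
      qed
      show "\<phi> (T z) \<le> \<phi> x0" if "z \<in> poly_closed n" for z using that by (intro x0(2)) (simp only: TK)
      obtain z where "x0 = poly_map \<rho> c \<theta> z" using x0P unfolding P(1) by blast
      then have "x0 = T (z * cis (- (2 * pi * real k / real n)))"
        unfolding T mult.assoc cis_mult by simp
      then show "\<exists>z\<in>poly_open n. \<phi> (T z) = \<phi> x0" using x0P TP by metis
    qed
    then show ?thesis unfolding T_def .
  qed
  then show ?thesis using that unfolding \<rho>_def by blast
qed

section \<open>Normalisation and scaling\<close>

lemma MIN_scale:
  fixes f :: "nat \<Rightarrow> real"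
  assumes "a > 0" "n \<ge> 1"
  shows "(MIN i\<in>{..<n}. a * f i) = a * (MIN i\<in>{..<n}. f i)"
proof -
  have "mono (\<lambda>x. a * x)" using assms(1) by (intro monoI) simp
  from mono_Min_commute[OF this, of "f ` {..<n}"] show ?thesis
    using assms(2) by (simp add: image_image lessThan_empty_iff)
qed

text \<open>Meant for the exponent \<open>p - 2\<close>, which is positive for \<open>n = 3\<close>,
  zero for \<open>n = 4\<close> and negative afterwards, so that errors in the base must be
  controlled on both sides.\<close>

lemma powr_near_one:
  fixes x e :: real
  assumes "1 / 2 \<le> x" "x \<le> 2" "\<bar>e\<bar> \<le> 1"
  shows "1 / 2 \<le> x powr e" "x powr e \<le> 2"
proof -
  have "ln x \<le> ln 2" "ln (1 / 2) \<le> ln x" using assms by (intro ln_mono; simp)+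
  moreover have "ln (1 / 2 :: real) = - ln 2" by (simp add: ln_div)
  ultimately have "\<bar>ln x\<bar> \<le> ln 2" by linarith
  then have "\<bar>e * ln x\<bar> \<le> 1 * ln 2" unfolding abs_mult using assms(3) by (intro mult_mono) auto
  then have b: "e * ln x \<le> ln 2" "- ln 2 \<le> e * ln x" by (auto simp: abs_le_iff)
  have x: "x powr e = exp (e * ln x)" using assms by (simp add: powr_def)
  have "exp (e * ln x) \<le> exp (ln 2)" using b(1) by (simp only: exp_le_cancel_iff)
  then show "x powr e \<le> 2" by (simp add: x)
  have "exp (- ln 2) \<le> exp (e * ln x)" using b(2) by (simp only: exp_le_cancel_iff)
  then show "1 / 2 \<le> x powr e" by (simp add: x exp_minus)
qed

lemma measure_square_cbox:
  fixes c :: "real^2"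
  assumes "r \<ge> 0"
  shows "measure lborel (cbox (c - vec r) (c + vec r)) = (2 * r)\<^sup>2"
proof -
  have ne: "cbox (c - vec r) (c + vec r) \<noteq> {}"
    using assms by (auto simp: interval_ne_empty_cart)
  have "measure lborel (cbox (c - vec r) (c + vec r)) = (\<Prod>i\<in>UNIV. (c + vec r) $ i - (c - vec r) $ i)"
    by (rule content_cbox_cart[OF ne])
  also have "\<dots> = (2 * r)\<^sup>2" by (simp add: UNIV_2 power2_eq_square)
  finally show ?thesis .
qed

lemma L2_normalised_bounds:
  fixes f :: "real^2 \<Rightarrow> real"
  assumes norm: "L2_norm_on P f = 1" and r: "r \<ge> 0"
  shows "P \<subseteq> cbox (c - vec r) (c + vec r) \<Longrightarrow> (\<And>x. x \<in> P \<Longrightarrow> \<bar>f x\<bar> \<le> M) \<Longrightarrow> 1 \<le> M\<^sup>2 * (2 * r)\<^sup>2"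
    and "cbox (c - vec r) (c + vec r) \<subseteq> P \<Longrightarrow> a \<ge> 0 \<Longrightarrow>
      (\<And>x. x \<in> cbox (c - vec r) (c + vec r) \<Longrightarrow> a \<le> f x) \<Longrightarrow> a\<^sup>2 * (2 * r)\<^sup>2 \<le> 1"
proof -
  define Q where "Q = cbox (c - vec r) (c + vec r)"
  define g where "g = (\<lambda>x. indicator P x *\<^sub>R (f x)\<^sup>2)"
  have int1: "integral\<^sup>L lborel g = 1"
    using norm unfolding L2_norm_on_def set_lebesgue_integral_def g_def by simp
  \<comment> \<open>A function that is not integrable has integral 0 by convention, so the value 1
    forces integrability.\<close>
  then have g: "integrable lborel g" using not_integrable_integral_eq by fastforce
  have Qint: "integrable lborel (\<lambda>x. indicator Q x * k)" "integral\<^sup>L lborel (\<lambda>x. indicator Q x * k) = k * (2 * r)\<^sup>2" for k :: real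
  proof -
    have "integrable lborel (indicat_real Q)"
      using emeasure_lborel_cbox_finite[of "c - vec r" "c + vec r"]
      unfolding Q_def by (simp add: integrable_indicator_iff)
    then show "integrable lborel (\<lambda>x. indicator Q x * k)" by simp
    have "integral\<^sup>L lborel (\<lambda>x. indicator Q x * k) = measure lborel Q * k" by (simp add: Q_def)
    then show "integral\<^sup>L lborel (\<lambda>x. indicator Q x * k) = k * (2 * r)\<^sup>2"
      unfolding Q_def measure_square_cbox[OF r] by simp
  qed
  {
    assume sub: "P \<subseteq> cbox (c - vec r) (c + vec r)" and M: "\<And>x. x \<in> P \<Longrightarrow> \<bar>f x\<bar> \<le> M"
    have "integral\<^sup>L lborel g \<le> integral\<^sup>L lborel (\<lambda>x. indicator Q x * M\<^sup>2)"
    proof (rule integral_mono[OF g Qint(1)])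
      fix x
      show "g x \<le> indicator Q x * M\<^sup>2"
      proof (cases "x \<in> P")
        case True
        have "\<bar>f x\<bar>\<^sup>2 \<le> M\<^sup>2" using M[OF True] by (intro power_mono) auto
        moreover have "x \<in> Q" using True sub Q_def by blast
        ultimately show ?thesis using True by (simp add: g_def)
      qed (simp add: g_def indicator_def)
    qed
    then show "1 \<le> M\<^sup>2 * (2 * r)\<^sup>2" by (simp only: int1 Qint(2))
  next
    assume sub: "cbox (c - vec r) (c + vec r) \<subseteq> P" and a: "a \<ge> 0" "\<And>x. x \<in> cbox (c - vec r) (c + vec r) \<Longrightarrow> a \<le> f x"
    have "integral\<^sup>L lborel (\<lambda>x. indicator Q x * a\<^sup>2) \<le> integral\<^sup>L lborel g"
    proof (rule integral_mono[OF Qint(1) g])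
      fix x
      show "indicator Q x * a\<^sup>2 \<le> g x"
      proof (cases "x \<in> Q")
        case True
        have "a\<^sup>2 \<le> (f x)\<^sup>2" using a True Q_def by (intro power_mono) auto
        moreover have "x \<in> P" using True sub Q_def by blast
        ultimately show ?thesis using True by (simp add: g_def)
      qed (simp add: g_def indicator_def)
    qed
    then show "a\<^sup>2 * (2 * r)\<^sup>2 \<le> 1" by (simp only: int1 Qint(2))
  }
qed

text \<open>The polygon lies in a square of half-side \<open>2 \<rho>\<close>, where
  \<open>\<phi> \<le> M\<close>. It contains one of half-side \<open>\<rho> / 4\<close>, whose
  preimage satisfies \<open>|z|^2 \<le> 1 / 2\<close>, so that there \<open>\<phi>\<close> is at
  least \<open>disc_const * M / 2\<close>.\<close>

lemma max_bounds:
  assumes n: "n \<ge> 3" and l: "l > 0"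
    and eig: "\<And>k. polygon_eigenfunction n (\<lambda>z. \<phi> (poly_map (inradius n l) c (\<theta> + 2 * pi * real k / real n) z)) lam M"
    and norm: "L2_norm_on (regular_polygon n l c \<theta>) \<phi> = 1"
  shows "1 \<le> 4 * (M * inradius n l)" "disc_const * (M * inradius n l) \<le> 4" "M > 0"
proof -
  define \<rho> where "\<rho> = inradius n l"
  define P where "P = regular_polygon n l c \<theta>"
  have \<rho>: "\<rho> > 0" using l angle_bounds(5)[OF n] by (simp add: \<rho>_def inradius_def)
  define T where "T = poly_map \<rho> c \<theta>"
  have "polygon_eigenfunction n (\<lambda>z. \<phi> (T z)) lam M"
    using eig[of 0] by (simp add: T_def \<rho>_def)
  note M_pos = eigen_max_pos[OF this] and pos = eigen_pos[OF this]
    and bound = eigen_le_max[OF this] and disc_lower_bound = eigen_disc_lower_bound[OF this]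
  have P: "P = T ` poly_open n" unfolding P_def T_def \<rho>_def by (rule regular_polygon_eq(1)[OF n l])
  show "M > 0" by (rule M_pos)
  have "1 \<le> M\<^sup>2 * (2 * (2 * \<rho>))\<^sup>2"
  proof (rule L2_normalised_bounds(1)[OF norm[folded P_def], where c = c])
    show "\<bar>\<phi> x\<bar> \<le> M" if xP: "x \<in> P" for x
    proof -
      obtain z where z: "z \<in> poly_open n" "x = T z" using xP unfolding P by blast
      then have "z \<in> poly_closed n" using poly_open_subset_closed by blast
      then show ?thesis using pos[OF z(1)] bound z(2) by simp
    qed
    show "P \<subseteq> cbox (c - vec (2 * \<rho>)) (c + vec (2 * \<rho>))"
    proof
      fix x assume "x \<in> P"
      then obtain z where z: "z \<in> poly_open n" "x = T z" unfolding P by blast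
      have "cmod (z * cis \<theta>) \<le> 2"
        using poly_closed_bounded[OF n, of z] z(1) poly_open_subset_closed[of n] by (auto simp: norm_mult)
      then have "\<bar>Re (z * cis \<theta>)\<bar> \<le> 2" "\<bar>Im (z * cis \<theta>)\<bar> \<le> 2"
        using abs_Re_le_cmod[of "z * cis \<theta>"] abs_Im_le_cmod[of "z * cis \<theta>"] by linarith+
      then have "\<bar>\<rho> * Re (z * cis \<theta>)\<bar> \<le> \<rho> * 2" "\<bar>\<rho> * Im (z * cis \<theta>)\<bar> \<le> \<rho> * 2"
        unfolding abs_mult using \<rho> by (auto intro!: mult_mono)
      then show "x \<in> cbox (c - vec (2 * \<rho>)) (c + vec (2 * \<rho>))"
        unfolding z(2) T_def poly_map_def mem_box_cart forall_2
        by (simp only: abs_le_iff vector_add_component vector_minus_component vector_scaleR_component vec_component cvec_nth real_scaleR_def) linarith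
    qed
  qed (use \<rho> in simp)
  also have "M\<^sup>2 * (2 * (2 * \<rho>))\<^sup>2 = (4 * (M * \<rho>))\<^sup>2" by (simp add: power_mult_distrib)
  finally have "1\<^sup>2 \<le> (4 * (M * \<rho>))\<^sup>2" by simp
  then have "1 \<le> 4 * (M * \<rho>)" by (rule power2_le_imp_le) (use M_pos \<rho> in simp)
  then show "1 \<le> 4 * (M * inradius n l)" by (simp add: \<rho>_def)
  have box: "\<exists>z. x = T z \<and> (cmod z)\<^sup>2 \<le> 1 / 2" if x: "x \<in> cbox (c - vec (\<rho> / 4)) (c + vec (\<rho> / 4))" for x
  proof -
    define w where "w = Complex ((x $ 1 - c $ 1) / \<rho>) ((x $ 2 - c $ 2) / \<rho>)"
    have "\<bar>x $ 1 - c $ 1\<bar> \<le> \<rho> / 4" "\<bar>x $ 2 - c $ 2\<bar> \<le> \<rho> / 4"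
      using x unfolding mem_box_cart forall_2
      by (simp_all only: abs_le_iff vector_add_component vector_minus_component vec_component) linarith+
    then have "\<bar>Re w\<bar> \<le> 1 / 4" "\<bar>Im w\<bar> \<le> 1 / 4" using \<rho> by (auto simp: w_def abs_divide field_simps)
    then have "(Re w)\<^sup>2 \<le> (1 / 4)\<^sup>2" "(Im w)\<^sup>2 \<le> (1 / 4)\<^sup>2"
      using power_mono[of "\<bar>Re w\<bar>" "1/4" 2] power_mono[of "\<bar>Im w\<bar>" "1/4" 2] by auto
    then have "(cmod w)\<^sup>2 \<le> 1 / 2" unfolding cmod_power2 by (simp add: power2_eq_square)
    moreover have "x = T (w * cis (- \<theta>))"
    proof -
      have "T (w * cis (- \<theta>)) = c + \<rho> *\<^sub>R cvec w" unfolding T_def poly_map_def mult.assoc cis_mult by simp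
      also have "\<dots> = x" using \<rho> by (simp add: vec_eq_iff forall_2 w_def)
      finally show ?thesis by simp
    qed
    ultimately show ?thesis by (intro exI[of _ "w * cis (- \<theta>)"]) (simp add: norm_mult)
  qed
  have "(disc_const * M / 2)\<^sup>2 * (2 * (\<rho> / 4))\<^sup>2 \<le> 1"
  proof (rule L2_normalised_bounds(2)[OF norm[folded P_def], where c = c])
    show "0 \<le> disc_const * M / 2" using const_pos M_pos by simp
    fix x assume "x \<in> cbox (c - vec (\<rho> / 4)) (c + vec (\<rho> / 4))"
    then obtain z where z: "x = T z" "(cmod z)\<^sup>2 \<le> 1 / 2" using box by blast
    have "(cmod z)\<^sup>2 \<le> 1\<^sup>2" using z(2) by simp
    then have z1: "z \<in> cball 0 1" using power2_le_imp_le[of "cmod z" 1] by simp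
    have "disc_const * M * (1 / 2) \<le> disc_const * M * (1 - (cmod z)\<^sup>2)"
      using z(2) const_pos M_pos by (intro mult_left_mono) auto
    also have "\<dots> \<le> \<phi> (T z)" by (rule disc_lower_bound[OF z1])
    finally show "disc_const * M / 2 \<le> \<phi> x" by (simp add: z(1))
  next
    show "cbox (c - vec (\<rho> / 4)) (c + vec (\<rho> / 4)) \<subseteq> P"
    proof
      fix x assume "x \<in> cbox (c - vec (\<rho> / 4)) (c + vec (\<rho> / 4))"
      then obtain z where z: "x = T z" "(cmod z)\<^sup>2 \<le> 1 / 2" using box by blast
      have "(cmod z)\<^sup>2 < 1\<^sup>2" using z(2) by simp
      then have "cmod z < 1" by (rule power_less_imp_less_base) simp
      then show "x \<in> P" unfolding P z(1) using unit_ball_subset_poly_open[of n] by auto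
    qed
  qed (use \<rho> in simp)
  moreover have "(disc_const * M / 2)\<^sup>2 * (2 * (\<rho> / 4))\<^sup>2 = (disc_const * (M * \<rho>) / 4)\<^sup>2"
    by (simp add: power2_eq_square)
  ultimately have "(disc_const * (M * \<rho>) / 4)\<^sup>2 \<le> 1\<^sup>2" by simp
  then have "disc_const * (M * \<rho>) / 4 \<le> 1" by (rule power2_le_imp_le) simp
  then show "disc_const * (M * inradius n l) \<le> 4" by (simp add: \<rho>_def)
qed

text \<open>\<open>y = 2 n tan (pi / n)\<close> is the perimeter of the polygon of inradius 1; it is
  at least 3 and, as \<open>tan h \<le> 2 h\<close>, at most 4 pi.\<close>

lemma perimeter_ratio:
  assumes n: "n \<ge> 3" and l: "l > 0"
  obtains y where "real n * l = inradius n l * y" "1 \<le> y" "y \<le> 16"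
proof -
  define h where "h = pi / real n"
  note ab = angle_bounds[OF n, folded h_def]
  define y where "y = 2 * real n * tan h"
  have "real n * l = inradius n l * y" using ab(5) by (simp add: inradius_def y_def h_def)
  moreover have "1 \<le> y"
  proof -
    have "2 * real n * (3 / (2 * real n)) \<le> y"
      unfolding y_def using tan_angle_bound(3)[OF n] by (intro mult_left_mono) (auto simp: h_def)
    then show ?thesis using n by simp
  qed
  moreover have "y \<le> 16"
  proof -
    have "sin h \<le> h" using ab(1) by (intro sin_x_le_x) simp
    then have "sin h / cos h \<le> h / (1 / 2)" using ab by (intro frac_le) auto
    then have "y \<le> 2 * real n * (h / (1 / 2))" unfolding y_def tan_def by (intro mult_left_mono) auto
    also have "\<dots> = 4 * pi" using n by (simp add: h_def)
    finally show ?thesis using pi_less_4 by linarith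
  qed
  ultimately show ?thesis using that by blast
qed

text \<open>\<open>B\<close> has degree \<open>2 + (p - 2) - (p + 1) = -1\<close> in
  \<open>\<rho>\<close>, so \<open>B \<rho>\<close> is free of scale. The loss 262144 is 2 * 2 from
  \<open>D\<close> and \<open>S\<close> times 16^4 from the perimeter.\<close>

lemma profile_scaling:
  fixes \<rho> r m y D S p :: real
  assumes \<rho>: "\<rho> > 0" and r: "r > 0" and m: "m > 0" and y: "1 \<le> y" "y \<le> 16" and p: "1 \<le> p" "p \<le> 3"
    and D: "m * r / 2 \<le> D" "D \<le> m * r" and S: "r / 2 \<le> S" "S \<le> 2 * r"
  defines "B \<equiv> (\<rho>\<^sup>2 * D) * (\<rho> * S) powr (p - 2) / (\<rho> * y) powr (p + 1)"
    and "Q \<equiv> m * r powr (p - 1)"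
  shows "Q / 262144 \<le> B * \<rho>" "B * \<rho> \<le> 2 * Q"
proof -
  have S0: "S > 0" using S r by linarith
  define x where "x = S / r"
  have x: "1 / 2 \<le> x" "x \<le> 2" using S r by (auto simp: x_def field_simps)
  have px: "1 / 2 \<le> x powr (p - 2)" "x powr (p - 2) \<le> 2"
    using powr_near_one[OF x, of "p - 2"] p by auto
  have Sx: "S = r * x" using r by (simp add: x_def)
  have yp: "1 \<le> y powr (p + 1)" "y powr (p + 1) \<le> 65536"
  proof -
    show "1 \<le> y powr (p + 1)" using y p by (intro ge_one_powr_ge_zero) auto
    have "y powr (p + 1) \<le> 16 powr (p + 1)" using y p by (intro powr_mono2) auto
    also have "\<dots> \<le> 16 powr 4" using p by (intro powr_mono) auto
    finally show "y powr (p + 1) \<le> 65536" by simp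
  qed
  define q where "q = m * r * r powr (p - 2)"
  have q: "q = Q" 
  proof -
    have "r powr (p - 1) = r powr (p - 2) * r powr 1" by (simp only: powr_add[symmetric]) simp
    then show ?thesis using r by (simp add: q_def Q_def)
  qed
  have Q0: "Q > 0" using m r by (simp add: Q_def)
  have "\<rho> powr (p + 1) = \<rho> powr (p - 2) * \<rho> powr 3" by (simp only: powr_add[symmetric]) (simp add: add.commute)
  then have rp: "\<rho> powr (p + 1) = \<rho> powr (p - 2) * (\<rho>\<^sup>2 * \<rho>)" using \<rho> by (simp add: power2_eq_square power3_eq_cube)
  have B: "B * \<rho> = D * S powr (p - 2) / y powr (p + 1)"
  proof -
    have e: "(\<rho> * S) powr (p - 2) = \<rho> powr (p - 2) * S powr (p - 2)"
      "(\<rho> * y) powr (p + 1) = \<rho> powr (p + 1) * y powr (p + 1)"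
      using \<rho> S0 y by (auto simp: powr_mult)
    define a where "a = \<rho> powr (p - 2)"
    have "a > 0" using \<rho> by (simp add: a_def)
    then show ?thesis unfolding B_def e rp a_def[symmetric] using \<rho> by (simp add: field_simps)
  qed
  have Sp: "S powr (p - 2) = r powr (p - 2) * x powr (p - 2)" using r x by (simp add: Sx powr_mult)
  have D0: "D > 0" using D(1) mult_pos_pos[OF m r] by linarith
  have up: "D * S powr (p - 2) \<le> 2 * Q"
  proof -
    have "D * S powr (p - 2) \<le> (m * r) * (r powr (p - 2) * 2)"
      unfolding Sp using D px m r by (intro mult_mono mult_left_mono) auto
    then show ?thesis using q by (simp add: q_def)
  qed
  have lo: "Q / 4 \<le> D * S powr (p - 2)"
  proof -
    have "(m * r / 2) * (r powr (p - 2) * (1 / 2)) \<le> D * S powr (p - 2)"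
      unfolding Sp using D px m r D0 by (intro mult_mono mult_left_mono) auto
    then show ?thesis using q by (simp add: q_def)
  qed
  have "D * S powr (p - 2) / y powr (p + 1) \<le> D * S powr (p - 2) / 1"
    using yp D0 S0 by (intro divide_left_mono) auto
  then show "B * \<rho> \<le> 2 * Q" using up unfolding B by simp
  have "(Q / 4) / 65536 \<le> D * S powr (p - 2) / y powr (p + 1)"
    using lo yp Q0 by (intro frac_le) auto
  then show "Q / 262144 \<le> B * \<rho>" unfolding B by simp
qed

text \<open>The second term collects the upper bound: the two-sided estimate,
  \<open>M \<rho> \<le> 4 / disc_const\<close> and \<open>profile_scaling\<close>. The third
  collects the lower bound, 768 = 96 * 4 * 2. The summand 1 makes the constant at least 1.\<close>

definition profile_const :: real where
  "profile_const = 1 + 331776 * 4 * 262144 / disc_const + 768 / disc_const"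

text \<open>The normalisation makes \<open>M\<close> of order \<open>1 / \<rho>\<close>, which
  matches the degree -1 of \<open>B\<close>. Here \<open>d\<close> and \<open>B\<close> are given by
  equations, so that \<open>refl\<close> can supply the expressions bound by \<open>let\<close> in
  the theorem.\<close>

lemma principal_eigenfunction_profile:
  assumes n: "n \<ge> 3" and l: "l > 0"
    and eig: "principal_dirichlet_eigenfunction (regular_polygon n l c \<theta>) \<phi>"
    and norm: "L2_norm_on (regular_polygon n l c \<theta>) \<phi> = 1"
    and x: "x \<in> regular_polygon n l c \<theta>"
    and d: "d = (\<lambda>i. side_dist n l c \<theta> i x)"
    and B: "B = (MIN i\<in>{..<n}. d i * d (Suc i mod n)) *
               (MIN i\<in>{..<n}. d i + d (Suc i mod n)) powr (real n / (real n - 2) - 2) /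
               (real n * l) powr (real n / (real n - 2) + 1)"
  shows "inverse profile_const * B \<le> \<phi> x \<and> \<phi> x \<le> profile_const * B"
proof -
  define K where "K = 331776 * 4 * 262144 / disc_const"
  define K' where "K' = 768 / disc_const"
  define C where "C = 1 + K + K'"
  have K: "K > 0" "K' > 0" using const_pos by (auto simp: K_def K'_def)
  have C: "C \<ge> 1" "C > 0" "K \<le> C" "K' \<le> C" using K by (auto simp: C_def)
  have n1: "n \<ge> 1" using n by simp
  define \<rho> where "\<rho> = inradius n l"
  have \<rho>: "\<rho> > 0" using l angle_bounds(5)[OF n] by (simp add: \<rho>_def inradius_def)
  define p where "p = corner_exp n"
  obtain lam M where loc:
    "\<And>k. polygon_eigenfunction n (\<lambda>z. \<phi> (poly_map \<rho> c (\<theta> + 2 * pi * real k / real n) z)) lam M"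
    using polygon_eigenfunction_poly_map[OF n l eig] unfolding \<rho>_def by blast
  note mb = max_bounds[OF n l loc[unfolded \<rho>_def] norm, folded \<rho>_def]
  obtain z where z: "z \<in> poly_open n" "x = poly_map \<rho> c \<theta> z"
    using x unfolding regular_polygon_eq(1)[OF n l] \<rho>_def by blast
  obtain k where k: "k < n" "z * cis (- (2 * pi * real k / real n)) \<in> vsector n"
    using vsector_rotate_ex[OF n1] by blast
  define w where "w = z * cis (- (2 * pi * real k / real n))"
  have wD: "w \<in> poly_open n" unfolding w_def poly_rotate_back(2)[OF n1] by (rule z(1))
  have wK: "w \<in> poly_closed n" and zK: "z \<in> poly_closed n"
    using wD z(1) poly_open_subset_closed by blast+
  define m where "m = corner_gap n w"
  define r where "r = cmod (apex n - w)"
  have m: "m > 0" using wD n by (simp add: m_def corner_gap_def poly_open_def)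
  have r: "r > 0" using corner_gap_le_dist[OF n, of w] m unfolding m_def r_def by linarith
  define pd where "pd = (\<lambda>i. poly_side_dist n i z)"
  have dd: "d i = \<rho> * pd i" for i
    unfolding d z(2) pd_def \<rho>_def by (rule side_dist_poly_map[OF n l])
  define D where "D = (MIN i\<in>{..<n}. pd i * pd (Suc i mod n))"
  define S where "S = (MIN i\<in>{..<n}. pd i + pd (Suc i mod n))"
  have ds: "m * r / 2 \<le> D" "D \<le> m * r" "r / 2 \<le> S" "S \<le> 2 * r"
    unfolding D_def S_def pd_def m_def r_def w_def
    by (rule poly_side_dist_bounds[OF n k(1) zK k(2)])+
  have "(MIN i\<in>{..<n}. d i * d (Suc i mod n)) = (MIN i\<in>{..<n}. \<rho>\<^sup>2 * (pd i * pd (Suc i mod n)))"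
    unfolding dd by (simp add: power2_eq_square mult_ac)
  also have "\<dots> = \<rho>\<^sup>2 * D" unfolding D_def by (rule MIN_scale) (use \<rho> n1 in auto)
  finally have mD: "(MIN i\<in>{..<n}. d i * d (Suc i mod n)) = \<rho>\<^sup>2 * D" .
  have "(MIN i\<in>{..<n}. d i + d (Suc i mod n)) = (MIN i\<in>{..<n}. \<rho> * (pd i + pd (Suc i mod n)))"
    unfolding dd by (simp add: distrib_left)
  also have "\<dots> = \<rho> * S" unfolding S_def by (rule MIN_scale) (use \<rho> n1 in auto)
  finally have mS: "(MIN i\<in>{..<n}. d i + d (Suc i mod n)) = \<rho> * S" .
  obtain y where y: "real n * l = \<rho> * y" "1 \<le> y" "y \<le> 16"
    using perimeter_ratio[OF n l] unfolding \<rho>_def by blast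
  have B': "B = (\<rho>\<^sup>2 * D) * (\<rho> * S) powr (p - 2) / (\<rho> * y) powr (p + 1)"
    unfolding B mD mS y(1) p_def corner_exp_def ..
  define Q where "Q = m * r powr (p - 1)"
  note ps = profile_scaling[OF \<rho> r m y(2,3) corner_exp_bounds(1,2)[OF n, folded p_def] ds,
    folded B' Q_def]
  have Q0: "Q > 0" using m r by (simp add: Q_def)
  have "B * \<rho> > 0" using ps(1) Q0 by linarith
  then have B0: "B > 0" using \<rho> by (simp add: zero_less_mult_iff)
  have xw: "x = poly_map \<rho> c (\<theta> + 2 * pi * real k / real n) w"
    unfolding z(2) poly_map_rotate w_def mult.assoc cis_mult by simp
  have ub: "\<phi> x \<le> 331776 * M * Q" and lb: "disc_const / 96 * M * Q \<le> \<phi> x"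
    unfolding xw Q_def m_def r_def p_def
    using eigen_two_sided_bound[OF loc wK k(2)[folded w_def]] by blast+
  have "\<phi> x \<le> C * B"
  proof -
    have "M \<le> 4 / (disc_const * \<rho>)" using mb(2) const_pos \<rho> by (simp add: field_simps)
    then have "331776 * M * Q \<le> 331776 * (4 / (disc_const * \<rho>)) * (262144 * (B * \<rho>))"
      using ps(1) Q0 mb(3) const_pos \<rho> by (intro mult_mono) auto
    also have "\<dots> = K * B" using \<rho> by (simp add: K_def)
    also have "\<dots> \<le> C * B" using C B0 by (intro mult_right_mono) auto
    finally show ?thesis using ub by simp
  qed
  moreover have "inverse C * B \<le> \<phi> x"
  proof -
    have "inverse C * B \<le> inverse K' * B"
      using C K B0 by (intro mult_right_mono le_imp_inverse_le) auto
    also have "\<dots> = disc_const / 96 * (1 / (4 * \<rho>)) * (B * \<rho> / 2)" using \<rho> by (simp add: K'_def)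
    also have "\<dots> \<le> disc_const / 96 * M * Q"
    proof (intro mult_mono mult_left_mono)
      show "1 / (4 * \<rho>) \<le> M" using mb(1) \<rho> by (simp add: field_simps)
    qed (use ps(2) B0 \<rho> Q0 mb(3) const_pos in auto)
    finally show ?thesis using lb by simp
  qed
  ultimately show ?thesis by (simp add: profile_const_def C_def K_def K'_def)
qed

theorem theorem2p7:
  "\<exists>C::real. C \<ge> 1 \<and>
     (\<forall>(n::nat) (l::real) (c::real^2) (\<theta>::real) (\<phi>::real^2 \<Rightarrow> real) (x::real^2).
        n \<ge> 3 \<longrightarrow> l > 0 \<longrightarrow>
        principal_dirichlet_eigenfunction (regular_polygon n l c \<theta>) \<phi> \<longrightarrow>
        L2_norm_on (regular_polygon n l c \<theta>) \<phi> = 1 \<longrightarrow>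
        x \<in> regular_polygon n l c \<theta> \<longrightarrow>
        (let d = (\<lambda>i. side_dist n l c \<theta> i x);
             B = (MIN i\<in>{..<n}. d i * d (Suc i mod n)) *
                 (MIN i\<in>{..<n}. d i + d (Suc i mod n)) powr (real n / (real n - 2) - 2) /
                 (real n * l) powr (real n / (real n - 2) + 1)
         in inverse C * B \<le> \<phi> x \<and> \<phi> x \<le> C * B))"
proof -
  have "1 \<le> profile_const" using const_pos by (simp add: profile_const_def)
  then show ?thesis
    unfolding Let_def using principal_eigenfunction_profile[OF _ _ _ _ _ refl refl] by blast
qed

end
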